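(* Let $(X,T)$ be Ohno's subshift and, for a roof function $\gamma:X_*\to(0,+\infty)$, let $(X^\gamma,\Phi^\gamma)$ be the associated suspension flow compactified by one fixed point; let $(X^1,\Phi^1)$ be the one with constant roof function $1$ (all as defined in the context). It is known that $h(\Phi^1)=h(T)>0$. Then for every real number $b\in(0,h(T))$ there exist a roof function $\gamma:X_*\to(0,+\infty)$, with associated flow $(X^\gamma,\Phi^\gamma)$, and a measure $\nu\in \mathrm{M}_{erg,\Phi^\gamma}$ such that $h_\nu(\Phi^\gamma)=b$.
   Context: Entropy of flows. A flow on a compact metric space $Z$ is a continuous map $\phi:Z\times\mathbb R\to Z$ with $\phi_0=\mathrm{id}$ and $\phi_t\circ\phi_s=\phi_{t+s}$, where $\phi_t=\phi(\cdot,t)$. $\mathrm{M}_{erg,\phi}$ is the set of Borel probability measures that are invariant and ergodic for the flow $\phi$. The measure-theoretic entropy is $h_\mu(\phi)=h_\mu(\phi_1)$ and the topological entropy is $h(\phi)=h(\phi_1)$. Ohno's subshift. Let $\Sigma(2)=\{0,1\}^{\mathbb Z}$ with the product topology and $T$ the shift $(x_i)\mapsto(x_{i+1})$. For a finite word $w$, write $w\succ I_n$ if $w$ contains $2n-1$ consecutive symbols $1$. Let $\alpha$ be a placeholder symbol, to be replaced by $0$ or $1$. Put $x_1=1\alpha$, $\tilde x_1=11$, and inductively $x_n=x_{n-1}\tilde x_{n-1}x_{n-1}$, where $\tilde x_n$ is obtained from $x_n$ by changing one $\alpha$ to $1$ in such a way that $\tilde x_n\succ I_n$. The words $x_n,\tilde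 x_n$ have length $2\cdot 3^{n-1}$, $x_n$ contains exactly $p_n=\frac{3^{n-1}+1}{2}$ symbols $\alpha$, and $x_n$ is a prefix of $x_{n+1}$, so $x^+=\lim_n x_n\in\{1,\alpha\}^{\mathbb N}$ exists (indexed from $1$). Modify $x^+$ as follows: going from left to right, successively for $n=1,2,\dots$, choose $2^{p_n}$ occurrences of the block $x_n$ in the part of the sequence not yet treated, fill their $\alpha$'s with $0$'s and $1$'s so that all $2^{p_n}$ possible fillings of $x_n$ occur, and replace all other $\alpha$'s to the left of the end of the last chosen block by $1$. The resulting sequence in $\{0,1\}^{\mathbb N}$ is again denoted $x^+$. Define $x^*\in\Sigma(2)$ by $x^*(k)=x^+(k)$ for $k\ge1$, $x^*(0)=0$, $x^*(k)=x^+(-k)$ for $k\le-1$. It satisfies: (1) for all $k\in\mathbb Z$, $n\ge1$, $x^*(k)x^*(k+1)\cdots x^*(k+4\cdot3^n)\succ I_n$; (2) for all $n\ge2$, $x^*$ contains at least $2^{p_n}$ distinct finite subwords of length $2\cdot3^{n-1}$. Let $X=\overline{\{T^nx^*:n\in\mathbb Z\}}$, a compact $T$-invariant set, and $T=T|_X$; $h(T)$ is its topological entropy. $(X,T)$ has a unique fixed point, the all-ones sequence, denoted $1$. Put $X_*=X\setminus\{1\}$ (locally compact). Suspension flows. A roof function is a positive continuous function $\gamma:X_*\to(0,+\infty)$. Let $X_*^\gamma$ be the quotient of $\{(x,u):x\in X_*,\ 0\le u\le\gamma(x)\}$ by $(x,\gamma(x))\sim(Tx,0)$, with the suspension flow determined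 by $\varphi^\gamma_t(x,u)=(x,u+t)$ for $-u\le t<\gamma(x)-u$. Let $X^\gamma=X_*^\gamma\cup\{\Delta\}$ be the one-point compactification, a compact metric space in which $(x_n,u_n)\to\Delta$ if and only if $x_n\to1$ in $X$. The flow $\Phi^\gamma$ on $X^\gamma$ extends $\varphi^\gamma$ by $\Phi^\gamma_t(\Delta)=\Delta$ for all $t$. $\Phi^1$ on $X^1$ denotes the case $\gamma\equiv1$. *)

theory Defs
  imports "HOL-Probability.Probability"
begin

section \<open>Entropy\<close>

text \<open>The join \<open>P \<or> f\<^sup>-\<^sup>1 P \<or> \<dots> \<or> f\<^sup>-\<^sup>(\<^sup>n\<^sup>-\<^sup>1\<^sup>) P\<close> of a partition or a cover \<open>P\<close> of \<open>S\<close>.\<close>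

definition iter_join :: "'a set \<Rightarrow> ('a \<Rightarrow> 'a) \<Rightarrow> 'a set set \<Rightarrow> nat \<Rightarrow> 'a set set" where
  "iter_join S f P n = {S \<inter> (\<Inter>i<n. (f ^^ i) -` A i) | A. \<forall>i<n. A i \<in> P}"

text \<open>Recall \<open>ln 0 = 0\<close>, so null sets (in particular an empty member of a join) contribute 0.\<close>

definition partition_entropy :: "'a measure \<Rightarrow> 'a set set \<Rightarrow> real" where
  "partition_entropy M P = (\<Sum>A\<in>P. - (measure M A * ln (measure M A)))"

definition measure_entropy :: "'a measure \<Rightarrow> ('a \<Rightarrow> 'a) \<Rightarrow> ereal" where
  "measure_entropy M f =
     (SUP P \<in> {P. finite P \<and> partition_on (space M) P \<and> P \<subseteq> sets M}.
        ereal (lim (\<lambda>n. partition_entropy M (iter_join (space M) f P n) / real n)))"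

definition min_subcover_card :: "'a set \<Rightarrow> 'a set set \<Rightarrow> nat" where
  "min_subcover_card S U = (LEAST k. \<exists>V. V \<subseteq> U \<and> finite V \<and> card V = k \<and> S \<subseteq> \<Union>V)"

text \<open>Topological entropy of a continuous self-map of a compact space, in the sense of
  Adler, Konheim and McAndrew.\<close>

definition topological_entropy :: "'a topology \<Rightarrow> ('a \<Rightarrow> 'a) \<Rightarrow> ereal" where
  "topological_entropy Z f =
     (SUP U \<in> {U. (\<forall>W\<in>U. openin Z W) \<and> \<Union>U = topspace Z}.
        ereal (lim (\<lambda>n. ln (real (min_subcover_card (topspace Z) (iter_join (topspace Z) f U n)))
                        / real n)))"

section \<open>Flows\<close>

definition is_flow :: "'a topology \<Rightarrow> (real \<Rightarrow> 'a \<Rightarrow> 'a) \<Rightarrow> bool" where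
  "is_flow Z \<phi> \<longleftrightarrow>
     continuous_map (prod_topology Z euclideanreal) Z (\<lambda>(z, t). \<phi> t z) \<and>
     (\<forall>z\<in>topspace Z. \<phi> 0 z = z) \<and>
     (\<forall>z\<in>topspace Z. \<forall>s t. \<phi> t (\<phi> s z) = \<phi> (t + s) z)"

definition borel_of :: "'a topology \<Rightarrow> 'a measure" where
  "borel_of Z = sigma (topspace Z) {U. openin Z U}"

definition ergodic_measures :: "'a topology \<Rightarrow> (real \<Rightarrow> 'a \<Rightarrow> 'a) \<Rightarrow> 'a measure set" where
  "ergodic_measures Z \<phi> =
     {\<mu>. sets \<mu> = sets (borel_of Z) \<and> prob_space \<mu> \<and>
         (\<forall>t. \<forall>A\<in>sets \<mu>. emeasure \<mu> (\<phi> t -` A \<inter> space \<mu>) = emeasure \<mu> A) \<and>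
         (\<forall>A\<in>sets \<mu>. (\<forall>t. \<phi> t -` A \<inter> space \<mu> = A) \<longrightarrow> measure \<mu> A = 0 \<or> measure \<mu> A = 1)}"

definition flow_measure_entropy :: "'a measure \<Rightarrow> (real \<Rightarrow> 'a \<Rightarrow> 'a) \<Rightarrow> ereal" where
  "flow_measure_entropy \<mu> \<phi> = measure_entropy \<mu> (\<phi> 1)"

section \<open>Ohno's subshift\<close>

text \<open>\<open>\<Sigma>(2)\<close> is the type \<open>int \<Rightarrow> bool\<close> with \<open>False\<close> for 0 and \<open>True\<close> for 1; its topology is the
  product topology of the discrete topology on \<open>bool\<close>.\<close>

type_synonym config = "int \<Rightarrow> bool"

definition shift_map :: "config \<Rightarrow> config" where
  "shift_map x = (\<lambda>i. x (i + 1))"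

text \<open>Words over \<open>{0, 1, \<alpha>}\<close>: \<open>None\<close> is the placeholder \<open>\<alpha>\<close>.\<close>

type_synonym symbol = "bool option"

abbreviation sym_one :: symbol where "sym_one \<equiv> Some True"
abbreviation placeholder :: symbol where "placeholder \<equiv> None"

text \<open>\<open>contains_ones w n\<close> is the relation \<open>w \<succ> I\<^sub>n\<close>.\<close>

definition contains_ones :: "symbol list \<Rightarrow> nat \<Rightarrow> bool" where
  "contains_ones w n \<longleftrightarrow> (\<exists>u v. w = u @ replicate (2 * n - 1) sym_one @ v)"

text \<open>The words \<open>x\<^sub>n\<close> (here \<open>w n\<close>) and their modifications (here \<open>w' n\<close>), for \<open>n \<ge> 1\<close>.
  The placeholder that is changed at each step is a free choice, hence a relation.\<close>

definition ohno_words :: "(nat \<Rightarrow> symbol list) \<Rightarrow> (nat \<Rightarrow> symbol list) \<Rightarrow> bool" where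
  "ohno_words w w' \<longleftrightarrow>
     w 1 = [sym_one, placeholder] \<and> w' 1 = [sym_one, sym_one] \<and>
     (\<forall>n\<ge>1. w (Suc n) = w n @ w' n @ w n) \<and>
     (\<forall>n\<ge>1. (\<exists>i<length (w n). w n ! i = placeholder \<and> w' n = (w n)[i := sym_one]) \<and>
             contains_ones (w' n) n)"

text \<open>The limit of the words \<open>w n\<close>, indexed from 1.\<close>

definition ohno_limit :: "(nat \<Rightarrow> symbol list) \<Rightarrow> (nat \<Rightarrow> symbol) \<Rightarrow> bool" where
  "ohno_limit w y \<longleftrightarrow> (\<forall>n\<ge>1. \<forall>k<length (w n). y (Suc k) = w n ! k)"

definition fills :: "symbol list \<Rightarrow> bool list \<Rightarrow> bool" where
  "fills w v \<longleftrightarrow> length v = length w \<and> (\<forall>k<length w. w ! k \<noteq> placeholder \<longrightarrow> w ! k = Some (v ! k))"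

definition num_placeholders :: "nat \<Rightarrow> nat" where
  "num_placeholders n = (3 ^ (n - 1) + 1) div 2"

text \<open>\<open>z\<close> is a sequence obtained from the sequence \<open>y\<close> (both indexed from 1) by filling placeholders.
  \<open>S n\<close> is the set of starting positions of the occurrences of \<open>w n\<close> chosen at stage \<open>n\<close>, and
  the positions \<open>\<le> e n\<close> are those treated after stage \<open>n\<close>. Since \<open>S n\<close> has as many elements as
  \<open>w n\<close> has fillings, each filling is used exactly once.\<close>

definition ohno_filling :: "(nat \<Rightarrow> symbol list) \<Rightarrow> (nat \<Rightarrow> symbol) \<Rightarrow> (nat \<Rightarrow> bool) \<Rightarrow> bool" where
  "ohno_filling w y z \<longleftrightarrow>
     (\<forall>k\<ge>1. y k \<noteq> placeholder \<longrightarrow> y k = Some (z k)) \<and>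
     (\<exists>(S :: nat \<Rightarrow> nat set) (e :: nat \<Rightarrow> nat).
        e 0 = 0 \<and>
        (\<forall>n\<ge>1.
           finite (S n) \<and> card (S n) = 2 ^ num_placeholders n \<and>
           (\<forall>s\<in>S n. e (n - 1) < s \<and> (\<forall>k<length (w n). y (s + k) = w n ! k)) \<and>
           e n = Max (S n) + length (w n) - 1 \<and>
           (\<forall>v. fills (w n) v \<longrightarrow> (\<exists>s\<in>S n. \<forall>k<length (w n). z (s + k) = v ! k)) \<and>
           (\<forall>k. e (n - 1) < k \<and> k \<le> e n \<and> y k = placeholder \<and>
                k \<notin> (\<Union>s\<in>S n. {s..<s + length (w n)}) \<longrightarrow> z k)))"

definition ohno_point :: "config \<Rightarrow> bool" where
  "ohno_point x \<longleftrightarrow>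
     (\<exists>w w' y z. ohno_words w w' \<and> ohno_limit w y \<and> ohno_filling w y z \<and>
        x = (\<lambda>k. if k = 0 then False else z (nat \<bar>k\<bar>)))"

text \<open>\<open>\<lambda>i. x (i + n)\<close> is the image of \<open>x\<close> under the \<open>n\<close>-th iterate of the shift, \<open>n\<close> being any
  integer.\<close>

definition orbit_closure :: "config \<Rightarrow> config set" where
  "orbit_closure x = closure (range (\<lambda>n::int. (\<lambda>i. x (i + n))))"

definition punctured :: "config set \<Rightarrow> config set" where
  "punctured X = X - {\<lambda>_. True}"

section \<open>Suspension flows\<close>

definition roof_function :: "config set \<Rightarrow> (config \<Rightarrow> real) \<Rightarrow> bool" where
  "roof_function Y \<gamma> \<longleftrightarrow> continuous_on Y \<gamma> \<and> (\<forall>x\<in>Y. 0 < \<gamma> x)"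

definition susp_region :: "config set \<Rightarrow> (config \<Rightarrow> real) \<Rightarrow> (config \<times> real) set" where
  "susp_region Y \<gamma> = {(x, u). x \<in> Y \<and> 0 \<le> u \<and> u \<le> \<gamma> x}"

definition susp_rel :: "config set \<Rightarrow> (config \<Rightarrow> real) \<Rightarrow> ((config \<times> real) \<times> (config \<times> real)) set" where
  "susp_rel Y \<gamma> =
     {(p, q). p \<in> susp_region Y \<gamma> \<and> q \<in> susp_region Y \<gamma> \<and>
              equivclp (\<lambda>p q. \<exists>x\<in>Y. p = (x, \<gamma> x) \<and> q = (shift_map x, 0)) p q}"

definition susp_class :: "config set \<Rightarrow> (config \<Rightarrow> real) \<Rightarrow> config \<times> real \<Rightarrow> (config \<times> real) set" where
  "susp_class Y \<gamma> p = susp_rel Y \<gamma> `` {p}"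

text \<open>The quotient topology.\<close>

definition susp_space :: "config set \<Rightarrow> (config \<Rightarrow> real) \<Rightarrow> (config \<times> real) set topology" where
  "susp_space Y \<gamma> =
     topology (\<lambda>U. U \<subseteq> susp_region Y \<gamma> // susp_rel Y \<gamma> \<and>
                   openin (top_of_set (susp_region Y \<gamma>))
                          {p \<in> susp_region Y \<gamma>. susp_class Y \<gamma> p \<in> U})"

lemma openin_susp_space:
  "openin (susp_space Y \<gamma>) U \<longleftrightarrow>
     U \<subseteq> susp_region Y \<gamma> // susp_rel Y \<gamma> \<and>
     openin (top_of_set (susp_region Y \<gamma>)) {p \<in> susp_region Y \<gamma>. susp_class Y \<gamma> p \<in> U}"
proof -
  let ?B = "susp_region Y \<gamma>" and ?c = "susp_class Y \<gamma>"
  have "istopology (\<lambda>U. U \<subseteq> ?B // susp_rel Y \<gamma> \<and> openin (top_of_set ?B) {p \<in> ?B. ?c p \<in> U})"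
    unfolding istopology_def
  proof (intro conjI allI impI)
    fix U V
    assume U: "U \<subseteq> ?B // susp_rel Y \<gamma> \<and> openin (top_of_set ?B) {p \<in> ?B. ?c p \<in> U}"
      and V: "V \<subseteq> ?B // susp_rel Y \<gamma> \<and> openin (top_of_set ?B) {p \<in> ?B. ?c p \<in> V}"
    show "U \<inter> V \<subseteq> ?B // susp_rel Y \<gamma>" using U by blast
    have "{p \<in> ?B. ?c p \<in> U \<inter> V} = {p \<in> ?B. ?c p \<in> U} \<inter> {p \<in> ?B. ?c p \<in> V}" by blast
    then show "openin (top_of_set ?B) {p \<in> ?B. ?c p \<in> U \<inter> V}" using U V by (simp add: openin_Int)
  next
    fix \<K>
    assume K: "\<forall>U\<in>\<K>. U \<subseteq> ?B // susp_rel Y \<gamma> \<and> openin (top_of_set ?B) {p \<in> ?B. ?c p \<in> U}"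
    show "\<Union>\<K> \<subseteq> ?B // susp_rel Y \<gamma>" using K by blast
    have "{p \<in> ?B. ?c p \<in> \<Union>\<K>} = (\<Union>U\<in>\<K>. {p \<in> ?B. ?c p \<in> U})" by blast
    moreover have "openin (top_of_set ?B) (\<Union>U\<in>\<K>. {p \<in> ?B. ?c p \<in> U})"
      using K by (intro openin_Union) auto
    ultimately show "openin (top_of_set ?B) {p \<in> ?B. ?c p \<in> \<Union>\<K>}" by simp
  qed
  then show ?thesis by (simp add: susp_space_def topology_inverse')
qed

text \<open>The one-point compactification; \<open>None\<close> is the added point \<open>\<Delta>\<close>.\<close>

definition susp_compactification ::
    "config set \<Rightarrow> (config \<Rightarrow> real) \<Rightarrow> (config \<times> real) set option topology" where
  "susp_compactification Y \<gamma> = Alexandroff_compactification (susp_space Y \<gamma>)"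

text \<open>The conditions below determine \<open>\<Phi>\<close> uniquely on the compactification. They can only be satisfied
  if no orbit of the suspension flow runs off to \<open>\<Delta>\<close> in finite time, which may happen
  when \<open>\<gamma>\<close> tends to 0 at the fixed point.\<close>

definition suspension_flow ::
    "config set \<Rightarrow> (config \<Rightarrow> real) \<Rightarrow> (real \<Rightarrow> (config \<times> real) set option \<Rightarrow> (config \<times> real) set option) \<Rightarrow> bool"
  where
  "suspension_flow Y \<gamma> \<Phi> \<longleftrightarrow>
     is_flow (susp_compactification Y \<gamma>) \<Phi> \<and>
     (\<forall>(x, u)\<in>susp_region Y \<gamma>. \<forall>t. - u \<le> t \<and> t < \<gamma> x - u \<longrightarrow>
        \<Phi> t (Some (susp_class Y \<gamma> (x, u))) = Some (susp_class Y \<gamma> (x, u + t))) \<and>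
     (\<forall>t. \<Phi> t None = None)"

end

theory Submission
  imports Defs "HOL-Real_Asymp.Real_Asymp"
begin

text \<open>
  A constant roof suffices. Let \<open>\<mu>\<close> be the law of the random point obtained by choosing a uniformly
  distributed point of the odometer that underlies the words \<open>w n\<close>, and filling the positions that
  are placeholders at every level with independent fair coins. All fillings of all \<open>w n\<close> occur in
  the Ohno point, hence \<open>\<mu>\<close> lives on the orbit closure; it is invariant and ergodic, and its
  entropy \<open>h\<close> is at least \<open>ln 2 / 4\<close>, since the placeholders of \<open>w n\<close> have density at least
  \<open>1 / 4\<close>. The suspension flow with roof \<open>c\<close> carries the product of \<open>\<mu>\<close> with the uniform measure on
  the fibres, whose entropy is \<open>h / c\<close>; now take \<open>c = h / b\<close>.
\<close>

section \<open>Entropy of random variables with finitely many values\<close>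

text \<open>With heights measured in units of the roof, the time-one map is a rotation of the circle
  by \<open>1 / c\<close> that drives the shift on the base. An itinerary of length n under the
  rotation has only linearly many possible values and so contributes no entropy, while the base is
  shifted about n / c times; this is why the entropy h / c can be obtained by counting words. Since
  only the ratio h / c has to equal b, what is required of \<mu> is that h is positive and finite.

  The obstacle lies in the choice of \<mu>. Coins in all holes of \<open>W n\<close> would in
  general leave the orbit closure: a neighbouring block has to be \<open>W' n\<close>, in which one
  of these holes has become 1. Hence a coin is allowed only where the hole survives every level, and
  the resulting law has no single finite description. Hole densities, however, decrease to 1/4 at a
  geometric rate, so on a fixed finite window the limit configuration differs from its level-n
  version with probability of order 3^-n. Invariance, decorrelation and the entropy bound are
  therefore computed exactly at level n and carried to the limit.\<close>

definition pr :: "'a measure \<Rightarrow> ('a \<Rightarrow> 'k) \<Rightarrow> 'k \<Rightarrow> real" where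
  "pr M X k = measure M {\<omega> \<in> space M. X \<omega> = k}"

text \<open>Entropy is attached to functions instead of partitions: a join becomes a tuple or a list
  of values, and refinement becomes one function determining another.\<close>

definition ent :: "'a measure \<Rightarrow> ('a \<Rightarrow> 'k) \<Rightarrow> real" where
  "ent M X = - (\<Sum>k\<in>X ` space M. pr M X k * ln (pr M X k))"

lemma pr_nonneg [simp]: "0 \<le> pr M X k"
  by (simp add: pr_def)

lemma pr_notin_range: "k \<notin> X ` space M \<Longrightarrow> pr M X k = 0"
proof -
  assume "k \<notin> X ` space M"
  then have "{\<omega> \<in> space M. X \<omega> = k} = {}" by auto
  then show ?thesis by (simp only: pr_def measure_empty)
qed

lemma simple_function_fiber:
  assumes "simple_function M X" shows "{\<omega> \<in> space M. X \<omega> = k} \<in> sets M"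
proof -
  have "{\<omega> \<in> space M. X \<omega> = k} = X -` {k} \<inter> space M" by auto
  then show ?thesis using simple_functionD(2)[OF assms] by simp
qed

lemma simple_function_comp2:
  assumes "simple_function M X" shows "simple_function M (\<lambda>\<omega>. h (X \<omega>))"
  using simple_function_compose[OF assms, of h] by (simp add: comp_def)

lemma simple_function_determined:
  assumes W: "simple_function M W"
    and det: "\<And>\<omega> \<omega>'. \<omega> \<in> space M \<Longrightarrow> \<omega>' \<in> space M \<Longrightarrow> W \<omega> = W \<omega>' \<Longrightarrow> X \<omega> = X \<omega>'"
  shows "\<exists>h. \<forall>\<omega>\<in>space M. X \<omega> = h (W \<omega>)"
proof (intro exI ballI)
  fix \<omega> assume \<omega>: "\<omega> \<in> space M"
  let ?\<omega>' = "SOME \<omega>'. \<omega>' \<in> space M \<and> W \<omega>' = W \<omega>"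
  have "?\<omega>' \<in> space M \<and> W ?\<omega>' = W \<omega>"
    using \<omega> by (intro someI[where P="\<lambda>\<omega>'. \<omega>' \<in> space M \<and> W \<omega>' = W \<omega>"]) auto
  then show "X \<omega> = (\<lambda>w. X (SOME \<omega>'. \<omega>' \<in> space M \<and> W \<omega>' = w)) (W \<omega>)"
    using det \<omega> by metis
qed

lemma ent_cong:
  assumes "\<And>\<omega>. \<omega> \<in> space M \<Longrightarrow> X \<omega> = Y \<omega>"
  shows "ent M X = ent M Y"
proof -
  have "X ` space M = Y ` space M" using assms by auto
  moreover have "pr M X k = pr M Y k" for k unfolding pr_def using assms by (metis (mono_tags, lifting) Collect_cong)
  ultimately show ?thesis by (simp add: ent_def)
qed

section \<open>Shannon's inequalities\<close>

context prob_space
begin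

lemma pr_le_1: "pr M X k \<le> 1"
  by (simp add: pr_def)

lemma pr_comp:
  assumes W: "simple_function M W"
  shows "pr M (\<lambda>\<omega>. h (W \<omega>)) u = (\<Sum>w | w \<in> W ` space M \<and> h w = u. pr M W w)"
proof -
  let ?A = "{w \<in> W ` space M. h w = u}"
  have "{\<omega> \<in> space M. h (W \<omega>) = u} = (\<Union>w\<in>?A. {\<omega> \<in> space M. W \<omega> = w})" by auto
  moreover have "prob (\<Union>w\<in>?A. {\<omega> \<in> space M. W \<omega> = w}) = (\<Sum>w\<in>?A. prob {\<omega> \<in> space M. W \<omega> = w})"
    using simple_functionD(1)[OF W] simple_function_fiber[OF W]
    by (intro finite_measure_finite_Union) (auto simp: disjoint_family_on_def)
  ultimately show ?thesis by (simp add: pr_def)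
qed

lemma sum_pr:
  assumes W: "simple_function M W"
  shows "(\<Sum>w\<in>W ` space M. pr M W w) = 1"
  using pr_comp[OF W, of "\<lambda>_. ()" "()"] by (simp add: pr_def prob_space)

lemma pr_mono_comp:
  assumes W: "simple_function M W"
  shows "pr M W w \<le> pr M (\<lambda>\<omega>. h (W \<omega>)) (h w)"
  unfolding pr_def
  using simple_function_fiber[OF simple_function_comp2[OF W]] by (intro finite_measure_mono) auto

text \<open>Writes the entropy of a coarsening as an expectation over the finer variable, so that
  the entropies of several coarsenings can be compared term by term in one sum.\<close>

lemma ent_comp:
  assumes W: "simple_function M W"
  shows "ent M (\<lambda>\<omega>. h (W \<omega>)) = - (\<Sum>w\<in>W ` space M. pr M W w * ln (pr M (\<lambda>\<omega>. h (W \<omega>)) (h w)))"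
proof -
  let ?p = "pr M (\<lambda>\<omega>. h (W \<omega>))"
  have fin: "finite (W ` space M)" using simple_functionD(1)[OF W] .
  have "(\<Sum>w\<in>W ` space M. pr M W w * ln (?p (h w)))
      = (\<Sum>u\<in>h ` W ` space M. \<Sum>w | w \<in> W ` space M \<and> h w = u. pr M W w * ln (?p (h w)))"
    by (rule sum.image_gen[OF fin])
  also have "\<dots> = (\<Sum>u\<in>h ` W ` space M. ?p u * ln (?p u))"
    by (intro sum.cong) (auto simp: pr_comp[OF W] sum_distrib_right)
  finally show ?thesis by (simp add: ent_def image_image)
qed

lemma ent_nonneg:
  assumes W: "simple_function M W" shows "0 \<le> ent M W"
proof -
  have "pr M W w * ln (pr M W w) \<le> 0" for w
    using pr_le_1[of W w] by (cases "pr M W w = 0") (auto intro!: mult_nonneg_nonpos simp: less_le)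
  then show ?thesis by (simp add: ent_def sum_nonpos)
qed

text \<open>A value of \<open>W\<close> is at most as likely as the value of \<open>X\<close> that
  it determines, so the logarithms compare term by term.\<close>

lemma ent_mono:
  assumes W: "simple_function M W"
    and det: "\<And>\<omega> \<omega>'. \<omega> \<in> space M \<Longrightarrow> \<omega>' \<in> space M \<Longrightarrow> W \<omega> = W \<omega>' \<Longrightarrow> X \<omega> = X \<omega>'"
  shows "ent M X \<le> ent M W"
proof -
  obtain h where h: "\<forall>\<omega>\<in>space M. X \<omega> = h (W \<omega>)" using simple_function_determined[of M W X] W det by metis
  have "ent M X = ent M (\<lambda>\<omega>. h (W \<omega>))" by (intro ent_cong) (use h in auto)
  also have "\<dots> \<le> ent M W"
  proof -
    have "pr M W w * ln (pr M W w) \<le> pr M W w * ln (pr M (\<lambda>\<omega>. h (W \<omega>)) (h w))" for w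
      using pr_mono_comp[OF W, of w h] pr_nonneg[of M W w]
      by (cases "pr M W w = 0") (auto intro!: mult_left_mono simp del: pr_nonneg)
    then show ?thesis
      unfolding ent_comp[OF W, of h] by (simp add: ent_def sum_mono)
  qed
  finally show ?thesis .
qed

lemma ent_eq:
  assumes "simple_function M W" "simple_function M X"
    and "\<And>\<omega> \<omega>'. \<omega> \<in> space M \<Longrightarrow> \<omega>' \<in> space M \<Longrightarrow> W \<omega> = W \<omega>' \<longleftrightarrow> X \<omega> = X \<omega>'"
  shows "ent M X = ent M W"
  using ent_mono[OF assms(1), of X] ent_mono[OF assms(2), of W] assms(3) by (intro antisym) blast+

text \<open>Gibbs' inequality against the uniform law on \<open>S\<close>, from
  \<open>ln t \<le> t - 1\<close> with t the ratio of the uniform probability to the actual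
  one.\<close>

lemma ent_le_ln_card:
  assumes W: "simple_function M W" and S: "finite S" "W ` space M \<subseteq> S"
  shows "ent M W \<le> ln (real (card S))"
proof -
  let ?R = "W ` space M" and ?c = "real (card S)"
  have "?R \<noteq> {}" using not_empty by auto
  then have c0: "0 < ?c" using S by (auto simp: card_gt_0_iff)
  have "- (pr M W w * ln (pr M W w)) - pr M W w * ln ?c \<le> 1 / ?c - pr M W w" for w
  proof (cases "pr M W w = 0")
    case False
    then have p: "0 < pr M W w" by (simp add: less_le)
    have "ln (1 / (pr M W w * ?c)) \<le> 1 / (pr M W w * ?c) - 1"
      using p c0 by (intro ln_le_minus_one) auto
    then have "pr M W w * ln (1 / (pr M W w * ?c)) \<le> pr M W w * (1 / (pr M W w * ?c) - 1)"
      using p by (intro mult_left_mono) auto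
    moreover have "pr M W w * (1 / (pr M W w * ?c) - 1) = 1 / ?c - pr M W w"
      using p c0 by (simp add: field_simps)
    moreover have "ln (1 / (pr M W w * ?c)) = - ln (pr M W w) - ln ?c"
      using p c0 by (simp add: ln_div ln_mult)
    ultimately have "pr M W w * (- ln (pr M W w) - ln ?c) \<le> 1 / ?c - pr M W w" by metis
    then show ?thesis by (simp add: right_diff_distrib)
  qed (use c0 in auto)
  then have "(\<Sum>w\<in>?R. - (pr M W w * ln (pr M W w)) - pr M W w * ln ?c) \<le> (\<Sum>w\<in>?R. 1 / ?c - pr M W w)"
    by (intro sum_mono)
  also have "\<dots> = real (card ?R) / ?c - 1" by (simp add: sum_subtractf sum_pr[OF W])
  also have "\<dots> \<le> 0" using card_mono[OF S] c0 by (simp add: field_simps)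
  finally show ?thesis
    by (simp add: sum_subtractf sum_negf ent_def sum_distrib_right[symmetric] sum_pr[OF W])
qed

text \<open>The inequality is \<open>H(X | Z) \<ge> H(X | Y, Z)\<close>.\<close>

lemma ent_strong_subadditive:
  assumes X: "simple_function M X" and Y: "simple_function M Y" and Z: "simple_function M Z"
  shows "ent M (\<lambda>\<omega>. (X \<omega>, Y \<omega>, Z \<omega>)) + ent M Z \<le> ent M (\<lambda>\<omega>. (X \<omega>, Z \<omega>)) + ent M (\<lambda>\<omega>. (Y \<omega>, Z \<omega>))"
proof -
  define W where "W = (\<lambda>\<omega>. (X \<omega>, Y \<omega>, Z \<omega>))"
  have W: "simple_function M W" unfolding W_def by (intro simple_function_Pair X Y Z)
  define XZ where "XZ = (\<lambda>\<omega>. (X \<omega>, Z \<omega>))"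
  define YZ where "YZ = (\<lambda>\<omega>. (Y \<omega>, Z \<omega>))"
  have sXZ: "simple_function M XZ" and sYZ: "simple_function M YZ"
    unfolding XZ_def YZ_def by (intro simple_function_Pair X Y Z)+
  let ?R = "W ` space M"
  let ?RX = "X ` space M" and ?RY = "Y ` space M" and ?RZ = "Z ` space M"
  have fin: "finite ?R" "finite ?RX" "finite ?RY" "finite ?RZ"
    using simple_functionD(1) W X Y Z by auto
  let ?p = "\<lambda>w. pr M W w" and ?xz = "\<lambda>w. pr M XZ (fst w, snd (snd w))"
    and ?yz = "\<lambda>w. pr M YZ (snd w)" and ?z = "\<lambda>w. pr M Z (snd (snd w))"
  have e1: "ent M XZ = - (\<Sum>w\<in>?R. ?p w * ln (?xz w))"
    using ent_comp[OF W, of "\<lambda>w. (fst w, snd (snd w))"] by (simp add: W_def XZ_def)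
  have e2: "ent M YZ = - (\<Sum>w\<in>?R. ?p w * ln (?yz w))"
    using ent_comp[OF W, of "\<lambda>w. snd w"] by (simp add: W_def YZ_def)
  have e3: "ent M Z = - (\<Sum>w\<in>?R. ?p w * ln (?z w))"
    using ent_comp[OF W, of "\<lambda>w. snd (snd w)"] by (simp add: W_def)
  \<comment> \<open>\<open>ln t \<le> t - 1\<close> again, where t compares the actual law with the
    one that makes \<open>X\<close> and \<open>Y\<close> independent given \<open>Z\<close>.\<close>
  have pw: "?p w - ?xz w * ?yz w / ?z w \<le> ?p w * (ln (?p w) + ln (?z w) - ln (?xz w) - ln (?yz w))" for w
  proof (cases "?p w = 0")
    case False
    then have p: "0 < ?p w" by (simp add: less_le)
    have "?p w \<le> ?xz w" using pr_mono_comp[OF W, of w "\<lambda>w. (fst w, snd (snd w))"] by (simp add: W_def XZ_def)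
    moreover have "?p w \<le> ?yz w" using pr_mono_comp[OF W, of w "\<lambda>w. snd w"] by (simp add: W_def YZ_def)
    moreover have "?p w \<le> ?z w" using pr_mono_comp[OF W, of w "\<lambda>w. snd (snd w)"] by (simp add: W_def)
    ultimately have q: "0 < ?xz w" "0 < ?yz w" "0 < ?z w" using p by linarith+
    let ?t = "?xz w * ?yz w / (?p w * ?z w)"
    have "ln ?t \<le> ?t - 1" using p q by (intro ln_le_minus_one) auto
    then have "?p w * ln ?t \<le> ?p w * (?t - 1)" using p by (intro mult_left_mono) auto
    moreover have "?p w * (?t - 1) = ?xz w * ?yz w / ?z w - ?p w" using p q by (simp add: field_simps)
    moreover have "ln ?t = ln (?xz w) + ln (?yz w) - ln (?p w) - ln (?z w)"
      using p q by (simp add: ln_div ln_mult)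
    ultimately have "?p w * (ln (?xz w) + ln (?yz w) - ln (?p w) - ln (?z w)) \<le> ?xz w * ?yz w / ?z w - ?p w"
      by metis
    then show ?thesis by (simp add: distrib_left right_diff_distrib)
  qed auto
  \<comment> \<open>Enlarging the sum to the full product of the ranges lets it factor over
    \<open>Z\<close>; the conditionally independent law has total mass 1.\<close>
  have "(\<Sum>w\<in>?R. ?xz w * ?yz w / ?z w) \<le> (\<Sum>w\<in>?RX \<times> ?RY \<times> ?RZ. ?xz w * ?yz w / ?z w)"
    by (intro sum_mono2) (auto simp: fin W_def)
  also have "\<dots> = (\<Sum>x\<in>?RX. \<Sum>y\<in>?RY. \<Sum>z\<in>?RZ. pr M XZ (x, z) * pr M YZ (y, z) / pr M Z z)"
    by (simp add: sum.cartesian_product split_beta)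
  also have "\<dots> = (\<Sum>z\<in>?RZ. (\<Sum>x\<in>?RX. pr M XZ (x, z)) * (\<Sum>y\<in>?RY. pr M YZ (y, z)) / pr M Z z)"
  proof -
    have "(\<Sum>x\<in>?RX. \<Sum>y\<in>?RY. \<Sum>z\<in>?RZ. pr M XZ (x, z) * pr M YZ (y, z) / pr M Z z)
       = (\<Sum>x\<in>?RX. \<Sum>z\<in>?RZ. \<Sum>y\<in>?RY. pr M XZ (x, z) * pr M YZ (y, z) / pr M Z z)"
      by (intro sum.cong refl sum.swap)
    also have "\<dots> = (\<Sum>z\<in>?RZ. \<Sum>x\<in>?RX. \<Sum>y\<in>?RY. pr M XZ (x, z) * pr M YZ (y, z) / pr M Z z)"
      by (rule sum.swap)
    also have "\<dots> = (\<Sum>z\<in>?RZ. (\<Sum>x\<in>?RX. pr M XZ (x, z)) * (\<Sum>y\<in>?RY. pr M YZ (y, z)) / pr M Z z)"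
      by (intro sum.cong refl) (simp only: sum_product sum_divide_distrib)
    finally show ?thesis .
  qed
  also have "\<dots> = (\<Sum>z\<in>?RZ. pr M Z z)"
  proof (intro sum.cong refl)
    fix z assume "z \<in> ?RZ"
    have fx: "(\<Sum>x\<in>?RX. pr M XZ (x, z)) = pr M Z z"
    proof -
      have "pr M Z z = (\<Sum>w | w \<in> XZ ` space M \<and> snd w = z. pr M XZ w)"
        using pr_comp[OF sXZ, of snd z] by (simp add: XZ_def)
      also have "\<dots> = (\<Sum>w\<in>(\<lambda>x. (x, z)) ` ?RX. pr M XZ w)"
      proof (rule sum.mono_neutral_left)
        show "\<forall>i\<in>(\<lambda>x. (x, z)) ` ?RX - {w \<in> XZ ` space M. snd w = z}. pr M XZ i = 0"
        proof
          fix i assume i: "i \<in> (\<lambda>x. (x, z)) ` ?RX - {w \<in> XZ ` space M. snd w = z}"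
          then have "snd i = z" by force
          with i have "i \<notin> XZ ` space M" by blast
          then show "pr M XZ i = 0" by (rule pr_notin_range)
        qed
      qed (auto simp: fin XZ_def)
      also have "\<dots> = (\<Sum>x\<in>?RX. pr M XZ (x, z))" by (subst sum.reindex) (auto simp: inj_on_def)
      finally show ?thesis by simp
    qed
    have fy: "(\<Sum>y\<in>?RY. pr M YZ (y, z)) = pr M Z z"
    proof -
      have "pr M Z z = (\<Sum>w | w \<in> YZ ` space M \<and> snd w = z. pr M YZ w)"
        using pr_comp[OF sYZ, of snd z] by (simp add: YZ_def)
      also have "\<dots> = (\<Sum>w\<in>(\<lambda>x. (x, z)) ` ?RY. pr M YZ w)"
      proof (rule sum.mono_neutral_left)
        show "\<forall>i\<in>(\<lambda>x. (x, z)) ` ?RY - {w \<in> YZ ` space M. snd w = z}. pr M YZ i = 0"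
        proof
          fix i assume i: "i \<in> (\<lambda>x. (x, z)) ` ?RY - {w \<in> YZ ` space M. snd w = z}"
          then have "snd i = z" by force
          with i have "i \<notin> YZ ` space M" by blast
          then show "pr M YZ i = 0" by (rule pr_notin_range)
        qed
      qed (auto simp: fin YZ_def)
      also have "\<dots> = (\<Sum>x\<in>?RY. pr M YZ (x, z))" by (subst sum.reindex) (auto simp: inj_on_def)
      finally show ?thesis by simp
    qed
    \<comment> \<open>A value \<open>z\<close> of probability 0 is covered as well, since division
      by 0 yields 0.\<close>
    show "(\<Sum>x\<in>?RX. pr M XZ (x, z)) * (\<Sum>y\<in>?RY. pr M YZ (y, z)) / pr M Z z = pr M Z z"
      unfolding fx fy by simp
  qed
  also have "\<dots> = 1" by (rule sum_pr[OF Z])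
  finally have "0 \<le> (\<Sum>w\<in>?R. ?p w - ?xz w * ?yz w / ?z w)" by (simp add: sum_subtractf sum_pr[OF W])
  also have "\<dots> \<le> (\<Sum>w\<in>?R. ?p w * (ln (?p w) + ln (?z w) - ln (?xz w) - ln (?yz w)))"
    by (intro sum_mono pw)
  also have "\<dots> = (\<Sum>w\<in>?R. ?p w * ln (?p w)) + (\<Sum>w\<in>?R. ?p w * ln (?z w)) - (\<Sum>w\<in>?R. ?p w * ln (?xz w)) - (\<Sum>w\<in>?R. ?p w * ln (?yz w))"
    by (simp add: sum_subtractf[symmetric] sum.distrib[symmetric] algebra_simps)
  also have "\<dots> = ent M XZ + ent M YZ - ent M W - ent M Z"
    unfolding e1 e2 e3 by (simp add: ent_def)
  finally show ?thesis by (simp add: W_def XZ_def YZ_def)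
qed

text \<open>The strong inequality with a constant third variable.\<close>

lemma ent_subadditive:
  assumes X: "simple_function M X" and Y: "simple_function M Y"
  shows "ent M (\<lambda>\<omega>. (X \<omega>, Y \<omega>)) \<le> ent M X + ent M Y"
proof -
  have U: "simple_function M (\<lambda>_. ())" by simp
  note P = simple_function_Pair
  have "ent M (\<lambda>\<omega>. (X \<omega>, Y \<omega>, ())) = ent M (\<lambda>\<omega>. (X \<omega>, Y \<omega>))"
    by (intro ent_eq P X Y U) auto
  moreover have "ent M (\<lambda>\<omega>. (X \<omega>, ())) = ent M X" "ent M (\<lambda>\<omega>. (Y \<omega>, ())) = ent M Y"
    by (intro ent_eq P X Y U; auto)+
  ultimately show ?thesis using ent_strong_subadditive[OF X Y U] ent_nonneg[OF U] by simp
qed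

lemma simple_function_names:
  assumes "\<And>i. i < n \<Longrightarrow> simple_function M (X i)"
  shows "simple_function M (\<lambda>\<omega>. map (\<lambda>i. X i \<omega>) [0..<n])"
  using assms
proof (induction n)
  case (Suc n)
  have "simple_function M (\<lambda>\<omega>. (map (\<lambda>i. X i \<omega>) [0..<n], X n \<omega>))"
    using Suc by (intro simple_function_Pair) auto
  from simple_function_comp2[OF this, of "\<lambda>(xs, x). xs @ [x]"] show ?case by simp
qed simp

text \<open>The hypothesis bounds the conditional entropy of \<open>X i\<close> given
  \<open>Y i\<close> by \<open>d\<close>; by the chain rule these costs add up along a name. The
  induction runs on the joint name of both processes, which bounds the name of \<open>X\<close> from
  above.\<close>

lemma ent_names_le:
  assumes X: "\<And>i. simple_function M (X i)" and Y: "\<And>i. simple_function M (Y i)"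
    and d: "\<And>i. ent M (\<lambda>\<omega>. (X i \<omega>, Y i \<omega>)) \<le> ent M (Y i) + d"
  shows "ent M (\<lambda>\<omega>. map (\<lambda>i. X i \<omega>) [0..<n]) \<le> ent M (\<lambda>\<omega>. map (\<lambda>i. Y i \<omega>) [0..<n]) + real n * d"
proof -
  let ?X = "\<lambda>n \<omega>. map (\<lambda>i. X i \<omega>) [0..<n]" and ?Y = "\<lambda>n \<omega>. map (\<lambda>i. Y i \<omega>) [0..<n]"
  have sX: "simple_function M (?X n)" and sY: "simple_function M (?Y n)" for n
    using simple_function_names X Y by blast+
  note P = simple_function_Pair
  have "ent M (\<lambda>\<omega>. (?X n \<omega>, ?Y n \<omega>)) \<le> ent M (?Y n) + real n * d"
  proof (induction n)
    case 0
    have "ent M (\<lambda>\<omega>. (?X 0 \<omega>, ?Y 0 \<omega>)) \<le> ent M (?Y 0)"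
      by (rule ent_mono[OF sY]) auto
    then show ?case by simp
  next
    case (Suc n)
    \<comment> \<open>\<open>Y n\<close> is no more uncertain when the past of \<open>X\<close> is
      known in addition to the past of \<open>Y\<close>.\<close>
    have a: "ent M (\<lambda>\<omega>. (?X n \<omega>, Y n \<omega>, ?Y n \<omega>)) + ent M (?Y n)
        \<le> ent M (\<lambda>\<omega>. (?X n \<omega>, ?Y n \<omega>)) + ent M (\<lambda>\<omega>. (Y n \<omega>, ?Y n \<omega>))"
      by (rule ent_strong_subadditive) (rule sX sY Y)+
    \<comment> \<open>\<open>X n\<close> is no more uncertain given both pasts and
      \<open>Y n\<close> than given \<open>Y n\<close> alone.\<close>
    have b: "ent M (\<lambda>\<omega>. (X n \<omega>, (?X n \<omega>, ?Y n \<omega>), Y n \<omega>)) + ent M (Y n)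
        \<le> ent M (\<lambda>\<omega>. (X n \<omega>, Y n \<omega>)) + ent M (\<lambda>\<omega>. ((?X n \<omega>, ?Y n \<omega>), Y n \<omega>))"
      by (rule ent_strong_subadditive) (rule sX sY X Y P)+
    have c: "ent M (\<lambda>\<omega>. (Y n \<omega>, ?Y n \<omega>)) = ent M (?Y (Suc n))"
      by (rule ent_eq) (rule sX sY X Y P | auto)+
    have e: "ent M (\<lambda>\<omega>. (X n \<omega>, (?X n \<omega>, ?Y n \<omega>), Y n \<omega>)) = ent M (\<lambda>\<omega>. (?X (Suc n) \<omega>, ?Y (Suc n) \<omega>))"
      by (rule ent_eq) (rule sX sY X Y P | auto)+
    have f: "ent M (\<lambda>\<omega>. ((?X n \<omega>, ?Y n \<omega>), Y n \<omega>)) = ent M (\<lambda>\<omega>. (?X n \<omega>, Y n \<omega>, ?Y n \<omega>))"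
      by (rule ent_eq) (rule sX sY X Y P | auto)+
    show ?case using a b c e f d[of n] Suc by (simp add: algebra_simps)
  qed
  moreover have "ent M (?X n) \<le> ent M (\<lambda>\<omega>. (?X n \<omega>, ?Y n \<omega>))"
    by (rule ent_mono) (rule sX sY P | auto)+
  ultimately show ?thesis by linarith
qed

end

text \<open>Equal laws may still come with different ranges, so both sums are taken over the union,
  where the additional values have probability 0.\<close>

lemma ent_eq_law:
  assumes M: "prob_space M" and N: "prob_space N"
    and X: "simple_function M X" and Y: "simple_function N Y"
    and law: "\<And>k. pr M X k = pr N Y k"
  shows "ent M X = ent N Y"
proof -
  let ?S = "X ` space M \<union> Y ` space N"
  note z = pr_notin_range
  have fin: "finite ?S" using simple_functionD(1)[OF X] simple_functionD(1)[OF Y] by auto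
  have "ent M X = - (\<Sum>k\<in>?S. pr M X k * ln (pr M X k))"
    unfolding ent_def by (intro arg_cong[where f=uminus] sum.mono_neutral_left fin) (blast | simp add: z)+
  moreover have "ent N Y = - (\<Sum>k\<in>?S. pr N Y k * ln (pr N Y k))"
    unfolding ent_def by (intro arg_cong[where f=uminus] sum.mono_neutral_left fin) (blast | simp add: z)+
  ultimately show ?thesis by (simp add: law)
qed

text \<open>Fekete's lemma: the limit is the infimum of \<open>a n / real n\<close> over n \<ge> 1.
  Convergence has to be established because \<open>measure_entropy\<close> is stated with
  \<open>lim\<close>, whose value says nothing about a divergent sequence.\<close>

lemma fekete:
  fixes a :: "nat \<Rightarrow> real"
  assumes sub: "\<And>m n. a (m + n) \<le> a m + a n" and nonneg: "\<And>n. 0 \<le> a n"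
  shows "\<exists>l. (\<lambda>n. a n / real n) \<longlonglongrightarrow> l"
proof -
  define l where "l = (INF n\<in>{1..}. a n / real n)"
  have bdd: "bdd_below ((\<lambda>n. a n / real n) ` {1..})" using nonneg by (intro bdd_belowI[of _ 0]) auto
  have l_le: "l \<le> a n / real n" if "n \<ge> 1" for n
    unfolding l_def using bdd that by (intro cINF_lower) auto
  have mul: "a (q * k) \<le> real q * a k" if "q \<ge> 1" for q k
    using that
  proof (induction q rule: dec_induct)
    case (step q)
    then show ?case using sub[of k "q * k"] by (simp add: algebra_simps)
  qed simp
  have "(\<lambda>n. a n / real n) \<longlonglongrightarrow> l"
  proof (rule LIMSEQ_I)
    fix e :: real assume e: "0 < e"
    have "l < l + e/2" using e by simp
    then obtain k where k: "k \<ge> 1" "a k / real k < l + e/2"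
      unfolding l_def using cINF_less_iff[OF _ bdd] by (metis atLeast_iff empty_iff le_refl)
    \<comment> \<open>Bounds the contribution of the remainder when n is divided by k.\<close>
    define B where "B = Max (a ` {..k})"
    have B: "a r \<le> B" if "r \<le> k" for r unfolding B_def using that by (intro Max_ge) auto
    have B0: "0 \<le> B" using B[of 0] nonneg[of 0] by simp
    obtain N where N: "real N > 2 * B / e" using reals_Archimedean2 by blast
    show "\<exists>no. \<forall>n\<ge>no. norm (a n / real n - l) < e"
    proof (intro exI allI impI)
      fix n assume n: "n \<ge> max N k + 1"
      let ?q = "n div k" and ?r = "n mod k"
      have q1: "?q \<ge> 1" using n k by (simp add: div_greater_zero_iff Suc_leI)
      have n0: "real n > 0" using n by simp
      have "a n = a (?q * k + ?r)" by simp
      also have "\<dots> \<le> real ?q * a k + B" using sub[of "?q * k" ?r] mul[OF q1, of k] B[of ?r] k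
        by (smt (verit) mod_less_divisor less_imp_le_nat less_le_trans zero_less_one)
      also have "real ?q * a k \<le> real n * (a k / real k)"
      proof -
        have "real ?q * real k \<le> real n" by (metis of_nat_le_iff of_nat_mult times_div_less_eq_dividend mult.commute)
        then have "real ?q * real k * (a k / real k) \<le> real n * (a k / real k)"
          using nonneg[of k] by (intro mult_right_mono) auto
        then show ?thesis using k by simp
      qed
      finally have "a n / real n \<le> a k / real k + B / real n" using n0 by (simp add: field_simps)
      moreover have "B / real n < e / 2"
      proof -
        have "2 * B / e < real n" using N n by linarith
        then show ?thesis using e n0 by (simp add: field_simps)
      qed
      ultimately have "a n / real n < l + e" using k by linarith
      moreover have "l \<le> a n / real n" using l_le n by simp
      ultimately show "norm (a n / real n - l) < e" by simp
    qed
  qed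
  then show ?thesis ..
qed

section \<open>The suspension flow with a constant roof\<close>

text \<open>Makes \<open>config\<close> second countable, so that the Borel sets of
  \<open>config \<times> real\<close> are the product \<sigma>-algebra.\<close>

instance bool :: second_countable_topology
proof
  show "\<exists>B::bool set set. countable B \<and> open = generate_topology B"
  proof (intro exI conjI)
    show "countable (UNIV :: bool set set)" by (rule countable_finite) simp
    show "open = generate_topology (UNIV :: bool set set)"
      by (simp add: fun_eq_iff Topological_Spaces.open_discrete generate_topology.Basis)
  qed
qed

section \<open>The full two-sided shift as a compact space\<close>

definition shiftn :: "int \<Rightarrow> config \<Rightarrow> config" where
  "shiftn k x = (\<lambda>i. x (i + k))"

lemma shiftn_0 [simp]: "shiftn 0 x = x"
  by (simp add: shiftn_def)

lemma shiftn_shiftn [simp]: "shiftn j (shiftn k x) = shiftn (j + k) x"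
  by (simp add: shiftn_def algebra_simps)

lemma shift_map_eq: "shift_map = shiftn 1"
  by (simp add: shiftn_def shift_map_def fun_eq_iff)

lemma shiftn_apply: "shiftn k x i = x (i + k)"
  by (simp add: shiftn_def)

lemma shiftn_one [simp]: "shiftn k (\<lambda>_. True) = (\<lambda>_. True)"
  by (simp add: shiftn_def)

lemma shiftn_eq_one_iff [simp]: "shiftn k x = (\<lambda>_. True) \<longleftrightarrow> x = (\<lambda>_. True)"
  by (metis add.right_inverse shiftn_0 shiftn_one shiftn_shiftn)

lemma continuous_on_shiftn: "continuous_on S (shiftn k)"
  unfolding shiftn_def
  by (intro continuous_on_coordinatewise_then_product continuous_on_subset[OF continuous_on_product_coordinates]) auto

lemma clopen_coordinate: "open {x::config. x i = b}" "closed {x::config. x i = b}"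
proof -
  have e: "{x::config. x i = b} = (\<lambda>x. x i) -` {b}" by auto
  show "open {x::config. x i = b}"
    unfolding e by (intro open_vimage Topological_Spaces.open_discrete continuous_on_product_coordinates)
  show "closed {x::config. x i = b}"
    unfolding e by (intro closed_vimage continuous_on_product_coordinates) simp
qed

lemma closed_one: "closed {\<lambda>_::int. True}"
proof -
  have "{\<lambda>_::int. True} = (\<Inter>i. {x. x i = True})" by (auto simp: fun_eq_iff)
  moreover have "closed (\<Inter>i. {x::config. x i = True})" by (intro closed_INT ballI clopen_coordinate)
  ultimately show ?thesis by simp
qed

lemma compact_config: "compact (UNIV :: config set)"
proof -
  have "compact_space (euclidean :: bool topology)"
    unfolding compact_space_def by (intro finite_imp_compactin) auto
  then have "compact_space (product_topology (\<lambda>_::int. euclidean :: bool topology) UNIV)"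
    by (simp add: compact_space_product_topology)
  then show ?thesis by (simp add: euclidean_product_topology compact_space_def)
qed

text \<open>\<open>X\<close> stands for the orbit closure. The point \<open>one_X\<close> gives
  \<Delta> a preimage in \<open>X \<times> {0..c}\<close>, which turns the compactification into a
  quotient of a compact product.\<close>

locale const_suspension =
  fixes X :: "config set" and c :: real
  assumes closed_X: "closed X"
    and shift_X: "shift_map x \<in> X \<longleftrightarrow> x \<in> X"
    and one_X: "(\<lambda>_. True) \<in> X"
    and c_pos: "0 < c"
begin

abbreviation "Y \<equiv> punctured X"
abbreviation "B \<equiv> susp_region Y (\<lambda>_. c)"
abbreviation "cls \<equiv> susp_class Y (\<lambda>_. c)"
abbreviation "SY \<equiv> susp_space Y (\<lambda>_. c)"
abbreviation "Z \<equiv> susp_compactification Y (\<lambda>_. c)"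

lemma shiftn_X [simp]: "shiftn k x \<in> X \<longleftrightarrow> x \<in> X"
proof -
  have nat: "shiftn (int n) x \<in> X \<longleftrightarrow> x \<in> X" for n x
  proof (induction n)
    case (Suc n)
    have "shiftn (int (Suc n)) x = shift_map (shiftn (int n) x)" by (simp add: shift_map_eq)
    then show ?case using Suc shift_X by simp
  qed simp
  show ?thesis
  proof (cases "0 \<le> k")
    case True
    then show ?thesis using nat[of "nat k" x] by simp
  next
    case False
    then show ?thesis using nat[of "nat (-k)" "shiftn k x"] by simp
  qed
qed

lemma shiftn_Y [simp]: "shiftn k x \<in> Y \<longleftrightarrow> x \<in> Y"
  by (simp add: punctured_def)

lemma mem_B: "(x, u) \<in> B \<longleftrightarrow> x \<in> Y \<and> 0 \<le> u \<and> u \<le> c"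
  by (simp add: susp_region_def)

text \<open>Normal form of a point modulo the gluing; it replaces the generated equivalence by
  equality of normal forms.\<close>

definition nf :: "config \<times> real \<Rightarrow> config \<times> real" where
  "nf p = (if snd p = c then (shift_map (fst p), 0) else p)"

text \<open>Because 0 \<noteq> c, a gluing step does not change the normal form; conversely every
  point reaches its normal form in at most one step.\<close>

lemma susp_rel_iff:
  "(p, q) \<in> susp_rel Y (\<lambda>_. c) \<longleftrightarrow> p \<in> B \<and> q \<in> B \<and> nf p = nf q"
proof -
  let ?R = "\<lambda>p q. \<exists>x\<in>Y. p = (x, c) \<and> q = (shift_map x, 0)"
  have 1: "nf p = nf q" if "equivclp ?R p q" for p q
    using that
  proof (induction rule: equivclp_induct)
    case (step y z)
    then show ?case using c_pos by (auto simp: nf_def)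
  qed simp
  have 2: "equivclp ?R p (nf p)" if "p \<in> B" for p
  proof (cases "snd p = c")
    case True
    then have "?R p (nf p)" using that by (cases p) (auto simp: nf_def susp_region_def)
    then show ?thesis by (rule r_into_equivclp)
  qed (simp add: nf_def)
  show ?thesis
  proof (cases "p \<in> B \<and> q \<in> B")
    case True
    have "equivclp ?R p q" if eq: "nf p = nf q"
    proof (rule equivclp_trans)
      show "equivclp ?R p (nf p)" using 2 True by blast
      have "equivclp ?R q (nf p)" unfolding eq using 2 True by blast
      then show "equivclp ?R (nf p) q" by (rule equivclp_sym)
    qed
    then show ?thesis using True 1[of p q] by (simp only: susp_rel_def mem_Collect_eq prod.case) blast
  qed (auto simp only: susp_rel_def mem_Collect_eq prod.case)
qed

lemma cls_eq: "p \<in> B \<Longrightarrow> cls p = {q \<in> B. nf q = nf p}"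
  by (auto simp: susp_class_def susp_rel_iff)

lemma cls_eq_iff: "p \<in> B \<Longrightarrow> q \<in> B \<Longrightarrow> cls p = cls q \<longleftrightarrow> nf p = nf q"
  by (auto simp: cls_eq)

lemma quot_eq: "B // susp_rel Y (\<lambda>_. c) = cls ` B"
  by (auto simp: quotient_def susp_class_def)

lemma openin_SY: "openin SY U \<longleftrightarrow> U \<subseteq> cls ` B \<and> openin (top_of_set B) {p \<in> B. cls p \<in> U}"
  by (simp add: openin_susp_space quot_eq)

lemma topspace_SY: "topspace SY = cls ` B"
proof -
  have "{p \<in> B. cls p \<in> cls ` B} = B" by auto
  then have "openin SY (cls ` B)" by (simp add: openin_SY)
  moreover have "topspace SY \<subseteq> cls ` B" using openin_topspace[of SY] by (simp only: openin_SY)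
  ultimately show ?thesis using openin_subset by blast
qed

lemma closedin_SY: "closedin SY C \<longleftrightarrow> C \<subseteq> cls ` B \<and> closedin (top_of_set B) {p \<in> B. cls p \<in> C}"
proof -
  have "B - {p \<in> B. cls p \<in> C} = {p \<in> B. cls p \<in> cls ` B - C}" by auto
  then show ?thesis by (auto simp: closedin_def topspace_SY openin_SY)
qed

lemma topspace_Z: "topspace Z = insert None (Some ` cls ` B)"
  by (simp add: susp_compactification_def topspace_SY)

text \<open>A clopen exhaustion of the complement of the all-ones point: some 0 occurs within
  distance \<open>k\<close> of the origin. Intersected with \<open>X\<close> each member is
  compact.\<close>

definition Xk :: "nat \<Rightarrow> config set" where
  "Xk k = (\<Union>i\<in>{-int k..int k}. {x. x i = False})"

lemma clopen_Xk: "open (Xk k)" "closed (Xk k)"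
  unfolding Xk_def by (intro open_UN closed_UN ballI clopen_coordinate; simp)+

lemma Xk_mono: "k \<le> l \<Longrightarrow> Xk k \<subseteq> Xk l"
  unfolding Xk_def by (rule UN_mono) auto

lemma Y_Xk: "x \<in> Y \<Longrightarrow> \<exists>k. x \<in> Xk k"
proof -
  assume "x \<in> Y"
  then obtain i where i: "x i = False" by (auto simp: punctured_def)
  have "i \<in> {-int (nat \<bar>i\<bar>)..int (nat \<bar>i\<bar>)}" by auto
  then show ?thesis using i unfolding Xk_def by blast
qed

lemma Xk_not_one: "x \<in> Xk k \<Longrightarrow> x \<noteq> (\<lambda>_. True)"
  by (auto simp: Xk_def)

lemma compact_XI: "compact (X \<times> {0..c})"
  using compact_Int_closed[OF compact_config closed_X] by (intro compact_Times) auto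

text \<open>\<open>Ek k\<close> is a saturated open set of the region whose closure is compact.\<close>

definition Ek :: "nat \<Rightarrow> (config \<times> real) set" where
  "Ek k = B \<inter> {(x, u). x \<in> Xk k \<and> (u = 0 \<longrightarrow> shiftn (-1) x \<in> Xk k) \<and> (u = c \<longrightarrow> shiftn 1 x \<in> Xk k)}"

lemma openin_Ek: "openin (top_of_set B) (Ek k)"
proof -
  have o: "open (shiftn j -` Xk k)" for j
    by (rule open_vimage[OF clopen_Xk(1) continuous_on_shiftn])
  have o1: "open {u. u \<noteq> (d::real)}" for d by (simp add: open_Collect_neq)
  have "{(x, u). x \<in> Xk k \<and> (u = 0 \<longrightarrow> shiftn (-1) x \<in> Xk k) \<and> (u = c \<longrightarrow> shiftn 1 x \<in> Xk k)}
    = (Xk k \<times> UNIV) \<inter> (UNIV \<times> {u. u \<noteq> 0} \<union> (shiftn (-1) -` Xk k) \<times> UNIV)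
       \<inter> (UNIV \<times> {u. u \<noteq> c} \<union> (shiftn 1 -` Xk k) \<times> UNIV)" by auto
  moreover have "open \<dots>"
    by (intro open_Int open_Un open_Times clopen_Xk o o1 open_UNIV)
  ultimately show ?thesis unfolding Ek_def by (simp add: openin_open_Int)
qed

lemma Ek_B: "Ek k \<subseteq> B"
  unfolding Ek_def by (rule Int_lower1)

lemma Ek_sub: "Ek k \<subseteq> (X \<inter> Xk k) \<times> {0..c}"
  by (auto simp: Ek_def susp_region_def punctured_def)

text \<open>For the glued points \<open>(x, c)\<close> and \<open>(shiftn 1 x, 0)\<close> the
  definition of \<open>Ek\<close> imposes the same two conditions, on \<open>x\<close> and on
  \<open>shiftn 1 x\<close>. This is why it looks at a neighbour exactly at the heights 0 and
  c.\<close>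

lemma Ek_saturated: "p \<in> Ek k \<Longrightarrow> q \<in> B \<Longrightarrow> nf p = nf q \<Longrightarrow> q \<in> Ek k"
proof -
  assume a: "p \<in> Ek k" "q \<in> B" "nf p = nf q"
  have "x = y" if "shiftn 1 x = shiftn 1 y" for x y
    using that by (metis add.left_inverse shiftn_0 shiftn_shiftn)
  then show ?thesis
    using a c_pos by (cases p; cases q) (auto simp: Ek_def nf_def shift_map_eq mem_B split: if_splits)
qed

lemma Ek_cls: "p \<in> B \<Longrightarrow> cls p \<in> cls ` Ek k \<Longrightarrow> p \<in> Ek k"
proof -
  assume p: "p \<in> B" "cls p \<in> cls ` Ek k"
  then obtain q where q: "q \<in> Ek k" "cls p = cls q" by blast
  then have "q \<in> B" by (simp add: Ek_def)
  then show "p \<in> Ek k" using Ek_saturated[OF q(1) p(1)] q(2) p(1) by (simp add: cls_eq_iff)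
qed

lemma Ek_mono: "k \<le> l \<Longrightarrow> Ek k \<subseteq> Ek l"
  using Xk_mono[of k l] by (auto simp: Ek_def)

lemma Ek_exhaust: "p \<in> B \<Longrightarrow> \<exists>k. p \<in> Ek k"
proof -
  assume p: "p \<in> B"
  obtain x u where pu: "p = (x, u)" by force
  then have "x \<in> Y" using p by (simp add: mem_B)
  then obtain a b d where "x \<in> Xk a" "shiftn (-1) x \<in> Xk b" "shiftn 1 x \<in> Xk d"
    using Y_Xk[of x] Y_Xk[of "shiftn (-1) x"] Y_Xk[of "shiftn 1 x"] by auto
  then have "x \<in> Xk (max a (max b d))" "shiftn (-1) x \<in> Xk (max a (max b d))" "shiftn 1 x \<in> Xk (max a (max b d))"
    using Xk_mono[of a "max a (max b d)"] Xk_mono[of b "max a (max b d)"] Xk_mono[of d "max a (max b d)"]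
    by (simp_all add: le_max_iff_disj subset_iff)
  then show ?thesis using p pu by (intro exI[of _ "max a (max b d)"]) (simp add: Ek_def)
qed

lemma continuous_cls: "continuous_map (top_of_set B) SY cls"
proof (unfold continuous_map_def, intro conjI allI impI)
  show "cls \<in> topspace (top_of_set B) \<rightarrow> topspace SY" unfolding topspace_SY by simp
  fix U assume "openin SY U"
  then have "openin (top_of_set B) {p \<in> B. cls p \<in> U}" by (simp only: openin_SY)
  moreover have "topspace (top_of_set B) = B" by (rule topspace_euclidean_subtopology)
  ultimately show "openin (top_of_set B) {x \<in> topspace (top_of_set B). cls x \<in> U}" by (simp only:)
qed

lemma compactin_SY:
  assumes C: "C \<subseteq> cls ` B"
  shows "compactin SY C \<and> closedin SY C \<longleftrightarrow> closedin (top_of_set (X \<times> {0..c})) {p \<in> B. cls p \<in> C}" (is "_ \<longleftrightarrow> closedin ?D ?P")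
proof
  assume a: "compactin SY C \<and> closedin SY C"
  have op: "openin SY (cls ` Ek k)" for k
  proof -
    have "{p \<in> B. cls p \<in> cls ` Ek k} = Ek k"
    proof (intro subset_antisym subsetI)
      fix p assume "p \<in> {p \<in> B. cls p \<in> cls ` Ek k}"
      then show "p \<in> Ek k" using Ek_cls by simp
    next
      fix p assume "p \<in> Ek k"
      then show "p \<in> {p \<in> B. cls p \<in> cls ` Ek k}" using Ek_B[of k] by auto
    qed
    moreover have "cls ` Ek k \<subseteq> cls ` B" using Ek_B by (rule image_mono)
    ultimately show ?thesis using openin_Ek[of k] by (simp only: openin_SY simp_thms)
  qed
  have "C \<subseteq> \<Union>(range (\<lambda>k. cls ` Ek k))"
  proof
    fix y assume "y \<in> C"
    then obtain p where "p \<in> B" "y = cls p" using C by auto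
    then show "y \<in> \<Union>(range (\<lambda>k. cls ` Ek k))" using Ek_exhaust[of p] by blast
  qed
  moreover have "\<And>U. U \<in> range (\<lambda>k. cls ` Ek k) \<Longrightarrow> openin SY U" using op by auto
  ultimately obtain F where F: "finite F" "F \<subseteq> range (\<lambda>k. cls ` Ek k)" "C \<subseteq> \<Union>F"
    using compactinD[of SY C "range (\<lambda>k. cls ` Ek k)"] a by metis
  then obtain I where I: "finite I" "F = (\<lambda>k. cls ` Ek k) ` I"
    using finite_subset_image[OF F(1,2)] by blast
  have "C \<subseteq> cls ` Ek (Max I)"
  proof
    fix y assume "y \<in> C"
    then obtain k where "k \<in> I" "y \<in> cls ` Ek k" using F I by auto
    then show "y \<in> cls ` Ek (Max I)" using Ek_mono[of k "Max I"] I by auto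
  qed
  then have PE: "?P \<subseteq> Ek (Max I)" using Ek_cls[of _ "Max I"] by auto
  have "closedin (top_of_set B) ?P" using a by (simp add: closedin_SY)
  then obtain K where K: "closed K" "?P = B \<inter> K" by (auto simp: closedin_closed)
  \<comment> \<open>Inside \<open>Xk\<close> the all-ones fibre is absent, so a set closed relative
    to \<open>B\<close> is closed outright.\<close>
  have "?P = ((X \<inter> Xk (Max I)) \<times> {0..c}) \<inter> K"
  proof
    show "?P \<subseteq> (X \<inter> Xk (Max I)) \<times> {0..c} \<inter> K" using PE Ek_sub K by blast
    show "(X \<inter> Xk (Max I)) \<times> {0..c} \<inter> K \<subseteq> ?P"
      unfolding K(2) using Xk_not_one by (fastforce simp: susp_region_def punctured_def)
  qed
  moreover have "closed (((X \<inter> Xk (Max I)) \<times> {0..c}) \<inter> K)"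
    by (intro closed_Int closed_Times closed_X clopen_Xk K closed_atLeastAtMost)
  ultimately have "closed ?P" by simp
  moreover have "?P \<subseteq> X \<times> {0..c}" by (auto simp: susp_region_def punctured_def)
  ultimately show "closedin ?D ?P" by (simp add: closed_subset)
next
  assume a: "closedin ?D ?P"
  have sub: "B \<subseteq> X \<times> {0..c}" by (auto simp: susp_region_def punctured_def)
  have "closedin (top_of_set B) ?P"
    by (rule closedin_subset_trans[OF a _ sub]) auto
  then have cl: "closedin SY C" using C by (simp add: closedin_SY)
  have "compact ?P" by (rule closedin_compact[OF compact_XI a])
  then have "compactin (top_of_set B) ?P" by (auto simp: compactin_subtopology)
  then have "compactin SY (cls ` ?P)" by (rule image_compactin[OF _ continuous_cls])
  moreover have "cls ` ?P = C" using C by auto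
  ultimately show "compactin SY C \<and> closedin SY C" using cl by simp
qed

text \<open>Global coordinates: the point reached from \<open>(x, 0)\<close> after time
  \<open>c * v\<close>, for any real \<open>v\<close>. Every \<open>x\<close> outside
  \<open>Y\<close>, the all-ones point included, represents \<Delta>.\<close>

definition qv :: "config \<Rightarrow> real \<Rightarrow> (config \<times> real) set option" where
  "qv x v = (if x \<in> Y then Some (cls (shiftn \<lfloor>v\<rfloor> x, c * frac v)) else None)"

lemma frac_mem_B [simp]: "(shiftn k x, c * frac v) \<in> B \<longleftrightarrow> x \<in> Y"
proof -
  have "c * frac v \<le> c * 1" using c_pos frac_lt_1[of v] by (intro mult_left_mono) auto
  then show ?thesis using c_pos by (auto simp: mem_B)
qed

lemma qv_None: "x \<notin> Y \<Longrightarrow> qv x v = None"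
  by (simp add: qv_def)

lemma qv_shift: "qv (shiftn k x) v = qv x (v + of_int k)"
proof -
  have "frac (v + of_int k) = frac v" by (simp add: frac_def)
  then show ?thesis by (simp add: qv_def)
qed

lemma qv_cls:
  assumes "x \<in> Y" "0 \<le> u" "u \<le> c"
  shows "qv x (u / c) = Some (cls (x, u))"
proof (cases "u = c")
  case True
  have "cls (shiftn 1 x, 0) = cls (x, c)"
    using assms c_pos by (subst cls_eq_iff) (auto simp: mem_B nf_def shift_map_eq)
  then show ?thesis using True assms c_pos by (simp add: qv_def)
next
  case False
  then have "\<lfloor>u / c\<rfloor> = 0" using assms c_pos by (simp add: floor_eq_iff)
  then show ?thesis using assms c_pos by (simp add: qv_def frac_def)
qed

lemma qv_eq_iff:
  assumes "x \<in> Y" "y \<in> Y"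
  shows "qv x v = qv y w \<longleftrightarrow> shiftn \<lfloor>v\<rfloor> x = shiftn \<lfloor>w\<rfloor> y \<and> frac v = frac w"
proof -
  have "c * frac t \<noteq> c" for t using c_pos frac_lt_1[of t] by simp
  then show ?thesis using assms c_pos by (simp add: qv_def cls_eq_iff nf_def)
qed

lemma qv_eq_None_iff: "qv x v = None \<longleftrightarrow> x \<notin> Y"
  by (simp add: qv_def)

text \<open>Coordinates of one point differ by an integer that is moved from the height to the
  shift, and adding \<open>s\<close> to both heights respects this. It makes the flow well
  defined.\<close>

lemma qv_eq_add:
  assumes "qv x v = qv y w"
  shows "qv x (v + s) = qv y (w + s)"
proof (cases "x \<in> Y")
  case True
  then have y: "y \<in> Y" using assms qv_eq_None_iff by metis
  then have e: "shiftn \<lfloor>v\<rfloor> x = shiftn \<lfloor>w\<rfloor> y" "frac v = frac w" using assms True by (simp_all add: qv_eq_iff)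
  have "y = shiftn (- \<lfloor>w\<rfloor>) (shiftn \<lfloor>w\<rfloor> y)" by simp
  also have "\<dots> = shiftn (\<lfloor>v\<rfloor> - \<lfloor>w\<rfloor>) x" unfolding e(1)[symmetric] by simp
  finally have "qv y (w + s) = qv x (w + s + of_int (\<lfloor>v\<rfloor> - \<lfloor>w\<rfloor>))" by (metis qv_shift)
  also have "w + s + of_int (\<lfloor>v\<rfloor> - \<lfloor>w\<rfloor>) = v + s" using e(2) by (simp add: frac_def)
  finally show ?thesis by simp
next
  case False
  then have "y \<notin> Y" using assms qv_eq_None_iff by metis
  then show ?thesis using False by (simp add: qv_None)
qed

lemma qv_surj: "z \<in> topspace Z \<Longrightarrow> \<exists>x\<in>X. \<exists>u\<in>{0..c}. z = qv x (u / c)"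
proof -
  assume "z \<in> topspace Z"
  then consider "z = None" | p where "p \<in> B" "z = Some (cls p)" unfolding topspace_Z by auto
  then show ?thesis
  proof cases
    case 1
    have "qv (\<lambda>_. True) (0 / c) = None" by (simp add: qv_def punctured_def)
    then show ?thesis using 1 one_X c_pos by (intro bexI[of _ "\<lambda>_. True"] bexI[of _ 0]) auto
  next
    case 2
    obtain x u where p: "p = (x, u)" by force
    then have "x \<in> Y" "0 \<le> u" "u \<le> c" using 2 by (simp_all add: mem_B)
    then show ?thesis using 2 p qv_cls by (intro bexI[of _ x] bexI[of _ u]) (auto simp: punctured_def)
  qed
qed

lemma qv_topspace: "qv x v \<in> topspace Z"
  by (simp add: qv_def topspace_Z)

text \<open>The compactification is \<open>X \<times> {0..c}\<close> with the ends glued and the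
  all-ones fibre collapsed, so continuity can be tested upstairs. Sets without \<Delta> are compared
  through the topology of \<open>B\<close>, sets with \<Delta> through their complements and
  \<open>compactin_SY\<close>.\<close>

lemma quotient_qv: "quotient_map (top_of_set (X \<times> {0..c})) Z (\<lambda>(x, u). qv x (u / c))"
  unfolding quotient_map_def
proof (intro conjI allI impI)
  let ?D = "top_of_set (X \<times> {0..c})" and ?f = "\<lambda>(x, u). qv x (u / c)"
  show "?f ` topspace ?D = topspace Z"
  proof
    show "?f ` topspace ?D \<subseteq> topspace Z" using qv_topspace by auto
    show "topspace Z \<subseteq> ?f ` topspace ?D"
    proof
      fix z assume "z \<in> topspace Z"
      then obtain x u where "x \<in> X" "u \<in> {0..c}" "z = qv x (u / c)" using qv_surj by blast
      then show "z \<in> ?f ` topspace ?D" by (intro image_eqI[of _ _ "(x, u)"]) auto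
    qed
  qed
  fix U assume U: "U \<subseteq> topspace Z"
  have BD: "B \<subseteq> X \<times> {0..c}" by (auto simp: susp_region_def punctured_def)
  have fB: "?f p = Some (cls p)" if "p \<in> B" for p
    using that by (cases p) (simp add: mem_B qv_cls)
  have fnB: "?f p = None" if "p \<in> X \<times> {0..c}" "p \<notin> B" for p
    using that by (cases p) (auto simp: mem_B qv_None)
  let ?P = "\<lambda>C. {p \<in> B. cls p \<in> C}"
  show "openin ?D {p \<in> topspace ?D. ?f p \<in> U} = openin Z U"
  proof (cases "None \<in> U")
    case False
    define V where "V = {k \<in> cls ` B. Some k \<in> U}"
    have UV: "U = Some ` V"
    proof
      show "U \<subseteq> Some ` V"
      proof
        fix z assume z: "z \<in> U"
        then obtain k where "z = Some k" using False by (cases z) auto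
        then show "z \<in> Some ` V" using U z unfolding topspace_Z V_def by auto
      qed
    qed (auto simp: V_def)
    have pre: "{p \<in> topspace ?D. ?f p \<in> U} = ?P V"
    proof (intro set_eqI iffI)
      fix p assume "p \<in> {p \<in> topspace ?D. ?f p \<in> U}"
      then have p: "p \<in> X \<times> {0..c}" "?f p \<in> U" by auto
      then have pB: "p \<in> B" using fnB False by metis
      then show "p \<in> ?P V" using p(2) fB[OF pB] V_def by auto
    next
      fix p assume "p \<in> ?P V"
      then have "p \<in> B" "cls p \<in> V" by auto
      then show "p \<in> {p \<in> topspace ?D. ?f p \<in> U}" using fB[of p] BD unfolding UV by auto
    qed
    \<comment> \<open>Only the closed fibre over the all-ones point is removed.\<close>
    have oB: "openin ?D B"
    proof -
      have "B = (X \<times> {0..c}) \<inter> ((- {\<lambda>_. True}) \<times> UNIV)"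
        by (auto simp: susp_region_def punctured_def)
      moreover have "open ((- {\<lambda>_ :: int. True}) \<times> (UNIV :: real set))" 
        by (intro open_Times open_Compl closed_one open_UNIV)
      ultimately show ?thesis by (simp only: openin_open_Int)
    qed
    have "openin Z U \<longleftrightarrow> openin SY V"
      unfolding UV susp_compactification_def by simp
    also have "\<dots> \<longleftrightarrow> openin (top_of_set B) (?P V)" by (auto simp only: openin_SY V_def)
    also have "\<dots> \<longleftrightarrow> openin ?D (?P V)"
    proof
      assume "openin (top_of_set B) (?P V)"
      then show "openin ?D (?P V)" using oB by (rule openin_trans)
    next
      assume "openin ?D (?P V)"
      then show "openin (top_of_set B) (?P V)" by (rule openin_subset_trans[OF _ _ BD]) auto
    qed
    finally show ?thesis unfolding pre by simp
  next
    case True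
    define C where "C = {k \<in> cls ` B. Some k \<notin> U}"
    have CB: "C \<subseteq> cls ` B" by (auto simp: C_def)
    have UC: "topspace Z - U = Some ` C"
      unfolding topspace_Z C_def using True by auto
    have pre: "topspace ?D - {p \<in> topspace ?D. ?f p \<in> U} = ?P C"
    proof (intro set_eqI iffI)
      fix p assume "p \<in> topspace ?D - {p \<in> topspace ?D. ?f p \<in> U}"
      then have p: "p \<in> X \<times> {0..c}" "?f p \<notin> U" by auto
      then have pB: "p \<in> B" using fnB True by metis
      then show "p \<in> ?P C" using p(2) fB[OF pB] C_def by auto
    next
      fix p assume "p \<in> ?P C"
      then have "p \<in> B" "cls p \<in> C" by auto
      then show "p \<in> topspace ?D - {p \<in> topspace ?D. ?f p \<in> U}" using fB[of p] BD unfolding C_def by auto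
    qed
    have "openin Z U \<longleftrightarrow> closedin Z (topspace Z - U)" using U by (simp add: openin_closedin_eq)
    also have "\<dots> \<longleftrightarrow> compactin SY C \<and> closedin SY C"
      unfolding UC by (simp add: susp_compactification_def)
    also have "\<dots> \<longleftrightarrow> closedin ?D (?P C)" by (rule compactin_SY[OF CB])
    also have "\<dots> \<longleftrightarrow> openin ?D {p \<in> topspace ?D. ?f p \<in> U}"
      unfolding pre[symmetric] by (subst openin_closedin_eq) auto
    finally show ?thesis by simp
  qed
qed

text \<open>On the strip of heights from \<open>k * c\<close> to \<open>k * c + c\<close> the map is
  the quotient map after moving \<open>k\<close> into the shift. The strips form a locally finite
  closed cover, so the pieces paste together.\<close>

lemma continuous_qv: "continuous_map (top_of_set (X \<times> UNIV)) Z (\<lambda>(x, r). qv x (r / c))"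
proof -
  let ?T = "\<lambda>k::int. X \<times> {of_int k * c..of_int k * c + c}"
  let ?g = "\<lambda>(x, r). qv x (r / c)"
  let ?h = "\<lambda>(k::int) p. (shiftn k (fst p), snd p - of_int k * c)"
  show ?thesis
  proof (rule pasting_lemma_locally_finite[where I = UNIV and T = ?T and f = "\<lambda>_. ?g"])
    fix p assume p: "p \<in> topspace (top_of_set (X \<times> (UNIV :: real set)))"
    obtain x r where xr: "p = (x, r)" by force
    define m where "m = \<lfloor>r / c\<rfloor>"
    have m: "of_int m * c \<le> r" "r < of_int m * c + c"
      unfolding m_def using floor_divide_lower[OF c_pos, of r] floor_divide_upper[OF c_pos, of r]
      by (simp_all add: distrib_right)
    let ?V = "X \<times> {r - c<..<r + c}"
    have "openin (top_of_set (X \<times> UNIV)) ?V"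
    proof -
      have "?V = (X \<times> UNIV) \<inter> (UNIV \<times> {r - c<..<r + c})" by auto
      moreover have "open ((UNIV :: config set) \<times> {r - c<..<r + c})" by (intro open_Times) auto
      ultimately show ?thesis by (simp only: openin_open_Int)
    qed
    moreover have "p \<in> ?V" using p xr c_pos by auto
    moreover have "finite {i \<in> UNIV. ?T i \<inter> ?V \<noteq> {}}"
    proof (rule finite_subset)
      show "{i \<in> UNIV. ?T i \<inter> ?V \<noteq> {}} \<subseteq> {m - 3..m + 3}"
      proof
        fix i assume "i \<in> {i \<in> UNIV. ?T i \<inter> ?V \<noteq> {}}"
        then obtain s where s: "of_int i * c \<le> s" "s \<le> of_int i * c + c" "r - c < s" "s < r + c" by auto
        have "of_int i * c < of_int (m + 2) * c" using s m by (simp add: algebra_simps)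
        then have "of_int i < (of_int (m + 2) :: real)" using c_pos by (simp only: mult_less_cancel_right_pos)
        moreover have "of_int (m - 2) * c < of_int i * c" using s m by (simp add: algebra_simps)
        then have "of_int (m - 2) < (of_int i :: real)" using c_pos by (simp only: mult_less_cancel_right_pos)
        ultimately show "i \<in> {m - 3..m + 3}" by simp
      qed
    qed simp
    ultimately show "\<exists>V. openin (top_of_set (X \<times> UNIV)) V \<and> p \<in> V \<and> finite {i \<in> UNIV. ?T i \<inter> V \<noteq> {}}"
      by blast
  next
    fix k :: int
    have "?T k = (X \<times> UNIV) \<inter> (UNIV \<times> {of_int k * c..of_int k * c + c})" by auto
    moreover have "closed ((UNIV :: config set) \<times> {of_int k * c..of_int k * c + c})" by (intro closed_Times) auto
    ultimately show "closedin (top_of_set (X \<times> UNIV)) (?T k)" by (simp only: closedin_closed_Int)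
  next
    fix k :: int
    have cont: "continuous_map (top_of_set (?T k)) (top_of_set (X \<times> {0..c})) (?h k)"
    proof (subst continuous_map_subtopology_eu, intro conjI)
      have "continuous_on (?T k) (\<lambda>p. shiftn k (fst p))"
        by (rule continuous_on_compose2[OF continuous_on_shiftn[of UNIV]]) (auto intro: continuous_intros)
      then show "continuous_on (?T k) (?h k)"
        by (intro continuous_on_Pair continuous_on_diff continuous_on_snd continuous_on_id continuous_on_const)
      show "?h k \<in> ?T k \<rightarrow> X \<times> {0..c}" by auto
    qed
    have "continuous_map (top_of_set (?T k)) Z ((\<lambda>(x, u). qv x (u / c)) \<circ> ?h k)"
      by (rule continuous_map_compose[OF cont quotient_imp_continuous_map[OF quotient_qv]])
    moreover have "((\<lambda>(x, u). qv x (u / c)) \<circ> ?h k) = ?g"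
      using c_pos by (auto simp: fun_eq_iff qv_shift diff_divide_distrib)
    moreover have "subtopology (top_of_set (X \<times> UNIV)) (?T k) = top_of_set (?T k)"
      by (simp add: subtopology_subtopology) (metis Times_Int_Times Int_UNIV_left inf.idem)
    ultimately show "continuous_map (subtopology (top_of_set (X \<times> UNIV)) (?T k)) Z ?g" by simp
  next
    fix p assume p: "p \<in> topspace (top_of_set (X \<times> (UNIV :: real set)))"
    obtain x r where xr: "p = (x, r)" by force
    have "p \<in> ?T \<lfloor>r / c\<rfloor>"
      using p xr floor_divide_lower[OF c_pos, of r] floor_divide_upper[OF c_pos, of r]
      by (simp add: distrib_right)
    then show "\<exists>j. j \<in> UNIV \<and> p \<in> ?T j \<and> ?g p = ?g p" by blast
  qed simp
qed

text \<open>The choice picks any coordinates of \<open>z\<close>; by \<open>qv_eq_add\<close> the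
  value does not depend on it.\<close>

definition flow :: "real \<Rightarrow> (config \<times> real) set option \<Rightarrow> (config \<times> real) set option" where
  "flow t z = (case (SOME p. z = qv (fst p) (snd p)) of (x, v) \<Rightarrow> qv x (v + t / c))"

lemma flow_qv: "flow t (qv x v) = qv x (v + t / c)"
proof -
  obtain y w where yw: "(SOME p. qv x v = qv (fst p) (snd p)) = (y, w)" by force
  have "qv x v = qv (fst (y, w)) (snd (y, w))"
    unfolding yw[symmetric] by (rule someI[where x = "(x, v)"]) simp
  then have "qv x (v + t / c) = qv y (w + t / c)" by (intro qv_eq_add) simp
  then show ?thesis by (simp add: flow_def yw)
qed

text \<open>The real line is locally compact, so the quotient map times the identity of the line is
  again a quotient map. Joint continuity thus reduces to that of \<open>qv\<close> after an addition
  of heights.\<close>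

lemma is_flow_flow: "is_flow Z flow"
  unfolding is_flow_def
proof (intro conjI ballI allI)
  let ?D = "top_of_set (X \<times> {0..c})"
  let ?Q = "\<lambda>(x, u). qv x (u / c)"
  have q: "quotient_map (prod_topology ?D euclideanreal) (prod_topology Z euclideanreal) (\<lambda>(p, t). (?Q p, t))"
    by (rule quotient_map_prod_left[OF _ _ quotient_qv]) (auto simp: locally_compact_space_euclidean)
  have "continuous_map (prod_topology ?D euclideanreal) Z ((\<lambda>(z, t). flow t z) \<circ> (\<lambda>(p, t). (?Q p, t)))"
  proof -
    have "continuous_map (top_of_set ((X \<times> {0..c}) \<times> UNIV)) (top_of_set (X \<times> UNIV)) (\<lambda>(p, t). (fst p, snd p + t))"
      by (subst continuous_map_subtopology_eu) (auto simp: split_beta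
          intro!: continuous_on_Pair continuous_on_add continuous_on_fst continuous_on_snd continuous_on_id)
    from continuous_map_compose[OF this continuous_qv]
    have "continuous_map (top_of_set ((X \<times> {0..c}) \<times> (UNIV :: real set))) Z ((\<lambda>(x, r). qv x (r / c)) \<circ> (\<lambda>(p, t). (fst p, snd p + t)))" .
    moreover have "((\<lambda>(x, r). qv x (r / c)) \<circ> (\<lambda>(p, t). (fst p, snd p + t))) = ((\<lambda>(z, t). flow t z) \<circ> (\<lambda>(p, t). (?Q p, t)))"
      by (auto simp: fun_eq_iff flow_qv add_divide_distrib)
    moreover have "prod_topology ?D euclideanreal = top_of_set ((X \<times> {0..c}) \<times> (UNIV :: real set))"
      by (metis euclidean_product_topology prod_topology_subtopology_eu subtopology_UNIV)
    ultimately show ?thesis by simp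
  qed
  then show "continuous_map (prod_topology Z euclideanreal) Z (\<lambda>(z, t). flow t z)"
    by (rule continuous_compose_quotient_map[OF q])
next
  fix z assume "z \<in> topspace Z"
  then obtain x u where z: "z = qv x (u / c)" using qv_surj by blast
  show "flow 0 z = z" unfolding z flow_qv by simp
  fix s t
  show "flow t (flow s z) = flow (t + s) z" unfolding z flow_qv by (simp add: add_divide_distrib algebra_simps)
qed

lemma suspension_flow_flow: "suspension_flow Y (\<lambda>_. c) flow"
  unfolding suspension_flow_def
proof (intro conjI allI is_flow_flow)
  fix t
  have "flow t (qv (\<lambda>_. True) 0) = None" by (simp only: flow_qv) (simp add: qv_def punctured_def)
  then show "flow t None = None" by (simp add: qv_def punctured_def)
next
  show "\<forall>(x, u)\<in>B. \<forall>t. - u \<le> t \<and> t < c - u \<longrightarrow> flow t (Some (cls (x, u))) = Some (cls (x, u + t))"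
  proof (clarify)
    fix x u t assume a: "(x, u) \<in> B" "- u \<le> t" "t < c - u"
    then have x: "x \<in> Y" "0 \<le> u" "u \<le> c" by (simp_all add: mem_B)
    have "flow t (Some (cls (x, u))) = flow t (qv x (u / c))" using x by (simp add: qv_cls)
    also have "\<dots> = qv x ((u + t) / c)" by (simp add: flow_qv add_divide_distrib)
    also have "\<dots> = Some (cls (x, u + t))" using x a by (intro qv_cls) auto
    finally show "flow t (Some (cls (x, u))) = Some (cls (x, u + t))" .
  qed
qed

lemma roof_function_const: "roof_function Y (\<lambda>_. c)"
  using c_pos by (simp add: roof_function_def)

end

section \<open>Generating algebras and measurability\<close>

text \<open>The sets approximable from \<open>G\<close> form a \<sigma>-algebra: a countable union
  is first cut to a finite one at the cost of \<open>e / 2\<close>, then each piece is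
  approximated.\<close>

lemma approx_by_algebra:
  assumes fin: "finite_measure M" and alg: "algebra (space M) G"
    and gen: "sets M = sigma_sets (space M) G"
    and A: "A \<in> sets M" and e: "0 < e"
  shows "\<exists>B\<in>G. measure M ((A - B) \<union> (B - A)) < e"
proof -
  interpret finite_measure M by fact
  interpret algebra "space M" G by fact
  have Gs: "B \<in> sets M" if "B \<in> G" for B unfolding gen using that by (rule sigma_sets.Basic)
  have "\<forall>e>0. \<exists>B\<in>G. measure M ((A - B) \<union> (B - A)) < e"
    using A unfolding gen
  proof (induction rule: sigma_sets.induct)
    case (Basic a)
    then show ?case by (intro allI impI bexI[of _ a]) auto
  next
    case Empty
    show ?case by (intro allI impI bexI[of _ "{}"]) auto
  next
    case (Compl a)
    show ?case
    proof (intro allI impI)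
      fix e :: real assume "0 < e"
      then obtain B where B: "B \<in> G" "measure M ((a - B) \<union> (B - a)) < e" using Compl.IH by blast
      have "a \<subseteq> space M" using Compl.hyps gen sets.sets_into_space by blast
      moreover have "B \<subseteq> space M" using B Gs sets.sets_into_space by blast
      ultimately have "((space M - a) - (space M - B)) \<union> ((space M - B) - (space M - a)) = (a - B) \<union> (B - a)" by blast
      then show "\<exists>B\<in>G. measure M ((space M - a - B) \<union> (B - (space M - a))) < e"
        using B by (intro bexI[of _ "space M - B"]) auto
    qed
  next
    case (Union a)
    show ?case
    proof (intro allI impI)
      fix e :: real assume e: "0 < e"
      have as: "a i \<in> sets M" for i unfolding gen by (rule Union.hyps)
      have "(\<lambda>n. measure M (\<Union>i<n. a i)) \<longlonglongrightarrow> measure M (\<Union>n. \<Union>i<n. a i)"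
        by (intro finite_Lim_measure_incseq) (auto simp: incseq_def as intro: less_le_trans)
      moreover have "(\<Union>n. \<Union>i<n. a i) = (\<Union>i. a i)" by auto
      ultimately have "(\<lambda>n. measure M (\<Union>i<n. a i)) \<longlonglongrightarrow> measure M (\<Union>i. a i)" by simp
      then obtain n where "\<bar>measure M (\<Union>i<n. a i) - measure M (\<Union>i. a i)\<bar> < e / 2"
        using e LIMSEQ_D[of _ _ "e / 2"] by (metis half_gt_zero order_refl real_norm_def)
      moreover have "measure M ((\<Union>i. a i) - (\<Union>i<n. a i)) = measure M (\<Union>i. a i) - measure M (\<Union>i<n. a i)"
        using as by (intro finite_measure_Diff) auto
      ultimately have n: "measure M ((\<Union>i. a i) - (\<Union>i<n. a i)) < e / 2" by linarith
      \<comment> \<open>The \<open>n\<close> pieces together cost at most \<open>e / 2\<close>;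
        dividing by \<open>n + 1\<close> covers n = 0.\<close>
      have "\<forall>i. \<exists>B\<in>G. measure M ((a i - B) \<union> (B - a i)) < e / (2 * real (n + 1))"
        using Union.IH e by simp
      then obtain b where b: "\<And>i. b i \<in> G" "\<And>i. measure M ((a i - b i) \<union> (b i - a i)) < e / (2 * real (n + 1))"
        by metis
      let ?B = "\<Union>i<n. b i"
      have bs: "b i \<in> sets M" for i using b Gs by blast
      have BG: "?B \<in> G" using b by (intro finite_UN) auto
      have "measure M (((\<Union>i. a i) - ?B) \<union> (?B - (\<Union>i. a i)))
          \<le> measure M (((\<Union>i. a i) - (\<Union>i<n. a i)) \<union> (\<Union>i<n. (a i - b i) \<union> (b i - a i)))"
        using as bs by (intro finite_measure_mono) auto
      also have "\<dots> \<le> measure M ((\<Union>i. a i) - (\<Union>i<n. a i)) + measure M (\<Union>i<n. (a i - b i) \<union> (b i - a i))"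
        using as bs by (intro measure_Un_le) auto
      also have "measure M (\<Union>i<n. (a i - b i) \<union> (b i - a i)) \<le> (\<Sum>i<n. measure M ((a i - b i) \<union> (b i - a i)))"
        using as bs by (intro finite_measure_subadditive_finite) auto
      also have "\<dots> \<le> (\<Sum>i<n. e / (2 * real (n + 1)))" using b by (intro sum_mono less_imp_le)
      also have "\<dots> = real n * (e / (2 * real (n + 1)))" by simp
      also have "\<dots> \<le> e / 2" using e by (simp add: field_simps)
      finally have "measure M (((\<Union>i. a i) - ?B) \<union> (?B - (\<Union>i. a i))) < e" using n by linarith
      then show "\<exists>B\<in>G. measure M ((\<Union> (range a) - B) \<union> (B - \<Union> (range a))) < e" using BG by blast
    qed
  qed
  then show ?thesis using e by blast
qed

section \<open>Windows and dyadic cells as generators of the Borel sets\<close>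

definition win :: "nat \<Rightarrow> config \<Rightarrow> bool list" where
  "win K x = map x [- int K..int K]"

lemma win_eq_iff: "win K x = win K y \<longleftrightarrow> (\<forall>i. \<bar>i\<bar> \<le> int K \<longrightarrow> x i = y i)"
  by (auto simp: win_def abs_le_iff)

lemma win_mono: "K \<le> L \<Longrightarrow> win L x = win L y \<Longrightarrow> win K x = win K y"
  unfolding win_eq_iff using order_trans[of _ "int K" "int L"] by auto

lemma finite_range_win: "finite (range (win K))"
proof (rule finite_subset)
  show "range (win K) \<subseteq> {xs. set xs \<subseteq> UNIV \<and> length xs = length [- int K..int K]}" by (auto simp: win_def)
qed (rule finite_lists_length_eq, simp)

lemma clopen_win: "open {x. win K x = w}" "closed {x. win K x = w}"
proof -
  have "open {x. win K x = w} \<and> closed {x. win K x = w}"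
  proof (cases "\<exists>y. w = win K y")
    case True
    then obtain y where "w = win K y" by blast
    then have eq: "{x. win K x = w} = (\<Inter>i\<in>{- int K..int K}. {x. x i = y i})"
      by (auto simp: win_eq_iff abs_le_iff)
    show ?thesis unfolding eq
      by (intro conjI open_INT closed_INT ballI clopen_coordinate) simp
  next
    case False
    then have "{x. win K x = w} = {}" by blast
    then show ?thesis by simp
  qed
  then show "open {x. win K x = w}" "closed {x. win K x = w}" by blast+
qed

lemma open_config_win:
  assumes "open U" "x \<in> U"
  shows "\<exists>K. \<forall>y. win K y = win K x \<longrightarrow> y \<in> U"
proof -
  have "openin (product_topology (\<lambda>_::int. euclidean :: bool topology) UNIV) U"
    using assms(1) by (simp add: euclidean_product_topology)
  then obtain V where V: "x \<in> Pi\<^sub>E UNIV V" "finite {i. V i \<noteq> topspace euclidean}" "Pi\<^sub>E UNIV V \<subseteq> U"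
    using product_topology_open_contains_basis[OF _ assms(2)] by blast
  let ?I = "{i. V i \<noteq> topspace euclidean}"
  define K where "K = nat (Max (insert 0 (abs ` ?I)))"
  have K: "\<bar>i\<bar> \<le> int K" if "i \<in> ?I" for i
  proof -
    have "\<bar>i\<bar> \<le> Max (insert 0 (abs ` ?I))" using that V(2) by (intro Max_ge) auto
    then show ?thesis unfolding K_def by linarith
  qed
  have "y \<in> U" if "win K y = win K x" for y
  proof -
    have "y \<in> Pi\<^sub>E UNIV V"
    proof (rule PiE_I)
      fix i
      show "y i \<in> V i"
      proof (cases "i \<in> ?I")
        case True
        then have "y i = x i" using that K[of i] by (simp add: win_eq_iff)
        then show ?thesis using V(1) by auto
      next
        case False
        then have "V i = UNIV" by simp
        then show ?thesis by simp
      qed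
    qed simp
    then show ?thesis using V(3) by blast
  qed
  then show ?thesis by blast
qed

text \<open>Sets decided by one stage of a sequence of observables; serves for windows of
  configurations and for cells of \<open>config \<times> real\<close> alike.\<close>

definition determined :: "(nat \<Rightarrow> 'a \<Rightarrow> 'k) \<Rightarrow> 'a set set" where
  "determined f = {A. \<exists>K. \<forall>x y. f K x = f K y \<longrightarrow> (x \<in> A \<longleftrightarrow> y \<in> A)}"

lemma algebra_determined:
  assumes mono: "\<And>K L x y. K \<le> L \<Longrightarrow> f L x = f L y \<Longrightarrow> f K x = f K y"
  shows "algebra UNIV (determined f)"
proof (rule algebra_iff_Un[THEN iffD2], intro conjI ballI)
  show "determined f \<subseteq> Pow UNIV" by simp
  show "{} \<in> determined f" by (auto simp: determined_def)
  fix A assume "A \<in> determined f"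
  then obtain K where K: "\<forall>x y. f K x = f K y \<longrightarrow> (x \<in> A \<longleftrightarrow> y \<in> A)" by (auto simp: determined_def)
  show "UNIV - A \<in> determined f" unfolding determined_def using K by blast
  fix A' assume "A' \<in> determined f"
  then obtain K' where K': "\<forall>x y. f K' x = f K' y \<longrightarrow> (x \<in> A' \<longleftrightarrow> y \<in> A')" by (auto simp: determined_def)
  have "\<forall>x y. f (max K K') x = f (max K K') y \<longrightarrow> (x \<in> A \<union> A' \<longleftrightarrow> y \<in> A \<union> A')"
    using K K' mono[of K "max K K'"] mono[of K' "max K K'"] by (metis UnE UnI1 UnI2 max.cobounded1 max.cobounded2)
  then show "A \<union> A' \<in> determined f" unfolding determined_def by blast
qed

text \<open>An open set is the union over \<open>K\<close> of the points whose whole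
  stage-\<open>K\<close> atom lies in it; conversely a determined set is a countable union of
  atoms.\<close>

lemma sigma_sets_determined:
  fixes f :: "nat \<Rightarrow> 'a::topological_space \<Rightarrow> 'k"
  assumes borel: "\<And>K w. {x. f K x = w} \<in> sets borel" and count: "\<And>K. countable (range (f K))"
    and basis: "\<And>U x. open U \<Longrightarrow> x \<in> U \<Longrightarrow> \<exists>K. \<forall>y. f K y = f K x \<longrightarrow> y \<in> U"
  shows "sets borel = sigma_sets UNIV (determined f)"
proof
  have "A \<in> sets borel" if A: "A \<in> determined f" for A
  proof -
    from A obtain K where K: "\<forall>x y. f K x = f K y \<longrightarrow> (x \<in> A \<longleftrightarrow> y \<in> A)" by (auto simp: determined_def)
    have "A = (\<Union>w\<in>f K ` A. {x. f K x = w})"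
    proof (intro subset_antisym subsetI)
      fix x assume "x \<in> (\<Union>w\<in>f K ` A. {x. f K x = w})"
      then obtain y where "y \<in> A" "f K x = f K y" by blast
      then show "x \<in> A" using K by blast
    qed blast
    moreover have "(\<Union>w\<in>f K ` A. {x. f K x = w}) \<in> sets borel"
      by (intro sets.countable_UN' countable_subset[OF _ count[of K]]) (auto simp: borel)
    ultimately show ?thesis by simp
  qed
  then show "sigma_sets UNIV (determined f) \<subseteq> sets borel"
    using sets.sigma_sets_subset[of "determined f" borel] by auto
  have op: "U \<in> sigma_sets UNIV (determined f)" if "open U" for U
  proof -
    have "U = (\<Union>K. {x. \<forall>y. f K y = f K x \<longrightarrow> y \<in> U})" using basis[OF that] by auto
    moreover have "(\<Union>K. {x. \<forall>y. f K y = f K x \<longrightarrow> y \<in> U}) \<in> sigma_sets UNIV (determined f)"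
    proof (rule sigma_sets.Union, rule sigma_sets.Basic)
      fix K show "{x. \<forall>y. f K y = f K x \<longrightarrow> y \<in> U} \<in> determined f"
        unfolding determined_def by (intro CollectI exI[of _ K]) auto
    qed
    ultimately show ?thesis by simp
  qed
  have "sets (borel :: 'a measure) = sigma_sets UNIV {U. open U}" by (simp add: borel_def)
  also have "\<dots> \<subseteq> sigma_sets UNIV (determined f)" by (rule sigma_sets_mono) (use op in auto)
  finally show "sets borel \<subseteq> sigma_sets UNIV (determined f)" .
qed

lemma borel_config: "sets (borel :: config measure) = sigma_sets UNIV (determined win)"
proof (rule sigma_sets_determined)
  show "{x. win K x = w} \<in> sets borel" for K w by (intro borel_open clopen_win)
  show "countable (range (win K))" for K by (intro countable_finite finite_range_win)
qed (rule open_config_win)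

text \<open>Heights are cut dyadically so that finer cells refine coarser ones.\<close>

definition cell :: "nat \<Rightarrow> config \<times> real \<Rightarrow> bool list \<times> int" where
  "cell K p = (win K (fst p), \<lfloor>2 ^ K * snd p\<rfloor>)"

lemma cell_mono: "K \<le> L \<Longrightarrow> cell L p = cell L q \<Longrightarrow> cell K p = cell K q"
proof -
  assume a: "K \<le> L" "cell L p = cell L q"
  have "\<lfloor>2 ^ K * v\<rfloor> = \<lfloor>2 ^ L * v\<rfloor> div 2 ^ (L - K)" for v :: real
  proof -
    have "(2::real) ^ L = 2 ^ K * 2 ^ (L - K)" using a(1) by (simp flip: power_add)
    then have "2 ^ K * v = 2 ^ L * v / real_of_int (2 ^ (L - K))" by simp
    then show ?thesis by (simp only: floor_divide_real_eq_div zero_le_power zero_le_numeral)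
  qed
  moreover have "win L (fst p) = win L (fst q)" "\<lfloor>2 ^ L * snd p\<rfloor> = \<lfloor>2 ^ L * snd q\<rfloor>"
    using a(2) unfolding cell_def prod.inject by blast+
  ultimately show ?thesis using win_mono[OF a(1)] unfolding cell_def prod.inject by metis
qed

lemma cell_basis:
  assumes "open U" "p \<in> U"
  shows "\<exists>K. \<forall>q. cell K q = cell K p \<longrightarrow> q \<in> U"
proof -
  obtain V W where VW: "open V" "open W" "fst p \<in> V" "snd p \<in> W" "V \<times> W \<subseteq> U"
    using assms open_prod_elim[of U p] by (metis SigmaE2 prod.collapse)
  obtain K1 where K1: "\<And>y. win K1 y = win K1 (fst p) \<Longrightarrow> y \<in> V" using open_config_win[OF VW(1,3)] by blast
  obtain e where e: "0 < e" "\<And>y. \<bar>y - snd p\<bar> < e \<Longrightarrow> y \<in> W"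
    using VW(2,4) unfolding open_dist dist_real_def by blast
  obtain K2 where K2: "(1/2)^K2 < e" using real_arch_pow_inv[OF e(1), of "1/2"] by auto
  define K where "K = max K1 K2"
  have "q \<in> U" if "cell K q = cell K p" for q
  proof -
    have "cell K1 q = cell K1 p" "cell K2 q = cell K2 p" 
      using cell_mono[OF _ that, of K1] cell_mono[OF _ that, of K2] unfolding K_def by simp_all
    then have "fst q \<in> V" "\<lfloor>2 ^ K2 * snd q\<rfloor> = \<lfloor>2 ^ K2 * snd p\<rfloor>" using K1 by (auto simp: cell_def)
    then have "\<bar>2 ^ K2 * snd q - 2 ^ K2 * snd p\<bar> < 1" by linarith
    then have "\<bar>2 ^ K2 * (snd q - snd p)\<bar> < 1" by (simp add: right_diff_distrib)
    then have "2 ^ K2 * \<bar>snd q - snd p\<bar> < 1" by (simp add: abs_mult)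
    then have "\<bar>snd q - snd p\<bar> < (1/2)^K2" by (simp add: field_simps power_one_over)
    then have "snd q \<in> W" using K2 by (intro e(2)) linarith
    then show ?thesis using VW(5) \<open>fst q \<in> V\<close> by (cases q) auto
  qed
  then show ?thesis by blast
qed

lemma borel_cell: "{p. cell K p = w} \<in> sets borel"
proof -
  have "{p. cell K p = w} = {x. win K x = fst w} \<times> {v. \<lfloor>2 ^ K * v\<rfloor> = snd w}"
    by (auto simp: cell_def)
  moreover have "{x. win K x = fst w} \<in> sets borel" using clopen_win by auto
  moreover have "{v::real. \<lfloor>2 ^ K * v\<rfloor> = snd w} \<in> sets borel" by measurable
  ultimately show ?thesis by (simp add: borel_Times)
qed

lemma borel_config_real: "sets (borel :: (config \<times> real) measure) = sigma_sets UNIV (determined cell)"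
proof (rule sigma_sets_determined)
  show "countable (range (cell K))" for K
  proof (rule countable_subset)
    show "range (cell K) \<subseteq> range (win K) \<times> UNIV" by (auto simp: cell_def)
    show "countable (range (win K) \<times> (UNIV :: int set))" 
      by (intro countable_SIGMA countable_finite[OF finite_range_win] countableI_type)
  qed
  show "{p. cell K p = w} \<in> sets borel" for K w by (rule borel_cell)
  show "\<exists>K. \<forall>q. cell K q = cell K p \<longrightarrow> q \<in> U" if "open U" "p \<in> U" for U p
    using that by (rule cell_basis)
qed

lemma measurable_shiftn [measurable]: "shiftn k \<in> borel_measurable borel"
  by (intro borel_measurable_continuous_onI continuous_on_shiftn)

section \<open>Borel structure of the compactified suspension\<close>

context const_suspension
begin

lemma sets_borel_of: "sets (borel_of Z) = sigma_sets (topspace Z) {U. openin Z U}"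
  unfolding borel_of_def by (rule sets_measure_of) (use openin_subset in auto)

lemma space_borel_of: "space (borel_of Z) = topspace Z"
  unfolding borel_of_def by (rule space_measure_of) (use openin_subset in auto)

lemma borel_of_open: "openin Z U \<Longrightarrow> U \<in> sets (borel_of Z)"
  unfolding sets_borel_of by (rule sigma_sets.Basic) simp

lemma measurable_qv [measurable]: "(\<lambda>(x, v). qv x v) \<in> borel \<rightarrow>\<^sub>M borel_of Z"
  unfolding borel_of_def
proof (rule measurable_measure_of)
  show "{U. openin Z U} \<subseteq> Pow (topspace Z)" using openin_subset by auto
  show "(\<lambda>(x, v). qv x v) \<in> space borel \<rightarrow> topspace Z" using qv_topspace by auto
  fix U assume "U \<in> {U. openin Z U}"
  then have U: "openin Z U" by simp
  have "continuous_map (top_of_set (X \<times> UNIV)) (top_of_set (X \<times> UNIV)) (\<lambda>p. (fst p, c * snd p))"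
    by (subst continuous_map_subtopology_eu)
       (auto intro!: continuous_on_Pair continuous_on_mult continuous_on_fst continuous_on_snd continuous_on_id continuous_on_const)
  from continuous_map_compose[OF this continuous_qv]
  have "continuous_map (top_of_set (X \<times> UNIV)) Z ((\<lambda>(x, r). qv x (r / c)) \<circ> (\<lambda>p. (fst p, c * snd p)))" .
  moreover have "(\<lambda>(x, r). qv x (r / c)) \<circ> (\<lambda>p. (fst p, c * snd p)) = (\<lambda>(x, v). qv x v)"
    using c_pos by (auto simp: fun_eq_iff)
  ultimately have "continuous_map (top_of_set (X \<times> UNIV)) Z (\<lambda>(x, v). qv x v)" by simp
  then have "openin (top_of_set (X \<times> UNIV)) {p \<in> topspace (top_of_set (X \<times> UNIV)). (\<lambda>(x, v). qv x v) p \<in> U}"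
    using U by (rule openin_continuous_map_preimage)
  then obtain W where W: "open W" "{p \<in> X \<times> UNIV. (\<lambda>(x, v). qv x v) p \<in> U} = (X \<times> UNIV) \<inter> W"
    by (auto simp: openin_open)
  have cX: "closed (X \<times> (UNIV :: real set))" by (intro closed_Times closed_X) auto
  \<comment> \<open>Continuity is available over the closed set \<open>X\<close> only; over its
    complement the map is constantly \<Delta>.\<close>
  have "(\<lambda>(x, v). qv x v) -` U \<inter> space borel
      = ((X \<times> UNIV) \<inter> W) \<union> (if None \<in> U then - (X \<times> UNIV) else {})"
  proof -
    have "qv x v = None" if "x \<notin> X" for x v using that by (intro qv_None) (simp add: punctured_def)
    then have "a \<in> X" if "None \<notin> U" "qv a b \<in> U" for a b using that by metis
    with \<open>\<And>x v. x \<notin> X \<Longrightarrow> qv x v = None\<close> show ?thesis unfolding W(2)[symmetric] by (auto split: if_splits)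
  qed
  moreover have "\<dots> \<in> sets borel"
  proof (rule sets.Un)
    show "(X \<times> (UNIV :: real set)) \<inter> W \<in> sets borel" by (rule sets.Int[OF borel_closed[OF cX] borel_open[OF W(1)]])
    have "- (X \<times> (UNIV :: real set)) \<in> sets borel" by (rule borel_open[OF open_Compl[OF cX]])
    then show "(if None \<in> U then - (X \<times> (UNIV :: real set)) else {}) \<in> sets borel" by (cases "None \<in> U") (simp_all only: if_True if_False sets.empty_sets)
  qed
  ultimately show "(\<lambda>(x, v). qv x v) -` U \<inter> space borel \<in> sets borel" by simp
qed

lemma continuous_map_flow: "continuous_map Z Z (flow t)"
proof -
  have "continuous_map (prod_topology Z euclideanreal) Z (\<lambda>(z, t). flow t z)"
    using is_flow_flow by (simp add: is_flow_def)
  moreover have "continuous_map Z (prod_topology Z euclideanreal) (\<lambda>z. (z, t))"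
    by (simp add: continuous_map_pairedI)
  ultimately have "continuous_map Z Z ((\<lambda>(z, t). flow t z) \<circ> (\<lambda>z. (z, t)))"
    using continuous_map_compose by blast
  then show ?thesis by (simp add: comp_def)
qed

lemma measurable_flow [measurable]: "flow t \<in> borel_of Z \<rightarrow>\<^sub>M borel_of Z"
proof (subst (2) borel_of_def, rule measurable_measure_of)
  show "{U. openin Z U} \<subseteq> Pow (topspace Z)" using openin_subset by auto
  show "flow t \<in> space (borel_of Z) \<rightarrow> topspace Z"
    using continuous_map_flow[of t] unfolding space_borel_of continuous_map_def by blast
  fix U assume "U \<in> {U. openin Z U}"
  then have "openin Z {z \<in> topspace Z. flow t z \<in> U}"
    using openin_continuous_map_preimage[OF continuous_map_flow] by blast
  moreover have "{z \<in> topspace Z. flow t z \<in> U} = flow t -` U \<inter> space (borel_of Z)" by (auto simp: space_borel_of)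
  ultimately show "flow t -` U \<inter> space (borel_of Z) \<in> sets (borel_of Z)" using borel_of_open by simp
qed

text \<open>One turn of the suspension over a clopen set splits into the open part at heights
  strictly between 0 and c and the closed slice at height 0. These sets form the coding partition
  for the lower entropy bound.\<close>

lemma qv_clopen_borel:
  assumes C: "open C" "closed C"
  shows "(\<lambda>(x, v). qv x v) ` ((Y \<inter> C) \<times> {0..<1}) \<in> sets (borel_of Z)"
proof -
  have Some_open: "Some ` U \<in> sets (borel_of Z)" if "openin SY U" for U
    using that by (intro borel_of_open) (simp add: susp_compactification_def)
  have Some_closed: "Some ` W \<in> sets (borel_of Z)" if W: "closedin SY W" for W
  proof -
    have "openin SY (topspace SY - W)" using W by blast
    then have "Some ` topspace SY - Some ` (topspace SY - W) \<in> sets (borel_of Z)"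
      by (intro sets.Diff Some_open) simp_all
    moreover have "Some ` topspace SY - Some ` (topspace SY - W) = Some ` W"
      using closedin_subset[OF W] by blast
    ultimately show ?thesis by (simp only:)
  qed
  let ?W1 = "cls ` ((Y \<inter> C) \<times> {0<..<c})" and ?W2 = "cls ` ((Y \<inter> C) \<times> {0})"
  have "{p \<in> B. cls p \<in> ?W1} = B \<inter> (C \<times> {0<..<c})"
  proof (intro set_eqI iffI)
    fix p assume "p \<in> {p \<in> B. cls p \<in> ?W1}"
    then obtain q where q: "p \<in> B" "q \<in> (Y \<inter> C) \<times> {0<..<c}" "cls p = cls q" by auto
    then have "q \<in> B" by (auto simp: susp_region_def)
    then have "nf p = nf q" using q by (simp add: cls_eq_iff)
    then show "p \<in> B \<inter> (C \<times> {0<..<c})" using q by (cases p; cases q) (auto simp: nf_def split: if_splits)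
  next
    fix p assume "p \<in> B \<inter> (C \<times> {0<..<c})"
    then show "p \<in> {p \<in> B. cls p \<in> ?W1}" by (auto simp: susp_region_def)
  qed
  moreover have "open (C \<times> {0<..<c})" using C by (intro open_Times) auto
  ultimately have "openin (top_of_set B) {p \<in> B. cls p \<in> ?W1}" by (simp only: openin_open_Int)
  moreover have "?W1 \<subseteq> cls ` B" by (intro image_mono) (auto simp: susp_region_def)
  ultimately have W1: "openin SY ?W1" by (simp only: openin_SY simp_thms)
  \<comment> \<open>The bottom slice also has preimages at the top of the preceding fibres.\<close>
  have "{p \<in> B. cls p \<in> ?W2} = B \<inter> (C \<times> {0} \<union> (shiftn 1 -` C) \<times> {c})"
  proof (intro set_eqI iffI)
    fix p assume "p \<in> {p \<in> B. cls p \<in> ?W2}"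
    then obtain q where q: "p \<in> B" "q \<in> (Y \<inter> C) \<times> {0}" "cls p = cls q" by auto
    then have "q \<in> B" using c_pos by (auto simp: susp_region_def)
    then have "nf p = nf q" using q by (simp add: cls_eq_iff)
    then show "p \<in> B \<inter> (C \<times> {0} \<union> (shiftn 1 -` C) \<times> {c})"
      using q c_pos by (cases p; cases q) (auto simp: nf_def shift_map_eq split: if_splits)
  next
    fix p assume p: "p \<in> B \<inter> (C \<times> {0} \<union> (shiftn 1 -` C) \<times> {c})"
    show "p \<in> {p \<in> B. cls p \<in> ?W2}"
    proof (cases "snd p = c")
      case True
      then have x: "fst p \<in> Y" "shiftn 1 (fst p) \<in> C" using p c_pos by (auto simp: susp_region_def)
      then have "cls p = cls (shiftn 1 (fst p), 0)"
        using p True c_pos by (subst cls_eq_iff) (auto simp: mem_B nf_def shift_map_eq)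
      moreover have "(shiftn 1 (fst p), 0) \<in> (Y \<inter> C) \<times> {0}" using x by simp
      ultimately show ?thesis using p by blast
    next
      case False
      then have "p \<in> (Y \<inter> C) \<times> {0}" using p by (auto simp: susp_region_def)
      then show ?thesis using p by blast
    qed
  qed
  moreover have "closed (C \<times> {0} \<union> (shiftn 1 -` C) \<times> {c})"
    using C by (intro closed_Un closed_Times closed_vimage continuous_on_shiftn) auto
  ultimately have "closedin (top_of_set B) {p \<in> B. cls p \<in> ?W2}" by (simp only: closedin_closed_Int)
  moreover have "?W2 \<subseteq> cls ` B" using c_pos by (intro image_mono) (auto simp: susp_region_def)
  ultimately have "closedin SY ?W2" by (simp only: closedin_SY simp_thms)
  then have S2: "Some ` ?W2 \<in> sets (borel_of Z)" by (rule Some_closed)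
  have "(\<lambda>(x, v). qv x v) ` ((Y \<inter> C) \<times> {0..<1}) = Some ` ?W1 \<union> Some ` ?W2"
  proof (intro set_eqI iffI)
    fix z assume "z \<in> (\<lambda>(x, v). qv x v) ` ((Y \<inter> C) \<times> {0..<1})"
    then obtain x v where xv: "x \<in> Y" "x \<in> C" "0 \<le> v" "v < 1" "z = qv x v" by auto
    have "z = Some (cls (x, c * v))"
      using qv_cls[of x "c * v"] xv c_pos by simp
    then show "z \<in> Some ` ?W1 \<union> Some ` ?W2" using xv c_pos by (cases "v = 0") auto
  next
    fix z assume z: "z \<in> Some ` ?W1 \<union> Some ` ?W2"
    obtain p where p: "p \<in> (Y \<inter> C) \<times> {0..<c}" "z = Some (cls p)"
    proof -
      have "((Y \<inter> C) \<times> {0<..<c}) \<union> ((Y \<inter> C) \<times> {0}) \<subseteq> (Y \<inter> C) \<times> {0..<c}" using c_pos by auto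
      then have "Some ` cls ` (((Y \<inter> C) \<times> {0<..<c}) \<union> ((Y \<inter> C) \<times> {0})) \<subseteq> Some ` cls ` ((Y \<inter> C) \<times> {0..<c})"
        by (intro image_mono)
      then have "z \<in> Some ` cls ` ((Y \<inter> C) \<times> {0..<c})" using z unfolding image_Un[symmetric] by (rule subsetD)
      then show ?thesis using that by (elim imageE) simp
    qed
    obtain x u where "p = (x, u)" by force
    with p have xu: "x \<in> Y" "x \<in> C" "0 \<le> u" "u < c" "z = Some (cls (x, u))" by auto
    then have "z = qv x (u / c)" by (simp add: qv_cls)
    then show "z \<in> (\<lambda>(x, v). qv x v) ` ((Y \<inter> C) \<times> {0..<1})"
      using xu c_pos by (intro image_eqI[of _ _ "(x, u / c)"]) auto
  qed
  then show ?thesis using sets.Un[OF Some_open[OF W1] S2] by (simp only:)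
qed

end

section \<open>The measure on the suspension\<close>

lemma pair_sets_config_real [simp]: "sets ((borel :: config measure) \<Otimes>\<^sub>M (borel :: real measure)) = sets borel"
  unfolding borel_prod by (rule refl)

text \<open>Cut \<open>{s..<s + 1}\<close> at an integer \<open>m\<close> and move the left piece by
  one period; the result is a full period starting at \<open>m\<close>.\<close>

lemma nn_integral_periodic:
  fixes g :: "real \<Rightarrow> ennreal"
  assumes [measurable]: "g \<in> borel_measurable borel" and per: "\<And>v. g (v + 1) = g v"
  shows "(\<integral>\<^sup>+v. g (v + s) * indicator {0..<1} v \<partial>lborel) = (\<integral>\<^sup>+v. g v * indicator {0..<1} v \<partial>lborel)"
proof -
  have pnat: "g (v + real n) = g v" for v n
  proof (induction n)
    case (Suc n)
    have "g (v + real (Suc n)) = g ((v + real n) + 1)" by (simp add: algebra_simps)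
    then show ?case using per Suc by simp
  qed simp
  have per': "g (v + of_int k) = g v" for v k
  proof (cases "0 \<le> k")
    case True
    then show ?thesis using pnat[of v "nat k"] by simp
  next
    case False
    then show ?thesis using pnat[of "v + of_int k" "nat (-k)"] by simp
  qed
  have trans: "(\<integral>\<^sup>+v. f v \<partial>lborel) = (\<integral>\<^sup>+v. f (t + v) \<partial>lborel)"
    if "f \<in> borel_measurable borel" for f :: "real \<Rightarrow> ennreal" and t
    using nn_integral_real_affine[of f 1 t] that by simp
  have shift: "(\<integral>\<^sup>+v. g v * indicator {a..<b} v \<partial>lborel)
      = (\<integral>\<^sup>+v. g v * indicator {a + of_int k..<b + of_int k} v \<partial>lborel)" for a b k
  proof -
    have "(\<integral>\<^sup>+v. g v * indicator {a + of_int k..<b + of_int k} v \<partial>lborel)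
        = (\<integral>\<^sup>+v. g (of_int k + v) * indicator {a + of_int k..<b + of_int k} (of_int k + v) \<partial>lborel)"
      by (rule trans) simp
    also have "\<dots> = (\<integral>\<^sup>+v. g v * indicator {a..<b} v \<partial>lborel)"
      using per' by (intro nn_integral_cong) (auto simp: indicator_def add.commute)
    finally show ?thesis by simp
  qed
  have split: "(\<integral>\<^sup>+v. g v * indicator {a..<d} v \<partial>lborel)
      = (\<integral>\<^sup>+v. g v * indicator {a..<b} v \<partial>lborel) + (\<integral>\<^sup>+v. g v * indicator {b..<d} v \<partial>lborel)"
    if "a \<le> b" "b \<le> d" for a b d
    using that by (subst nn_integral_add[symmetric]) (auto intro!: nn_integral_cong simp: indicator_def)
  define m where "m = \<lceil>s\<rceil>"
  have m: "s \<le> of_int m" "of_int m \<le> s + 1" unfolding m_def by linarith+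
  have "(\<integral>\<^sup>+v. g (v + s) * indicator {0..<1} v \<partial>lborel) = (\<integral>\<^sup>+v. g v * indicator {s..<s + 1} v \<partial>lborel)"
    by (subst trans[of "\<lambda>v. g v * indicator {s..<s + 1} v" s])
       (auto intro!: nn_integral_cong simp: indicator_def add.commute)
  also have "\<dots> = (\<integral>\<^sup>+v. g v * indicator {s..<of_int m} v \<partial>lborel) + (\<integral>\<^sup>+v. g v * indicator {of_int m..<s + 1} v \<partial>lborel)"
    using m by (rule split)
  also have "(\<integral>\<^sup>+v. g v * indicator {s..<of_int m} v \<partial>lborel) = (\<integral>\<^sup>+v. g v * indicator {s + 1..<of_int m + 1} v \<partial>lborel)"
    using shift[of s "of_int m" 1] by simp
  also have "\<dots> + (\<integral>\<^sup>+v. g v * indicator {of_int m..<s + 1} v \<partial>lborel) = (\<integral>\<^sup>+v. g v * indicator {of_int m..<of_int m + 1} v \<partial>lborel)"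
    by (subst (3) split[of _ "s + 1"]) (use m in \<open>auto simp: add.commute\<close>)
  also have "\<dots> = (\<integral>\<^sup>+v. g v * indicator {0..<1} v \<partial>lborel)"
    using shift[of 0 1 m] by (simp add: add.commute)
  finally show ?thesis .
qed

definition unif01 :: "real measure" where
  "unif01 = uniform_measure lborel {0..<1}"

lemma sets_unif01 [simp, measurable_cong]: "sets unif01 = sets borel"
  by (simp add: unif01_def)

lemma space_unif01 [simp]: "space unif01 = UNIV"
  by (simp add: unif01_def)

lemma prob_space_unif01: "prob_space unif01"
  unfolding unif01_def by (rule prob_space_uniform_measure) auto

lemma nn_integral_unif01:
  "f \<in> borel_measurable borel \<Longrightarrow> (\<integral>\<^sup>+v. f v \<partial>unif01) = (\<integral>\<^sup>+v. f v * indicator {0..<1} v \<partial>lborel)"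
  unfolding unif01_def by (subst nn_integral_uniform_measure) (auto simp: divide_ennreal_def)

text \<open>Moves coordinates into the fundamental domain \<open>{0..<1}\<close> of heights without
  changing the point \<open>qv\<close> assigns to them.\<close>

definition base :: "config \<times> real \<Rightarrow> config \<times> real" where
  "base p = (shiftn \<lfloor>snd p\<rfloor> (fst p), frac (snd p))"

lemma base_id: "0 \<le> snd p \<Longrightarrow> snd p < 1 \<Longrightarrow> base p = p"
proof -
  assume "0 \<le> snd p" "snd p < 1"
  then have "\<lfloor>snd p\<rfloor> = 0" by (simp add: floor_eq_iff)
  then show ?thesis by (simp add: base_def frac_def)
qed

lemma measurable_base [measurable]: "base \<in> borel_measurable borel"
proof -
  have "(\<lambda>p. shiftn (\<lfloor>snd p\<rfloor>) (fst p)) \<in> borel_measurable (borel :: (config \<times> real) measure)"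
  proof (rule measurable_compose_countable)
    show "(\<lambda>p. shiftn i (fst p)) \<in> borel_measurable (borel :: (config \<times> real) measure)" for i
      by (intro measurable_compose[OF _ measurable_shiftn] borel_measurable_continuous_onI continuous_on_fst continuous_on_id)
    have "(\<lambda>p. snd p) \<in> borel_measurable (borel :: (config \<times> real) measure)"
      by (intro borel_measurable_continuous_onI continuous_on_snd continuous_on_id)
    then show "(\<lambda>p. \<lfloor>snd p\<rfloor>) \<in> measurable (borel :: (config \<times> real) measure) (count_space UNIV)" by measurable
  qed
  moreover have "(\<lambda>p. frac (snd p)) \<in> borel_measurable (borel :: (config \<times> real) measure)"
  proof -
    have "(\<lambda>p. snd p) \<in> borel_measurable (borel :: (config \<times> real) measure)"
      by (intro borel_measurable_continuous_onI continuous_on_snd continuous_on_id)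
    then show ?thesis unfolding frac_def by measurable
  qed
  ultimately have "(\<lambda>p. (shiftn \<lfloor>snd p\<rfloor> (fst p), frac (snd p))) \<in> measurable borel ((borel :: config measure) \<Otimes>\<^sub>M (borel :: real measure))"
    by (rule measurable_Pair)
  then show ?thesis unfolding base_def[abs_def] using measurable_cong_sets[OF refl pair_sets_config_real] by blast
qed

definition wrd :: "nat \<Rightarrow> config \<Rightarrow> bool list" where
  "wrd n x = map (\<lambda>i. x (int i)) [0..<n]"

lemma wrd_eq_iff: "wrd n x = wrd n y \<longleftrightarrow> (\<forall>i. 0 \<le> i \<and> i < int n \<longrightarrow> x i = y i)"
proof -
  have "wrd n x = wrd n y \<longleftrightarrow> (\<forall>i<n. x (int i) = y (int i))" by (auto simp: wrd_def)
  also have "\<dots> \<longleftrightarrow> (\<forall>i. 0 \<le> i \<and> i < int n \<longrightarrow> x i = y i)"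
    by (metis nat_less_iff nat_0_le of_nat_0_le_iff of_nat_less_iff zless_nat_eq_int_zless)
  finally show ?thesis .
qed

lemma finite_range_wrd: "finite (range (wrd n))"
proof (rule finite_subset)
  show "range (wrd n) \<subseteq> {xs. set xs \<subseteq> UNIV \<and> length xs = n}" by (auto simp: wrd_def)
qed (rule finite_lists_length_eq, simp)

lemma borel_wrd [measurable]: "{x. wrd n x = w} \<in> sets borel"
proof -
  have "{x. wrd n x = w} \<in> determined win"
    unfolding determined_def using win_eq_iff wrd_eq_iff
    by (intro CollectI exI[of _ n]) auto
  then show ?thesis unfolding borel_config by (rule sigma_sets.Basic)
qed

text \<open>\<open>h\<close> enters as the growth rate of the entropy of words, the form used in
  both entropy bounds; \<open>mu_Y\<close> keeps mass away from \<Delta>.\<close>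

locale suspension_measure = const_suspension + mu: prob_space \<mu> for \<mu> :: "config measure" +
  fixes h :: real
  assumes sets_mu [simp, measurable_cong]: "sets \<mu> = sets borel"
    and inv_mu: "A \<in> sets borel \<Longrightarrow> emeasure \<mu> (shift_map -` A) = emeasure \<mu> A"
    and erg_mu: "A \<in> sets borel \<Longrightarrow> shift_map -` A = A \<Longrightarrow> measure \<mu> A = 0 \<or> measure \<mu> A = 1"
    and mu_Y: "AE x in \<mu>. x \<in> punctured X"
    and ent_wrd: "(\<lambda>n. ent \<mu> (wrd n) / real n) \<longlonglongrightarrow> h"
begin

lemma space_mu [simp]: "space \<mu> = UNIV"
  using sets_eq_imp_space_eq[OF sets_mu] by simp

abbreviation N :: "(config \<times> real) measure" where "N \<equiv> \<mu> \<Otimes>\<^sub>M unif01"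

sublocale U: prob_space unif01 by (rule prob_space_unif01)
sublocale P: pair_prob_space \<mu> unif01 ..

lemma sets_N [simp, measurable_cong]: "sets N = sets borel"
proof -
  have "sets N = sets ((borel :: config measure) \<Otimes>\<^sub>M (borel :: real measure))" by (rule sets_pair_measure_cong) simp_all
  then show ?thesis unfolding pair_sets_config_real .
qed

lemma space_N [simp]: "space N = UNIV"
  by (simp add: space_pair_measure)

lemma inv_shiftn: "A \<in> sets borel \<Longrightarrow> emeasure \<mu> (shiftn k -` A) = emeasure \<mu> A"
proof -
  have meas: "shiftn k -` A \<in> sets borel" if "A \<in> sets borel" for k A
    using measurable_sets[OF measurable_shiftn that, of k] by simp
  have nat: "emeasure \<mu> (shiftn (int n) -` A) = emeasure \<mu> A" if "A \<in> sets borel" for n A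
    using that
  proof (induction n arbitrary: A)
    case (Suc n)
    have "shiftn (int (Suc n)) -` A = shiftn (int n) -` (shift_map -` A)"
      by (auto simp: shift_map_eq)
    then show ?case using Suc meas[of A 1] inv_mu by (simp add: shift_map_eq)
  next
    case 0
    have "shiftn (int 0) -` A = A" by auto
    then show ?case by simp
  qed
  assume A: "A \<in> sets borel"
  show ?thesis
  proof (cases "0 \<le> k")
    case True
    then show ?thesis using nat[OF A, of "nat k"] by simp
  next
    case False
    have "shiftn (- k) -` (shiftn k -` A) = A" by auto
    then show ?thesis using False nat[OF meas[OF A], of "nat (- k)" k] by simp
  qed
qed

lemma section_borel: "G \<in> sets (borel :: (config \<times> real) measure) \<Longrightarrow> (\<lambda>x. (x, v)) -` G \<in> sets borel"
proof -
  assume "G \<in> sets borel"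
  then have "G \<in> sets N" by (simp only: sets_N)
  then have "(\<lambda>x. (x, v)) -` G \<in> sets \<mu>" by (rule sets_Pair2)
  then show ?thesis by (simp only: sets_mu)
qed

lemma emeasure_N: "G \<in> sets borel \<Longrightarrow> emeasure N G = (\<integral>\<^sup>+v. emeasure \<mu> ((\<lambda>x. (x, v)) -` G) * indicator {0..<1} v \<partial>lborel)"
proof -
  assume G: "G \<in> sets borel"
  then have "emeasure N G = (\<integral>\<^sup>+v. emeasure \<mu> ((\<lambda>x. (x, v)) -` G) \<partial>unif01)"
    by (intro P.emeasure_pair_measure_alt2) (simp only: sets_N)
  also have "\<dots> = (\<integral>\<^sup>+v. emeasure \<mu> ((\<lambda>x. (x, v)) -` G) * indicator {0..<1} v \<partial>lborel)"
  proof (rule nn_integral_unif01)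
    have "(\<lambda>v. emeasure \<mu> ((\<lambda>x. (x, v)) -` G)) \<in> borel_measurable unif01"
      using G by (intro P.measurable_emeasure_Pair2) (simp only: sets_N)
    then show "(\<lambda>v. emeasure \<mu> ((\<lambda>x. (x, v)) -` G)) \<in> borel_measurable borel"
      using measurable_cong_sets[OF sets_unif01 refl] by blast
  qed
  finally show ?thesis .
qed

lemma measurable_translate [measurable]: "(\<lambda>p. (fst p, snd p + s)) \<in> measurable borel (borel :: (config \<times> real) measure)"
  by (intro borel_measurable_continuous_onI continuous_on_Pair continuous_on_add continuous_on_fst continuous_on_snd
      continuous_on_id continuous_on_const)

text \<open>Fubini: the fibre measure \<open>v \<mapsto> \<mu> {x. (x, v) \<in> G}\<close> is periodic, by invariance of \<open>\<mu>\<close>.\<close>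

lemma N_translate:
  assumes G: "G \<in> sets borel" and eq: "\<And>x v. (x, v + 1) \<in> G \<longleftrightarrow> (shift_map x, v) \<in> G"
  shows "emeasure N {p. (fst p, snd p + s) \<in> G} = emeasure N G"
proof -
  let ?g = "\<lambda>v. emeasure \<mu> ((\<lambda>x. (x, v)) -` G)"
  have gm: "?g \<in> borel_measurable borel"
  proof -
    have "?g \<in> borel_measurable unif01"
      using G by (intro P.measurable_emeasure_Pair2) (simp only: sets_N)
    then show ?thesis using measurable_cong_sets[OF sets_unif01 refl] by blast
  qed
  have per: "?g (v + 1) = ?g v" for v
  proof -
    have "(\<lambda>x. (x, v + 1)) -` G = shift_map -` ((\<lambda>x. (x, v)) -` G)" using eq by auto
    then show ?thesis using inv_mu[OF section_borel[OF G]] by simp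
  qed
  have "{p. (fst p, snd p + s) \<in> G} \<in> sets borel"
    using measurable_sets[OF measurable_translate G, of s] by (simp add: vimage_def)
  then have "emeasure N {p. (fst p, snd p + s) \<in> G} = (\<integral>\<^sup>+v. ?g (v + s) * indicator {0..<1} v \<partial>lborel)"
    by (subst emeasure_N) (simp_all add: vimage_def)
  also have "\<dots> = emeasure N G" using G by (simp add: nn_integral_periodic[OF gm per] emeasure_N)
  finally show ?thesis .
qed

lemma emeasure_fst: "A \<in> sets borel \<Longrightarrow> emeasure N {p. fst p \<in> A} = emeasure \<mu> A"
proof -
  assume A: "A \<in> sets borel"
  have "{p. fst p \<in> A} = A \<times> space unif01" by auto
  then show ?thesis using A by (simp add: U.emeasure_pair_measure_Times U.emeasure_space_1[simplified])
qed

lemma AE_N_snd: "AE p in N. 0 \<le> snd p \<and> snd p < 1"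
proof -
  have "{p. 0 \<le> snd p \<and> snd p < 1} = UNIV \<times> {0..<1::real}" by auto
  moreover have "AE p in N. p \<in> UNIV \<times> {0..<1}"
  proof (rule P.AE_prob_1)
    have "emeasure N (UNIV \<times> {0..<1}) = emeasure \<mu> UNIV * emeasure unif01 {0..<1}"
      by (intro U.emeasure_pair_measure_Times) auto
    also have "emeasure \<mu> UNIV = 1" using mu.emeasure_space_1 by simp
    also have "emeasure unif01 {0..<1} = 1"
      unfolding unif01_def by (subst emeasure_uniform_measure) (auto simp: divide_ennreal_def)
    finally show "P.prob (UNIV \<times> {0..<1}) = 1" by (simp add: measure_def)
  qed
  ultimately show ?thesis by (auto elim: eventually_mono)
qed

lemma AE_N_base: "AE p in N. base p = p"
  using AE_N_snd by eventually_elim (simp add: base_id)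

lemma AE_N_Y: "AE p in N. fst p \<in> Y"
proof -
  obtain S where S: "{x \<in> space \<mu>. x \<notin> Y} \<subseteq> S" "emeasure \<mu> S = 0" "S \<in> sets \<mu>"
    using mu_Y by (auto elim: AE_E)
  have "emeasure N {p. fst p \<in> S} = 0" using S emeasure_fst[of S] by simp
  moreover have "{p. fst p \<in> S} \<in> sets N"
  proof -
    have "{p. fst p \<in> S} = S \<times> space unif01" by auto
    then show ?thesis using S(3) by (metis pair_measureI sets.top)
  qed
  ultimately have "{p. fst p \<in> S} \<in> null_sets N" by (rule null_setsI)
  moreover have "{p \<in> space N. \<not> fst p \<in> Y} \<subseteq> {p. fst p \<in> S}" using S(1) by auto
  ultimately show ?thesis by (rule AE_I')
qed

abbreviation q :: "config \<times> real \<Rightarrow> (config \<times> real) set option" where "q p \<equiv> qv (fst p) (snd p)"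

lemma measurable_q [measurable]: "q \<in> measurable borel (borel_of Z)"
  using measurable_qv by (simp add: split_beta')

definition \<nu> :: "(config \<times> real) set option measure" where
  "\<nu> = distr N (borel_of Z) q"

lemma sets_nu [simp]: "sets \<nu> = sets (borel_of Z)"
  by (simp add: \<nu>_def)

lemma space_nu [simp]: "space \<nu> = topspace Z"
  by (simp add: \<nu>_def space_borel_of)

lemma measurable_q_N: "q \<in> measurable N (borel_of Z)"
  using measurable_q measurable_cong_sets[OF sets_N refl] by blast

lemma prob_space_nu: "prob_space \<nu>"
  unfolding \<nu>_def by (rule P.prob_space_distr[OF measurable_q_N])

lemma borel_q: "A \<in> sets (borel_of Z) \<Longrightarrow> {p. q p \<in> A} \<in> sets borel"
  using measurable_sets[OF measurable_q, of A] by (simp add: vimage_def)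

lemma emeasure_nu: "A \<in> sets (borel_of Z) \<Longrightarrow> emeasure \<nu> A = emeasure N {p. q p \<in> A}"
  unfolding \<nu>_def by (subst emeasure_distr[OF measurable_q_N]) (auto simp: vimage_def)

lemma qv_step: "qv x (v + 1) = qv (shift_map x) v"
  using qv_shift[of 1 x v] by (simp add: shift_map_eq)

text \<open>Invariance is translation invariance of \<open>N\<close> on equivariant sets. For
  ergodicity, membership of \<open>qv x v\<close> in a flow-invariant set does not depend on
  \<open>v\<close>, so the set comes from a shift-invariant set of base points and ergodicity of
  \<mu> applies.\<close>

lemma nu_ergodic: "\<nu> \<in> ergodic_measures Z flow"
  unfolding ergodic_measures_def
proof (intro CollectI conjI ballI allI impI)
  show "sets \<nu> = sets (borel_of Z)" by simp
  show "prob_space \<nu>" by (rule prob_space_nu)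
next
  fix t A assume A: "A \<in> sets \<nu>"
  have m: "flow t -` A \<inter> space \<nu> \<in> sets (borel_of Z)"
    using measurable_sets[OF measurable_flow, of A t] A by (simp add: space_borel_of)
  have "emeasure \<nu> (flow t -` A \<inter> space \<nu>) = emeasure N {p. (fst p, snd p + t / c) \<in> {p. q p \<in> A}}"
    using emeasure_nu[OF m] qv_topspace by (simp add: flow_qv)
  also have "\<dots> = emeasure N {p. q p \<in> A}"
    using A by (intro N_translate borel_q) (auto simp: qv_step)
  also have "\<dots> = emeasure \<nu> A" using A by (simp add: emeasure_nu)
  finally show "emeasure \<nu> (flow t -` A \<inter> space \<nu>) = emeasure \<nu> A" .
next
  fix A assume A: "A \<in> sets \<nu>" and inv: "\<forall>t. flow t -` A \<inter> space \<nu> = A"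
  have qA: "qv x v \<in> A \<longleftrightarrow> qv x 0 \<in> A" for x v
  proof -
    have "flow (c * v) (qv x 0) = qv x v" using c_pos by (simp add: flow_qv)
    moreover have "qv x 0 \<in> A \<longleftrightarrow> qv x 0 \<in> flow (c * v) -` A \<inter> space \<nu>" using inv by simp
    ultimately show ?thesis using qv_topspace by simp
  qed
  define A0 where "A0 = {x. qv x 0 \<in> A}"
  have A0: "A0 \<in> sets borel"
    using section_borel[OF borel_q, of A 0] A unfolding A0_def by (simp add: vimage_def)
  have "shift_map -` A0 = A0" unfolding A0_def using qA qv_step by (auto simp flip: qv_step)
  then have "measure \<mu> A0 = 0 \<or> measure \<mu> A0 = 1" using erg_mu A0 by blast
  moreover have "{p. q p \<in> A} = {p. fst p \<in> A0}" unfolding A0_def using qA by blast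
  then have "emeasure \<nu> A = emeasure \<mu> A0" using A A0 by (simp add: emeasure_nu emeasure_fst)
  then have "measure \<nu> A = measure \<mu> A0" by (simp add: measure_def)
  ultimately show "measure \<nu> A = 0 \<or> measure \<nu> A = 1" by simp
qed

end

text \<open>Only the limit 0 needs work: \<open>\<bar>x * ln x\<bar>\<close> is at most
  \<open>2 * sqrt x + x\<^sup>2\<close>, where the two terms come from
  \<open>ln t \<le> t - 1\<close> at 1 / sqrt x and at x.\<close>

lemma tendsto_x_ln_x:
  fixes p :: "'b \<Rightarrow> real"
  assumes p: "(p \<longlongrightarrow> a) F" and nonneg: "\<And>m. 0 \<le> p m"
  shows "((\<lambda>m. p m * ln (p m)) \<longlongrightarrow> a * ln a) F"
proof (cases "a = 0")
  case False
  then show ?thesis using p by (intro tendsto_intros) auto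
next
  case True
  have bound: "\<bar>x * ln x\<bar> \<le> 2 * sqrt x + x\<^sup>2" if "0 \<le> x" for x :: real
  proof (cases "x = 0")
    case False
    then have x: "0 < x" using that by simp
    have "ln x \<le> x - 1" using x by (rule ln_le_minus_one)
    then have "x * ln x \<le> x * x" using x by (intro mult_left_mono) auto
    moreover have "- (2 * sqrt x) \<le> x * ln x"
    proof -
      have "ln (1 / sqrt x) \<le> 1 / sqrt x - 1" using x by (intro ln_le_minus_one) simp
      moreover have "ln (1 / sqrt x) = - (ln x / 2)" using x by (simp add: ln_div ln_sqrt)
      ultimately have "- (2 / sqrt x) \<le> ln x" by simp
      then have "x * (- (2 / sqrt x)) \<le> x * ln x" using x by (intro mult_left_mono) auto
      moreover have "x * (- (2 / sqrt x)) = - (2 * sqrt x)"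
        using x by (simp add: real_div_sqrt mult.commute[of x] flip: times_divide_eq_right)
      ultimately show ?thesis by simp
    qed
    moreover have "0 \<le> sqrt x" "0 \<le> x * x" using x by auto
    ultimately show ?thesis unfolding power2_eq_square by (intro abs_leI) linarith+
  qed simp
  have "((\<lambda>m. 2 * sqrt (p m) + (p m)\<^sup>2) \<longlongrightarrow> 2 * sqrt 0 + 0\<^sup>2) F"
    using p True by (intro tendsto_intros) auto
  then have "((\<lambda>m. 2 * sqrt (p m) + (p m)\<^sup>2) \<longlongrightarrow> 0) F" by simp
  then have "((\<lambda>m. p m * ln (p m)) \<longlongrightarrow> 0) F"
    by (rule Lim_null_comparison[rotated]) (use bound nonneg in auto)
  then show ?thesis using True by simp
qed

section \<open>Continuity of entropy under small perturbations\<close>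

context prob_space
begin

lemma ent_superset:
  assumes "finite S" "X ` space M \<subseteq> S"
  shows "ent M X = - (\<Sum>k\<in>S. pr M X k * ln (pr M X k))"
proof -
  have "(\<Sum>k\<in>X ` space M. pr M X k * ln (pr M X k)) = (\<Sum>k\<in>S. pr M X k * ln (pr M X k))"
    by (rule sum.mono_neutral_left[OF assms]) (simp add: pr_notin_range)
  then show ?thesis by (simp add: ent_def)
qed

text \<open>With values in a fixed finite set, entropy is a continuous function of finitely many
  probabilities, each of which moves by at most the probability of \<open>bad m\<close>.\<close>

lemma ent_tendsto:
  assumes W: "\<And>m. simple_function M (W m)" "simple_function M V"
    and S: "finite S" "\<And>m. W m ` space M \<subseteq> S" "V ` space M \<subseteq> S"
    and bad: "\<And>m. bad m \<in> sets M" "\<And>m \<omega>. \<omega> \<in> space M \<Longrightarrow> \<omega> \<notin> bad m \<Longrightarrow> W m \<omega> = V \<omega>"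
    and lim: "(\<lambda>m. prob (bad m)) \<longlonglongrightarrow> 0"
  shows "(\<lambda>m. ent M (W m)) \<longlonglongrightarrow> ent M V"
proof -
  have "(\<lambda>m. pr M (W m) k) \<longlonglongrightarrow> pr M V k" for k
  proof -
    have "norm (pr M (W m) k - pr M V k) \<le> prob (bad m)" for m
    proof -
      let ?A = "{\<omega> \<in> space M. W m \<omega> = k}" and ?B = "{\<omega> \<in> space M. V \<omega> = k}"
      have s: "?A \<in> sets M" "?B \<in> sets M" using W simple_function_fiber by auto
      have "prob ?A \<le> prob (?B \<union> bad m)" using s bad by (intro finite_measure_mono) auto
      also have "\<dots> \<le> prob ?B + prob (bad m)" using s bad by (intro measure_Un_le) auto
      finally have 1: "prob ?A \<le> prob ?B + prob (bad m)" .
      have "prob ?B \<le> prob (?A \<union> bad m)" using s bad by (intro finite_measure_mono) auto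
      also have "\<dots> \<le> prob ?A + prob (bad m)" using s bad by (intro measure_Un_le) auto
      finally show ?thesis using 1 by (simp add: pr_def abs_le_iff)
    qed
    then have "(\<lambda>m. pr M (W m) k - pr M V k) \<longlonglongrightarrow> 0"
      by (intro Lim_null_comparison[OF _ lim]) auto
    then show ?thesis by (simp add: LIM_zero_iff)
  qed
  then have "(\<lambda>m. - (\<Sum>k\<in>S. pr M (W m) k * ln (pr M (W m) k))) \<longlonglongrightarrow> - (\<Sum>k\<in>S. pr M V k * ln (pr M V k))"
    by (intro tendsto_minus tendsto_sum tendsto_x_ln_x) auto
  then show ?thesis using ent_superset[OF S(1,2)] ent_superset[OF S(1,3)] by simp
qed

text \<open>Says that \<open>F\<close> has conditional entropy at most \<open>e\<close> given a
  variable built from sets of the generating algebra. The approximations \<open>B r\<close> of the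
  fibres may overlap or leave gaps, so that variable records the set of all \<open>r\<close> with
  \<omega> in \<open>B r\<close>; off a small set it equals \<open>{F \<omega>}\<close>, which
  determines \<open>F\<close>.\<close>

lemma ent_approx:
  assumes F: "simple_function M F" and alg: "algebra (space M) G" and gen: "sets M = sigma_sets (space M) G"
    and e: "0 < e"
  shows "\<exists>B. (\<forall>r\<in>F ` space M. B r \<in> G) \<and>
    ent M (\<lambda>\<omega>. (F \<omega>, {r \<in> F ` space M. \<omega> \<in> B r})) \<le> ent M (\<lambda>\<omega>. {r \<in> F ` space M. \<omega> \<in> B r}) + e"
proof -
  define R where "R = F ` space M"
  have fin: "finite R" unfolding R_def using simple_functionD(1)[OF F] .
  have FR: "F \<omega> \<in> R" if "\<omega> \<in> space M" for \<omega> unfolding R_def using that by (rule imageI)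
  let ?A = "\<lambda>r. {\<omega> \<in> space M. F \<omega> = r}"
  have As: "?A r \<in> sets M" for r using simple_function_fiber[OF F] .
  have ex: "\<exists>B. B \<in> G \<and> prob ((?A r - B) \<union> (B - ?A r)) < 1 / real (Suc m)" for r m
    using approx_by_algebra[OF finite_measure_axioms alg gen As, of "1 / real (Suc m)" r] by auto
  define B where "B m r = (SOME B. B \<in> G \<and> prob ((?A r - B) \<union> (B - ?A r)) < 1 / real (Suc m))" for m r
  have B: "B m r \<in> G" "prob ((?A r - B m r) \<union> (B m r - ?A r)) < 1 / real (Suc m)" for m r
    using someI_ex[OF ex, of r m] unfolding B_def by blast+
  have Bs: "B m r \<in> sets M" for m r unfolding gen using B(1) by (rule sigma_sets.Basic)
  define T where "T m \<omega> = {r \<in> R. \<omega> \<in> B m r}" for m \<omega>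
  define bad where "bad m = (\<Union>r\<in>R. (?A r - B m r) \<union> (B m r - ?A r))" for m
  have bads: "bad m \<in> sets M" for m unfolding bad_def by (intro sets.finite_UN sets.Un sets.Diff As Bs fin)
  have good: "T m \<omega> = {F \<omega>}" if "\<omega> \<in> space M" "\<omega> \<notin> bad m" for m \<omega>
    using that FR unfolding T_def bad_def by auto
  have lim: "(\<lambda>m. prob (bad m)) \<longlonglongrightarrow> 0"
  proof (rule Lim_null_comparison)
    have "prob (bad m) \<le> real (card R) * (1 / real (Suc m))" for m
    proof -
      have "prob (bad m) \<le> (\<Sum>r\<in>R. prob ((?A r - B m r) \<union> (B m r - ?A r)))"
        unfolding bad_def
          by (intro finite_measure_subadditive_finite fin image_subsetI sets.Un sets.Diff As Bs)
      also have "\<dots> \<le> (\<Sum>r\<in>R. 1 / real (Suc m))" using B(2) by (intro sum_mono less_imp_le)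
      finally show ?thesis by simp
    qed
    then show "\<forall>\<^sub>F m in sequentially. norm (prob (bad m)) \<le> real (card R) * (1 / real (Suc m))" by simp
    have "(\<lambda>m. real (card R) * (1 / real (Suc m))) \<longlonglongrightarrow> real (card R) * 0"
      by (intro tendsto_intros LIMSEQ_Suc[OF lim_1_over_n])
    then show "(\<lambda>m. real (card R) * (1 / real (Suc m))) \<longlonglongrightarrow> 0" by simp
  qed
  have sT: "simple_function M (T m)" for m
  proof -
    have "T m ` space M \<subseteq> Pow R" unfolding T_def by blast
    then have ft: "finite (T m ` space M)" by (rule finite_subset) (simp add: fin)
    moreover have "T m -` {t} \<inter> space M \<in> sets M" for t
    proof (cases "t \<subseteq> R")
      case True
      have "T m -` {t} \<inter> space M = space M \<inter> (\<Inter>r\<in>R. if r \<in> t then B m r \<inter> space M else space M - B m r)"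
    proof (intro set_eqI iffI)
        fix \<omega> assume "\<omega> \<in> T m -` {t} \<inter> space M"
        then have "T m \<omega> = t" "\<omega> \<in> space M" by auto
        then show "\<omega> \<in> space M \<inter> (\<Inter>r\<in>R. if r \<in> t then B m r \<inter> space M else space M - B m r)"
          unfolding T_def by auto
      next
        fix \<omega> assume \<omega>: "\<omega> \<in> space M \<inter> (\<Inter>r\<in>R. if r \<in> t then B m r \<inter> space M else space M - B m r)"
        have "r \<in> t \<longleftrightarrow> \<omega> \<in> B m r" if "r \<in> R" for r
          using that \<omega> by (cases "r \<in> t") auto
        then have "T m \<omega> = t" using True unfolding T_def by blast
        then show "\<omega> \<in> T m -` {t} \<inter> space M" using \<omega> by simp
      qed
      also have "\<dots> \<in> sets M"
      proof (cases "R = {}")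
        case False
        have "(if r \<in> t then B m r \<inter> space M else space M - B m r) \<in> sets M" for r
          using Bs[of m r] by auto
        then show ?thesis using False fin by (intro sets.Int sets.top sets.finite_INT)
      qed simp
      finally show ?thesis .
    next
      case False
      then have "T m -` {t} \<inter> space M = {}" by (auto simp: T_def)
      then show ?thesis by (simp only: sets.empty_sets)
    qed
    ultimately show ?thesis by (simp add: simple_function_def)
  qed
  have s1: "simple_function M (\<lambda>\<omega>. {F \<omega>})" by (rule simple_function_comp2[OF F, of "\<lambda>k. {k}"])
  have TR: "T m \<omega> \<in> Pow R" for m \<omega> unfolding T_def by blast
  have l1: "(\<lambda>m. ent M (T m)) \<longlonglongrightarrow> ent M (\<lambda>\<omega>. {F \<omega>})"
  proof (rule ent_tendsto[where S = "Pow R" and bad = bad])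
    show "T m ` space M \<subseteq> Pow R" for m using TR by (rule image_subsetI)
    show "(\<lambda>\<omega>. {F \<omega>}) ` space M \<subseteq> Pow R" using FR by blast
  qed (simp_all add: sT s1 fin bads good lim)
  have l2: "(\<lambda>m. ent M (\<lambda>\<omega>. (F \<omega>, T m \<omega>))) \<longlonglongrightarrow> ent M (\<lambda>\<omega>. (F \<omega>, {F \<omega>}))"
  proof (rule ent_tendsto[where S = "R \<times> Pow R" and bad = bad])
    show "(\<lambda>\<omega>. (F \<omega>, T m \<omega>)) ` space M \<subseteq> R \<times> Pow R" for m using TR FR by (intro image_subsetI SigmaI)
    show "(\<lambda>\<omega>. (F \<omega>, {F \<omega>})) ` space M \<subseteq> R \<times> Pow R" using FR by blast
  qed (simp_all add: sT s1 fin bads good lim F simple_function_Pair)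
  have e1: "ent M (\<lambda>\<omega>. (F \<omega>, {F \<omega>})) = ent M (\<lambda>\<omega>. {F \<omega>})"
    by (rule ent_eq[OF s1 simple_function_Pair[OF F s1]]) auto
  have "(\<lambda>m. ent M (\<lambda>\<omega>. (F \<omega>, T m \<omega>)) - ent M (T m)) \<longlonglongrightarrow> 0"
    using tendsto_diff[OF l2 l1] unfolding e1 by simp
  then obtain m where "\<bar>ent M (\<lambda>\<omega>. (F \<omega>, T m \<omega>)) - ent M (T m)\<bar> < e"
    using LIMSEQ_D[OF _ e, of "\<lambda>m. ent M (\<lambda>\<omega>. (F \<omega>, T m \<omega>)) - ent M (T m)" 0] by auto
  then have "ent M (\<lambda>\<omega>. (F \<omega>, T m \<omega>)) \<le> ent M (T m) + e" by linarith
  then show ?thesis using B(1) unfolding T_def R_def[symmetric] by blast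
qed

end

section \<open>Names of points with respect to a partition\<close>

definition label :: "'a set set \<Rightarrow> 'a \<Rightarrow> 'a set" where
  "label P z = (THE A. A \<in> P \<and> z \<in> A)"

lemma label_eq: "partition_on S P \<Longrightarrow> A \<in> P \<Longrightarrow> z \<in> A \<Longrightarrow> label P z = A"
  unfolding label_def partition_on_def disjoint_def by (rule the_equality) blast+

lemma label_in: "partition_on S P \<Longrightarrow> z \<in> S \<Longrightarrow> label P z \<in> P \<and> z \<in> label P z"
  using label_eq[of S P] unfolding partition_on_def by (metis UnionE)

text \<open>The nonempty members of the join are exactly the fibres of the name map, one for each
  name that occurs; an empty member contributes 0.\<close>

lemma partition_entropy_iter_join:
  assumes P: "finite P" "partition_on (space M) P" and f: "\<And>z. z \<in> space M \<Longrightarrow> f z \<in> space M"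
  shows "partition_entropy M (iter_join (space M) f P n) = ent M (\<lambda>z. map (\<lambda>i. label P ((f ^^ i) z)) [0..<n])"
proof -
  let ?S = "space M"
  define nm where "nm z = map (\<lambda>i. label P ((f ^^ i) z)) [0..<n]" for z
  let ?J = "iter_join ?S f P n"
  have fi: "(f ^^ i) z \<in> ?S" if "z \<in> ?S" for i z using f that by (induction i) auto
  have nm_mem: "{z \<in> ?S. nm z = k} \<in> ?J - {{}}" if k: "k \<in> nm ` ?S" for k
  proof -
    obtain z0 where z0: "z0 \<in> ?S" "k = nm z0" using k by auto
    have kP: "k ! i \<in> P" if "i < n" for i
      using label_in[OF P(2) fi[OF z0(1)]] that z0 by (simp add: nm_def)
    have "{z \<in> ?S. nm z = k} = ?S \<inter> (\<Inter>i<n. (f ^^ i) -` (k ! i))"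
    proof (intro set_eqI iffI)
      fix z assume "z \<in> {z \<in> ?S. nm z = k}"
      then have z: "z \<in> ?S" "k = nm z" by auto
      then show "z \<in> ?S \<inter> (\<Inter>i<n. (f ^^ i) -` (k ! i))"
        using label_in[OF P(2) fi[OF z(1)]] by (auto simp: nm_def)
    next
      fix z assume z: "z \<in> ?S \<inter> (\<Inter>i<n. (f ^^ i) -` (k ! i))"
      have "nm z = k"
      proof (rule nth_equalityI)
        show "length (nm z) = length k" using z0 by (simp add: nm_def)
        fix i assume "i < length (nm z)"
        then have i: "i < n" by (simp add: nm_def)
        then have "(f ^^ i) z \<in> k ! i" using z by auto
        then show "nm z ! i = k ! i" using label_eq[OF P(2) kP[OF i]] i by (simp add: nm_def)
      qed
      then show "z \<in> {z \<in> ?S. nm z = k}" using z by simp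
    qed
    then have "{z \<in> ?S. nm z = k} \<in> ?J" unfolding iter_join_def using kP by blast
    moreover have "z0 \<in> {z \<in> ?S. nm z = k}" using z0 by simp
    ultimately show ?thesis by blast
  qed
  have onto: "C \<in> (\<lambda>k. {z \<in> ?S. nm z = k}) ` nm ` ?S" if C: "C \<in> ?J - {{}}" for C
  proof -
    obtain A where A: "C = ?S \<inter> (\<Inter>i<n. (f ^^ i) -` A i)" "\<forall>i<n. A i \<in> P" using C by (auto simp: iter_join_def)
    obtain z0 where z0: "z0 \<in> C" using C by blast
    have lab: "label P ((f ^^ i) z) = A i" if "z \<in> C" "i < n" for z i
      using that A label_eq[OF P(2), of "A i"] by auto
    have "nm z0 ! i = A i" if "i < n" for i using lab[OF z0 that] that by (simp add: nm_def)
    have "C = {z \<in> ?S. nm z = nm z0}"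
    proof (intro set_eqI iffI)
      fix z assume "z \<in> C"
      then show "z \<in> {z \<in> ?S. nm z = nm z0}" using lab z0 A by (auto simp: nm_def)
    next
      fix z assume "z \<in> {z \<in> ?S. nm z = nm z0}"
      then have z: "z \<in> ?S" "\<And>i. i < n \<Longrightarrow> label P ((f ^^ i) z) = A i"
        using lab[OF z0] by (auto simp: nm_def)
      then show "z \<in> C" using label_in[OF P(2) fi[OF z(1)]] unfolding A(1) by fastforce
    qed
    then show ?thesis using z0 A by blast
  qed
  have J: "?J - {{}} = (\<lambda>k. {z \<in> ?S. nm z = k}) ` nm ` ?S" using nm_mem onto by blast
  have "nm ` ?S \<subseteq> {xs. set xs \<subseteq> P \<and> length xs = n}"
    using label_in[OF P(2) fi] by (auto simp: nm_def)
  then have fin: "finite (nm ` ?S)" using finite_lists_length_eq[OF P(1)] finite_subset by blast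
  then have finJ: "finite (?J - {{}})" unfolding J by blast
  then have "finite ?J" by simp
  have inj: "inj_on (\<lambda>k. {z \<in> ?S. nm z = k}) (nm ` ?S)" by (rule inj_onI) blast
  have "partition_entropy M ?J = (\<Sum>A\<in>?J - {{}}. - (measure M A * ln (measure M A)))"
    unfolding partition_entropy_def using \<open>finite ?J\<close> by (intro sum.mono_neutral_right) auto
  also have "\<dots> = (\<Sum>k\<in>nm ` ?S. - (pr M nm k * ln (pr M nm k)))"
    unfolding J by (subst sum.reindex[OF inj]) (simp add: pr_def)
  finally show ?thesis by (simp add: ent_def sum_negf nm_def[abs_def])
qed

section \<open>The entropy of the suspension flow\<close>

context suspension_measure
begin

abbreviation tr :: "real \<Rightarrow> config \<times> real \<Rightarrow> config \<times> real" where
  "tr s p \<equiv> (fst p, snd p + s)"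

text \<open>Finite Borel observables that respect the identification of \<open>(x, v + 1)\<close>
  with \<open>(shift_map x, v)\<close>. \<open>N\<close> lives on heights in \<open>{0..<1}\<close>
  and is not itself invariant under \<open>tr\<close>, but the law of such an observable is.\<close>

definition equiv :: "(config \<times> real \<Rightarrow> 'k) \<Rightarrow> bool" where
  "equiv F \<longleftrightarrow> finite (range F) \<and> (\<forall>k. {p. F p = k} \<in> sets borel) \<and>
     (\<forall>x v. F (x, v + 1) = F (shift_map x, v))"

lemma equiv_fiber: "equiv F \<Longrightarrow> {p. F p = k} \<in> sets borel"
  by (simp add: equiv_def)

lemma simple_N: "finite (range F) \<Longrightarrow> (\<And>k. {p. F p = k} \<in> sets borel) \<Longrightarrow> simple_function N F"
  by (auto simp: simple_function_def vimage_def)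

lemma simple_tr: "equiv F \<Longrightarrow> simple_function N (\<lambda>p. F (tr s p))"
proof (rule simple_N)
  assume F: "equiv F"
  then show "finite (range (\<lambda>p. F (tr s p)))" unfolding equiv_def by (elim conjE) (rule finite_subset[rotated], auto)
  show "{p. F (tr s p) = k} \<in> sets borel" for k
    using measurable_sets[OF measurable_translate equiv_fiber[OF F], of s k] by (simp add: vimage_def)
qed

lemma simple_equiv: "equiv F \<Longrightarrow> simple_function N F"
  using simple_tr[of F 0] by simp

lemma equiv_Pair:
  assumes "equiv F" "equiv G" shows "equiv (\<lambda>p. (F p, G p))"
proof -
  have "range (\<lambda>p. (F p, G p)) \<subseteq> range F \<times> range G" by auto
  then have "finite (range (\<lambda>p. (F p, G p)))"
    by (rule finite_subset) (use assms in \<open>simp add: equiv_def\<close>)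
  moreover have "{p. (F p, G p) = k} \<in> sets borel" for k
  proof -
    have "{p. (F p, G p) = k} = {p. F p = fst k} \<inter> {p. G p = snd k}" by auto
    then show ?thesis using equiv_fiber[OF assms(1)] equiv_fiber[OF assms(2)] by (simp add: sets.Int)
  qed
  ultimately show ?thesis using assms by (simp add: equiv_def)
qed

lemma pr_tr:
  assumes F: "equiv F" shows "pr N (\<lambda>p. F (tr s p)) k = pr N F k"
proof -
  have "emeasure N {p. tr s p \<in> {p. F p = k}} = emeasure N {p. F p = k}"
    using F by (intro N_translate) (auto simp: equiv_def)
  then show ?thesis by (simp add: pr_def measure_def)
qed

lemma ent_tr:
  assumes F: "equiv F" shows "ent N (\<lambda>p. F (tr s p)) = ent N F"
  by (rule ent_eq_law[OF P.prob_space_axioms P.prob_space_axioms simple_tr[OF F] simple_equiv[OF F] pr_tr[OF F]])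

text \<open>The height, in units of the roof, gained in unit time: the angle of the
  rotation.\<close>

definition \<tau> :: real where "\<tau> = 1 / c"

lemma tau_pos: "0 < \<tau>"
  using c_pos by (simp add: \<tau>_def)

section \<open>Names along the time-one map\<close>

definition nms :: "(config \<times> real \<Rightarrow> 'k) \<Rightarrow> nat \<Rightarrow> config \<times> real \<Rightarrow> 'k list" where
  "nms F n p = map (\<lambda>i. F (tr (real i * \<tau>) p)) [0..<n]"

lemma simple_nms: "equiv F \<Longrightarrow> simple_function N (nms F n)"
  unfolding nms_def[abs_def] by (intro P.simple_function_names simple_tr)

lemma equiv_nms: "equiv F \<Longrightarrow> equiv (nms F n)"
proof -
  assume F: "equiv F"
  have "F (x, v + 1 + s) = F (shift_map x, v + s)" for x v s
    using F by (metis add.assoc add.commute equiv_def)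
  then have "nms F n (x, v + 1) = nms F n (shift_map x, v)" for x v by (simp add: nms_def)
  moreover have "finite (range (nms F n))" "{p. nms F n p = k} \<in> sets borel" for k
    using simple_functionD(1)[OF simple_nms[OF F, of n]] simple_function_fiber[OF simple_nms[OF F, of n], of k] by simp_all
  ultimately show ?thesis by (simp add: equiv_def)
qed

lemma nms_add: "nms F (m + n) p = nms F m p @ nms F n (tr (real m * \<tau>) p)"
proof -
  have shift: "[m..<m + n] = map (\<lambda>i. i + m) [0..<n]" by (simp add: map_add_upt add.commute)
  have "map (\<lambda>i. F (tr (real i * \<tau>) p)) [0..<m + n]
      = map (\<lambda>i. F (tr (real i * \<tau>) p)) [0..<m] @ map (\<lambda>i. F (tr (real i * \<tau>) p)) [m..<m + n]"
    by (metis map_append upt_add_eq_append zero_le)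
  also have "map (\<lambda>i. F (tr (real i * \<tau>) p)) [m..<m + n] = map (\<lambda>i. F (tr (real (i + m) * \<tau>) p)) [0..<n]"
    unfolding shift by simp
  finally show ?thesis by (simp add: nms_def algebra_simps)
qed

text \<open>The second half of a name is a translated name, which has the same law.\<close>

lemma ent_nms_subadd:
  assumes F: "equiv F" shows "ent N (nms F (m + n)) \<le> ent N (nms F m) + ent N (nms F n)"
proof -
  let ?G = "\<lambda>p. nms F n (tr (real m * \<tau>) p)"
  have G: "simple_function N ?G" using simple_tr[OF equiv_nms[OF F]] .
  have "ent N (nms F (m + n)) \<le> ent N (\<lambda>p. (nms F m p, ?G p))"
    by (rule P.ent_mono[OF simple_function_Pair[OF simple_nms[OF F] G]]) (simp add: nms_add)
  also have "\<dots> \<le> ent N (nms F m) + ent N ?G" by (rule P.ent_subadditive[OF simple_nms[OF F] G])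
  also have "ent N ?G = ent N (nms F n)" by (rule ent_tr[OF equiv_nms[OF F]])
  finally show ?thesis by simp
qed

lemma ent_nms_converges:
  assumes F: "equiv F" shows "\<exists>l. (\<lambda>n. ent N (nms F n) / real n) \<longlonglongrightarrow> l"
  by (rule fekete[OF ent_nms_subadd[OF F] P.ent_nonneg[OF simple_nms[OF F]]])

section \<open>Upper bound for the entropy of the suspension\<close>

lemma base_step: "base (x, v + 1) = base (shift_map x, v)"
  by (simp add: base_def shift_map_eq frac_def)

lemma equiv_base:
  assumes "finite (range (\<lambda>p. G (base p)))" "\<And>k. {p. G p = k} \<in> sets borel"
  shows "equiv (\<lambda>p. G (base p))"
  unfolding equiv_def using assms measurable_sets[OF measurable_base assms(2)]
  by (auto simp: base_step vimage_def)

lemma cell_base_range: "range (\<lambda>p. cell K (base p)) \<subseteq> range (win K) \<times> {0..<2 ^ K}"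
proof
  fix w assume "w \<in> range (\<lambda>p. cell K (base p))"
  then obtain p where w: "w = cell K (base p)" by blast
  have "0 \<le> frac (snd p)" "frac (snd p) < 1" by (simp_all add: frac_lt_1)
  then have "0 \<le> 2 ^ K * frac (snd p)" "2 ^ K * frac (snd p) < 2 ^ K * 1" by simp_all
  then have "0 \<le> \<lfloor>2 ^ K * frac (snd p)\<rfloor>" "\<lfloor>2 ^ K * frac (snd p)\<rfloor> < 2 ^ K" by (simp_all add: floor_less_iff)
  then show "w \<in> range (win K) \<times> {0..<2 ^ K}" unfolding w by (simp add: cell_def base_def)
qed

lemma equiv_cell: "equiv (\<lambda>p. cell K (base p))"
  by (rule equiv_base[OF finite_subset[OF cell_base_range] borel_cell]) (simp add: finite_range_win)

text \<open>\<open>ent_approx\<close> yields a variable decided by one level of cells. Composition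
  with \<open>base\<close> makes it equivariant and changes it on a null set only.\<close>

lemma ent_approx_cell:
  assumes F: "equiv F" and e: "0 < e"
  shows "\<exists>K. ent N (\<lambda>p. (F p, cell K (base p))) \<le> ent N (\<lambda>p. cell K (base p)) + e"
proof -
  define R where "R = range F"
  have fin: "finite R" using F by (simp add: equiv_def R_def)
  have sF: "simple_function N F" by (rule simple_equiv[OF F])
  have alg: "algebra (space N) (determined cell)" 
    unfolding space_N by (rule algebra_determined) (rule cell_mono)
  have gen: "sets N = sigma_sets (space N) (determined cell)" by (simp add: borel_config_real)
  obtain B where B: "\<forall>r\<in>R. B r \<in> determined cell"
      "ent N (\<lambda>p. (F p, {r \<in> R. p \<in> B r})) \<le> ent N (\<lambda>p. {r \<in> R. p \<in> B r}) + e"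
    using P.ent_approx[OF sF alg gen e] unfolding R_def by auto
  have "\<forall>r\<in>R. \<exists>K. \<forall>x y. cell K x = cell K y \<longrightarrow> (x \<in> B r \<longleftrightarrow> y \<in> B r)"
    using B(1) by (simp add: determined_def)
  then obtain k where k: "\<And>r x y. r \<in> R \<Longrightarrow> cell (k r) x = cell (k r) y \<Longrightarrow> (x \<in> B r \<longleftrightarrow> y \<in> B r)"
    by (metis (no_types, lifting))
  \<comment> \<open>The finitely many approximating sets share a common level.\<close>
  define K where "K = Max (insert 0 (k ` R))"
  have kK: "k r \<le> K" if "r \<in> R" for r unfolding K_def using fin that by (intro Max_ge) auto
  define T where "T p = {r \<in> R. p \<in> B r}" for p
  define T' where "T' p = T (base p)" for p
  have Tcell: "T p = T p'" if "cell K p = cell K p'" for p p'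
    unfolding T_def using k cell_mono[OF kK that] by blast
  have Tb: "{p. T p = t} \<in> sets borel" for t
  proof -
    have "(p \<in> {p. T p = t}) = (p' \<in> {p. T p = t})" if "cell K p = cell K p'" for p p'
      unfolding mem_Collect_eq Tcell[OF that] by (rule refl)
    then have "{p. T p = t} \<in> determined cell" unfolding determined_def by blast
    then show ?thesis unfolding borel_config_real by (rule sigma_sets.Basic)
  qed
  have TR: "range T \<subseteq> Pow R" by (auto simp: T_def)
  then have fT: "finite (range T)" by (rule finite_subset) (simp add: fin)
  have fT': "finite (range T')" by (rule finite_subset[OF _ fT]) (auto simp: T'_def)
  have eT': "equiv T'" unfolding T'_def[abs_def] by (rule equiv_base) (use fT' Tb in \<open>auto simp: T'_def\<close>)
  have sT: "simple_function N T" by (rule simple_N[OF fT Tb])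
  have sT': "simple_function N T'" by (rule simple_equiv[OF eT'])
  have ae: "AE p in N. T' p = T p" using AE_N_base by eventually_elim (simp add: T'_def)
  have m1: "pr N T' t = pr N T t" for t
    unfolding pr_def using ae simple_function_fiber[OF sT] simple_function_fiber[OF sT']
    by (intro measure_eq_AE) auto
  have m2: "pr N (\<lambda>p. (F p, T' p)) t = pr N (\<lambda>p. (F p, T p)) t" for t
    unfolding pr_def
    using ae simple_function_fiber[OF simple_function_Pair[OF sF sT]] simple_function_fiber[OF simple_function_Pair[OF sF sT']]
    by (intro measure_eq_AE) auto
  have "ent N T' = ent N T" by (rule ent_eq_law[OF P.prob_space_axioms P.prob_space_axioms sT' sT m1])
  moreover have "ent N (\<lambda>p. (F p, T' p)) = ent N (\<lambda>p. (F p, T p))"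
    by (rule ent_eq_law[OF P.prob_space_axioms P.prob_space_axioms simple_function_Pair[OF sF sT'] simple_function_Pair[OF sF sT] m2])
  ultimately have b: "ent N (\<lambda>p. (F p, T' p)) \<le> ent N T' + e" using B(2) by (simp add: T_def[abs_def])
  let ?Y = "\<lambda>p. cell K (base p)"
  have sY: "simple_function N ?Y" by (rule simple_equiv[OF equiv_cell])
  have T'Y: "T' p = T' p'" if "?Y p = ?Y p'" for p p' unfolding T'_def using Tcell that by blast
  \<comment> \<open>Conditioning on the finer cells instead of \<open>T'\<close> does not increase
    the conditional entropy of \<open>F\<close>.\<close>
  have "ent N (\<lambda>p. (F p, ?Y p, T' p)) + ent N T' \<le> ent N (\<lambda>p. (F p, T' p)) + ent N (\<lambda>p. (?Y p, T' p))"
    by (rule P.ent_strong_subadditive[OF sF sY sT'])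
  moreover have "ent N (\<lambda>p. (F p, ?Y p)) \<le> ent N (\<lambda>p. (F p, ?Y p, T' p))"
    by (rule P.ent_mono) (rule simple_function_Pair sF sY sT' | simp)+
  moreover have "ent N (\<lambda>p. (?Y p, T' p)) \<le> ent N ?Y"
  proof (rule P.ent_mono[OF sY])
    fix p p' assume "?Y p = ?Y p'"
    then show "(?Y p, T' p) = (?Y p', T' p')" using T'Y[of p p'] by (simp only:)
  qed
  ultimately have "ent N (\<lambda>p. (F p, ?Y p)) \<le> ent N ?Y + e" using b by linarith
  then show ?thesis by blast
qed

text \<open>The itinerary of the circle rotation is a monotone function of the starting point, so that it is
  determined by the sum of its entries; this bounds the number of itineraries linearly.\<close>

definition isum :: "nat \<Rightarrow> nat \<Rightarrow> config \<times> real \<Rightarrow> int" where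
  "isum K n p = (\<Sum>i<n. \<lfloor>2 ^ K * (frac (snd p) + real i * \<tau>)\<rfloor>)"

lemma isum_determines:
  assumes "isum K n p = isum K n p'" "i < n"
  shows "\<lfloor>2 ^ K * (frac (snd p) + real i * \<tau>)\<rfloor> = \<lfloor>2 ^ K * (frac (snd p') + real i * \<tau>)\<rfloor>"
proof -
  let ?g = "\<lambda>v i. \<lfloor>2 ^ K * (v + real i * \<tau>)\<rfloor>"
  have key: "?g v i = ?g w i" if vw: "v \<le> w" "(\<Sum>i<n. ?g v i) = (\<Sum>i<n. ?g w i)" for v w
  proof (rule ccontr)
    assume ne: "?g v i \<noteq> ?g w i"
    have le: "?g v j \<le> ?g w j" for j using vw(1) by (intro floor_mono mult_left_mono) auto
    have "(\<Sum>i<n. ?g v i) < (\<Sum>i<n. ?g w i)"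
      using le ne assms(2)
      by (intro sum_strict_mono_ex1 ballI bexI[of _ i]) (auto simp: less_le)
    then show False using vw(2) by simp
  qed
  show ?thesis using key[of "frac (snd p)" "frac (snd p')"] key[of "frac (snd p')" "frac (snd p)"] assms(1)
    unfolding isum_def by (metis linorder_linear)
qed

lemma isum_range: "isum K n p \<in> {(\<Sum>i<n. \<lfloor>2 ^ K * (real i * \<tau>)\<rfloor>)..(\<Sum>i<n. \<lfloor>2 ^ K * (real i * \<tau>)\<rfloor>) + int n * 2 ^ K}"
proof -
  have f: "0 \<le> frac (snd p)" "frac (snd p) \<le> 1" using frac_lt_1[of "snd p"] by simp_all
  have l: "\<lfloor>2 ^ K * (real i * \<tau>)\<rfloor> \<le> \<lfloor>2 ^ K * (frac (snd p) + real i * \<tau>)\<rfloor>" for i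
    using f by (intro floor_mono mult_left_mono) auto
  have u: "\<lfloor>2 ^ K * (frac (snd p) + real i * \<tau>)\<rfloor> \<le> \<lfloor>2 ^ K * (real i * \<tau>)\<rfloor> + 2 ^ K" for i
  proof -
    have "\<lfloor>2 ^ K * (frac (snd p) + real i * \<tau>)\<rfloor> \<le> \<lfloor>2 ^ K * (real i * \<tau>) + of_int (2 ^ K)\<rfloor>"
      using f by (intro floor_mono) (simp add: distrib_left)
    then show ?thesis by (simp only: floor_add_int[symmetric])
  qed
  have "(\<Sum>i<n. \<lfloor>2 ^ K * (real i * \<tau>)\<rfloor>) \<le> isum K n p" unfolding isum_def by (intro sum_mono l)
  moreover have "isum K n p \<le> (\<Sum>i<n. \<lfloor>2 ^ K * (real i * \<tau>)\<rfloor> + 2 ^ K)" unfolding isum_def by (intro sum_mono u)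
  ultimately show ?thesis by (simp add: sum.distrib)
qed

lemma simple_isum: "simple_function N (isum K n)"
proof (rule simple_N)
  show "finite (range (isum K n))"
    by (rule finite_subset[of _ "{(\<Sum>i<n. \<lfloor>2 ^ K * (real i * \<tau>)\<rfloor>)..(\<Sum>i<n. \<lfloor>2 ^ K * (real i * \<tau>)\<rfloor>) + int n * 2 ^ K}"])
       (use isum_range in auto)
  have s: "snd \<in> borel_measurable (borel :: (config \<times> real) measure)"
    by (intro borel_measurable_continuous_onI continuous_on_snd continuous_on_id)
  then have m: "(\<lambda>p::config \<times> real. real_of_int \<lfloor>2 ^ K * (frac (snd p) + real i * \<tau>)\<rfloor>) \<in> borel_measurable borel" for i
    unfolding frac_def by measurable
  have "{p. isum K n p = k} = (\<lambda>p. \<Sum>i<n. real_of_int \<lfloor>2 ^ K * (frac (snd p) + real i * \<tau>)\<rfloor>) -` {of_int k} \<inter> space borel" for k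
    unfolding isum_def by (auto simp flip: of_int_sum)
  moreover have "(\<lambda>p::config \<times> real. \<Sum>i<n. real_of_int \<lfloor>2 ^ K * (frac (snd p) + real i * \<tau>)\<rfloor>) \<in> borel_measurable borel"
    by (intro borel_measurable_sum m)
  ultimately show "{p. isum K n p = k} \<in> sets borel" for k
    using measurable_sets[of _ borel borel "{real_of_int k}"] by (simp only:) simp
qed

lemma ent_isum: "ent N (isum K n) \<le> ln (real n * 2 ^ K + 1)"
proof -
  let ?S = "{(\<Sum>i<n. \<lfloor>2 ^ K * (real i * \<tau>)\<rfloor>)..(\<Sum>i<n. \<lfloor>2 ^ K * (real i * \<tau>)\<rfloor>) + int n * 2 ^ K}"
  have "ent N (isum K n) \<le> ln (real (card ?S))"
    by (rule P.ent_le_ln_card[OF simple_isum]) (use isum_range in auto)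
  also have "card ?S = n * 2 ^ K + 1"
    by (simp add: nat_add_distrib nat_mult_distrib nat_power_eq)
  finally show ?thesis by (simp add: add.commute)
qed

lemma emeasure_base: "A \<in> sets borel \<Longrightarrow> emeasure N {p. fst (base p) \<in> A} = emeasure \<mu> A"
proof -
  assume A: "A \<in> sets borel"
  have f: "fst \<in> borel_measurable (borel :: (config \<times> real) measure)"
    by (intro borel_measurable_continuous_onI continuous_on_fst continuous_on_id)
  have "{p :: config \<times> real. fst p \<in> A} \<in> sets borel" using measurable_sets[OF f A] by (simp add: vimage_def)
  moreover from measurable_sets[OF measurable_base this] have "{p. fst (base p) \<in> A} \<in> sets borel"
    by (simp add: vimage_def)
  moreover have "AE p in N. p \<in> {p. fst (base p) \<in> A} \<longleftrightarrow> p \<in> {p. fst p \<in> A}"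
    using AE_N_base by eventually_elim simp
  ultimately have "emeasure N {p. fst (base p) \<in> A} = emeasure N {p. fst p \<in> A}"
    by (intro emeasure_eq_AE) auto
  then show ?thesis using emeasure_fst[OF A] by simp
qed

lemma simple_wrd: "simple_function \<mu> (wrd L)"
  using finite_range_wrd[of L] borel_wrd[of L] by (auto simp: simple_function_def vimage_def)

lemma fiber_base_wrd: "{p. wrd L (shiftn k (fst (base p))) = w} \<in> sets borel"
  "emeasure N {p. wrd L (shiftn k (fst (base p))) = w} = emeasure \<mu> {x. wrd L x = w}"
proof -
  have s: "shiftn k -` {x. wrd L x = w} \<in> sets borel"
    using measurable_sets[OF measurable_shiftn borel_wrd] by simp
  have f: "(\<lambda>p. fst (base p)) \<in> borel_measurable borel"
    by (rule measurable_compose[OF measurable_base])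
       (intro borel_measurable_continuous_onI continuous_on_fst continuous_on_id)
  have e: "{p. wrd L (shiftn k (fst (base p))) = w} = {p. fst (base p) \<in> shiftn k -` {x. wrd L x = w}}" by auto
  show "{p. wrd L (shiftn k (fst (base p))) = w} \<in> sets borel"
    unfolding e using measurable_sets[OF f s] by (simp add: vimage_def)
  show "emeasure N {p. wrd L (shiftn k (fst (base p))) = w} = emeasure \<mu> {x. wrd L x = w}"
    unfolding e emeasure_base[OF s] by (rule inv_shiftn[OF borel_wrd])
qed

lemma simple_base_wrd: "simple_function N (\<lambda>p. wrd L (shiftn k (fst (base p))))"
proof (rule simple_N[OF _ fiber_base_wrd(1)])
  show "finite (range (\<lambda>p. wrd L (shiftn k (fst (base p)))))"
    by (rule finite_subset[OF _ finite_range_wrd[of L]]) auto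
qed

lemma ent_base_wrd: "ent N (\<lambda>p. wrd L (shiftn k (fst (base p)))) = ent \<mu> (wrd L)"
proof (rule ent_eq_law[OF P.prob_space_axioms mu.prob_space_axioms simple_base_wrd simple_wrd])
  show "pr N (\<lambda>p. wrd L (shiftn k (fst (base p)))) w = pr \<mu> (wrd L) w" for w
    using fiber_base_wrd(2)[of L k w] by (simp add: pr_def measure_def)
qed

text \<open>The skew product: how far the base is shifted depends on the circle coordinate alone,
  which itself is rotated by \<open>s\<close>.\<close>

lemma base_tr: "base (tr s p) = (shiftn \<lfloor>frac (snd p) + s\<rfloor> (fst (base p)), frac (frac (snd p) + s))"
proof -
  have e: "snd p + s = (frac (snd p) + s) + of_int \<lfloor>snd p\<rfloor>" by (simp add: frac_def)
  have "\<lfloor>snd p + s\<rfloor> = \<lfloor>frac (snd p) + s\<rfloor> + \<lfloor>snd p\<rfloor>" unfolding e by simp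
  then have "frac (snd p + s) = frac (frac (snd p) + s)" unfolding frac_def by simp
  with \<open>\<lfloor>snd p + s\<rfloor> = \<lfloor>frac (snd p) + s\<rfloor> + \<lfloor>snd p\<rfloor>\<close> show ?thesis by (simp add: base_def)
qed

text \<open>A floor at resolution 2^K carries both the amount of the shift and the dyadic cell of
  the new height, so the terms of \<open>isum\<close> record both.\<close>

lemma floor_split:
  fixes t t' :: real
  shows "\<lfloor>2 ^ K * t\<rfloor> = \<lfloor>2 ^ K * t'\<rfloor> \<Longrightarrow> \<lfloor>t\<rfloor> = \<lfloor>t'\<rfloor> \<and> \<lfloor>2 ^ K * frac t\<rfloor> = \<lfloor>2 ^ K * frac t'\<rfloor>"
proof -
  assume a: "\<lfloor>2 ^ K * t\<rfloor> = \<lfloor>2 ^ K * t'\<rfloor>"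
  have d: "\<lfloor>u\<rfloor> = \<lfloor>2 ^ K * u\<rfloor> div 2 ^ K" for u :: real
  proof -
    have "u = 2 ^ K * u / real_of_int (2 ^ K)" by simp
    then show ?thesis by (metis floor_divide_real_eq_div zero_le_numeral zero_le_power)
  qed
  have f: "\<lfloor>2 ^ K * frac u\<rfloor> = \<lfloor>2 ^ K * u\<rfloor> - 2 ^ K * \<lfloor>u\<rfloor>" for u :: real
  proof -
    have "2 ^ K * frac u = 2 ^ K * u - of_int (2 ^ K * \<lfloor>u\<rfloor>)" by (simp add: frac_def right_diff_distrib)
    then show ?thesis by (simp only: floor_diff_of_int)
  qed
  show ?thesis using d[of t] d[of t'] f[of t] f[of t'] a by metis
qed

text \<open>The cell name over n steps is determined by the rotation itinerary, which costs a
  logarithm, and by a single word of the base configuration long enough to contain all windows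
  visited.\<close>

lemma ent_nms_cell:
  "ent N (nms (\<lambda>p. cell K (base p)) n) \<le> ln (real n * 2 ^ K + 1) + ent \<mu> (wrd (nat \<lfloor>real n * \<tau>\<rfloor> + (2 * K + 3)))"
proof -
  \<comment> \<open>Window centres run from 0 to at most
    \<open>\<lfloor>real n * \<tau>\<rfloor> + 1\<close>, and \<open>K\<close> positions are needed
    on either side; hence the word starts at \<open>- int K\<close>.\<close>
  define L where "L = nat \<lfloor>real n * \<tau>\<rfloor> + (2 * K + 3)"
  let ?V = "\<lambda>p. wrd L (shiftn (- int K) (fst (base p)))"
  have det: "nms (\<lambda>p. cell K (base p)) n p = nms (\<lambda>p. cell K (base p)) n p'"
    if eq: "isum K n p = isum K n p'" "?V p = ?V p'" for p p'
  proof -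
    have "cell K (base (tr (real i * \<tau>) p)) = cell K (base (tr (real i * \<tau>) p'))" if i: "i < n" for i
    proof -
      let ?t = "frac (snd p) + real i * \<tau>" and ?t' = "frac (snd p') + real i * \<tau>"
      have fl: "\<lfloor>?t\<rfloor> = \<lfloor>?t'\<rfloor>" "\<lfloor>2 ^ K * frac ?t\<rfloor> = \<lfloor>2 ^ K * frac ?t'\<rfloor>"
        using floor_split[OF isum_determines[OF eq(1) i]] by simp_all
      have it: "real i * \<tau> \<le> real n * \<tau>" using i tau_pos by (intro mult_right_mono) auto
      have "0 \<le> real i * \<tau>" using tau_pos by simp
      then have j0: "0 \<le> \<lfloor>?t\<rfloor>" by simp
      have "?t \<le> real n * \<tau> + 1" using it frac_lt_1[of "snd p"] by linarith
      then have j1: "\<lfloor>?t\<rfloor> \<le> \<lfloor>real n * \<tau>\<rfloor> + 1" by linarith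
      have n0: "0 \<le> \<lfloor>real n * \<tau>\<rfloor>" using tau_pos by simp
      have LK: "int L = \<lfloor>real n * \<tau>\<rfloor> + 2 * int K + 3" using n0 by (simp add: L_def)
      have "win K (shiftn \<lfloor>?t\<rfloor> (fst (base p))) = win K (shiftn \<lfloor>?t\<rfloor> (fst (base p')))"
      proof (unfold win_eq_iff, intro allI impI)
        fix k :: int assume k: "\<bar>k\<bar> \<le> int K"
        define m where "m = k + \<lfloor>?t\<rfloor> + int K"
        have "0 \<le> m" "m < int L" using k j0 j1 LK unfolding m_def by linarith+
        then have "shiftn (- int K) (fst (base p)) m = shiftn (- int K) (fst (base p')) m"
          using eq(2) unfolding wrd_eq_iff by blast
        then show "shiftn \<lfloor>?t\<rfloor> (fst (base p)) k = shiftn \<lfloor>?t\<rfloor> (fst (base p')) k"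
          by (simp add: shiftn_apply m_def)
      qed
      then show ?thesis unfolding base_tr cell_def using fl by simp
    qed
    then show ?thesis by (simp add: nms_def)
  qed
  have "ent N (nms (\<lambda>p. cell K (base p)) n) \<le> ent N (\<lambda>p. (isum K n p, ?V p))"
    by (rule P.ent_mono[OF simple_function_Pair[OF simple_isum simple_base_wrd]]) (use det in blast)
  also have "\<dots> \<le> ent N (isum K n) + ent N ?V" by (rule P.ent_subadditive[OF simple_isum simple_base_wrd])
  also have "\<dots> \<le> ln (real n * 2 ^ K + 1) + ent \<mu> (wrd L)"
    using ent_isum[of K n] by (simp add: ent_base_wrd)
  finally show ?thesis unfolding L_def .
qed

text \<open>The source of the factor \<tau>: in n units of time the words read have length n \<tau>
  up to a bounded error.\<close>

lemma ent_wrd_scaled: "(\<lambda>n. ent \<mu> (wrd (nat \<lfloor>real n * \<tau>\<rfloor> + C)) / real n) \<longlonglongrightarrow> h * \<tau>"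
proof -
  let ?L = "\<lambda>n. nat \<lfloor>real n * \<tau>\<rfloor> + C"
  have rl: "real (?L n) = of_int \<lfloor>real n * \<tau>\<rfloor> + real C" for n using tau_pos by simp
  have b: "real n * \<tau> - 1 \<le> real (?L n)" "real (?L n) \<le> real n * \<tau> + real C" for n unfolding rl by linarith+
  have r: "(\<lambda>n. real (?L n) / real n) \<longlonglongrightarrow> \<tau>"
  proof (rule real_tendsto_sandwich)
    show "\<forall>\<^sub>F n in sequentially. (real n * \<tau> - 1) / real n \<le> real (?L n) / real n"
      using b(1) by (intro always_eventually allI divide_right_mono) auto
    show "\<forall>\<^sub>F n in sequentially. real (?L n) / real n \<le> (real n * \<tau> + real C) / real n"
      using b(2) by (intro always_eventually allI divide_right_mono) auto
    show "(\<lambda>n. (real n * \<tau> - 1) / real n) \<longlonglongrightarrow> \<tau>" by real_asymp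
    show "(\<lambda>n. (real n * \<tau> + real C) / real n) \<longlonglongrightarrow> \<tau>" by real_asymp
  qed
  have "filterlim (\<lambda>n. real n * \<tau> - 1) at_top sequentially" using tau_pos by real_asymp
  then have "filterlim (\<lambda>n. real (?L n)) at_top sequentially"
    by (rule filterlim_at_top_mono) (use b(1) in auto)
  then have inf: "filterlim ?L at_top sequentially" by (simp add: filterlim_sequentially_iff_filterlim_real)
  have "(\<lambda>n. ent \<mu> (wrd (?L n)) / real (?L n)) \<longlonglongrightarrow> h"
    by (rule filterlim_compose[OF ent_wrd inf])
  then have "(\<lambda>n. (ent \<mu> (wrd (?L n)) / real (?L n)) * (real (?L n) / real n)) \<longlonglongrightarrow> h * \<tau>"
    by (intro tendsto_mult r)
  moreover have "\<forall>\<^sub>F n in sequentially. (ent \<mu> (wrd (?L n)) / real (?L n)) * (real (?L n) / real n) = ent \<mu> (wrd (?L n)) / real n"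
  proof -
    have "\<forall>\<^sub>F n in sequentially. 1 \<le> ?L n" using inf unfolding filterlim_at_top by blast
    then show ?thesis by eventually_elim simp
  qed
  ultimately show ?thesis by (rule Lim_transform_eventually)
qed

text \<open>By \<open>ent_names_le\<close> the names of \<open>F\<close> exceed the cell names by at
  most \<open>e\<close> per step, and the logarithm in \<open>ent_nms_cell\<close> disappears after
  division by n.\<close>

lemma ent_nms_upper:
  assumes F: "equiv F" and l: "(\<lambda>n. ent N (nms F n) / real n) \<longlonglongrightarrow> l"
  shows "l \<le> h * \<tau>"
proof (rule field_le_epsilon)
  fix e :: real assume e: "0 < e"
  obtain K where K: "ent N (\<lambda>p. (F p, cell K (base p))) \<le> ent N (\<lambda>p. cell K (base p)) + e"
    using ent_approx_cell[OF F e] by blast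
  let ?Y = "\<lambda>p. cell K (base p)"
  have pe: "equiv (\<lambda>p. (F p, ?Y p))" by (rule equiv_Pair[OF F equiv_cell])
  have nb: "ent N (nms F n) \<le> ent N (nms ?Y n) + real n * e" for n
    unfolding nms_def[abs_def]
  proof (rule P.ent_names_le[OF simple_tr[OF F] simple_tr[OF equiv_cell]])
    fix i
    show "ent N (\<lambda>p. (F (tr (real i * \<tau>) p), ?Y (tr (real i * \<tau>) p))) \<le> ent N (\<lambda>p. ?Y (tr (real i * \<tau>) p)) + e"
      using K ent_tr[OF pe, of "real i * \<tau>"] ent_tr[OF equiv_cell, of K "real i * \<tau>"] by simp
  qed
  let ?C = "2 * K + 3"
  let ?a = "\<lambda>n. ent \<mu> (wrd (nat \<lfloor>real n * \<tau>\<rfloor> + ?C))"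
  have D: "(0::real) < 2 ^ K" by simp
  have ln0: "(\<lambda>n. ln (real n * D + 1) / real n) \<longlonglongrightarrow> 0" if "0 < D" for D :: real
    using that by real_asymp
  have "(\<lambda>n. ln (real n * 2 ^ K + 1) / real n + ?a n / real n + e) \<longlonglongrightarrow> 0 + h * \<tau> + e"
    by (intro tendsto_add ln0[OF D] ent_wrd_scaled tendsto_const)
  moreover have "\<forall>\<^sub>F n in sequentially. ent N (nms F n) / real n \<le> ln (real n * 2 ^ K + 1) / real n + ?a n / real n + e"
    using eventually_gt_at_top[of "0::nat"]
  proof eventually_elim
    case (elim n)
    have "ent N (nms F n) \<le> ln (real n * 2 ^ K + 1) + ?a n + real n * e"
      using nb[of n] ent_nms_cell[of K n] by linarith
    then have "ent N (nms F n) / real n \<le> (ln (real n * 2 ^ K + 1) + ?a n + real n * e) / real n"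
      by (intro divide_right_mono) auto
    then show ?case using elim by (simp add: add_divide_distrib)
  qed
  ultimately have "l \<le> 0 + h * \<tau> + e" using l by (intro tendsto_le[OF sequentially_bot])
  then show "l \<le> h * \<tau> + e" by simp
qed

end

section \<open>Transfer to the suspension and the lower bound\<close>

context suspension_measure
begin

lemma q_surj: "z \<in> topspace Z \<Longrightarrow> \<exists>p. z = q p"
proof -
  assume "z \<in> topspace Z"
  then obtain x u where "z = qv x (u / c)" using qv_surj by blast
  then have "z = q (x, u / c)" by simp
  then show ?thesis by blast
qed

lemma q_tr: "flow 1 (q p) = q (tr \<tau> p)"
  by (simp add: flow_qv \<tau>_def)

lemma funpow_flow: "(flow 1 ^^ i) (q p) = q (tr (real i * \<tau>) p)"
proof (induction i)
  case (Suc i)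
  have "(flow 1 ^^ Suc i) (q p) = q (tr \<tau> (tr (real i * \<tau>) p))" by (simp only: funpow.simps comp_apply Suc q_tr)
  then show ?case by (simp add: algebra_simps)
qed simp

lemma measurable_funpow_flow: "(flow 1 ^^ i) \<in> \<nu> \<rightarrow>\<^sub>M \<nu>"
proof (induction i)
  case 0
  then show ?case by (simp add: id_def)
next
  case (Suc i)
  have "flow 1 \<in> \<nu> \<rightarrow>\<^sub>M \<nu>"
    using measurable_flow[of 1] measurable_cong_sets[OF sets_nu sets_nu] by blast
  from measurable_comp[OF Suc this] show ?case by (simp only: funpow.simps)
qed

lemma ent_nu:
  assumes G: "\<And>k. {z \<in> topspace Z. G z = k} \<in> sets (borel_of Z)"
  shows "ent \<nu> G = ent N (\<lambda>p. G (q p))"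
proof -
  have im: "G ` space \<nu> = (\<lambda>p. G (q p)) ` space N"
    using q_surj qv_topspace by (auto simp: image_iff) metis
  have "pr \<nu> G k = pr N (\<lambda>p. G (q p)) k" for k
    using emeasure_nu[OF G, of k] qv_topspace by (simp add: pr_def measure_def)
  then show ?thesis unfolding ent_def im by simp
qed

lemma equiv_q:
  assumes fin: "finite (G ` topspace Z)" and G: "\<And>k. {z \<in> topspace Z. G z = k} \<in> sets (borel_of Z)"
  shows "equiv (\<lambda>p. G (q p))"
proof -
  have "finite (range (\<lambda>p. G (q p)))" by (rule finite_subset[OF _ fin]) (use qv_topspace in auto)
  moreover have "{p. G (q p) = k} \<in> sets borel" for k
    using borel_q[OF G, of k] qv_topspace by simp
  ultimately show ?thesis by (simp add: equiv_def qv_step)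
qed

lemma label_fiber:
  assumes P: "partition_on (topspace Z) P" "P \<subseteq> sets (borel_of Z)"
  shows "{z \<in> topspace Z. label P z = A} \<in> sets (borel_of Z)"
proof (cases "A \<in> P")
  case True
  have "A \<subseteq> topspace Z" using P(1) True by (auto simp: partition_on_def)
  then have "{z \<in> topspace Z. label P z = A} = A"
    using label_eq[OF P(1) True] label_in[OF P(1)] by blast
  then show ?thesis using P(2) True by auto
next
  case False
  then have "{z \<in> topspace Z. label P z = A} = {}" using label_in[OF P(1)] by blast
  then show ?thesis by (simp only: sets.empty_sets)
qed

lemma partition_entropy_nu:
  assumes fin: "finite P" and P: "partition_on (topspace Z) P" "P \<subseteq> sets (borel_of Z)"
  shows "equiv (\<lambda>p. label P (q p))"
    and "partition_entropy \<nu> (iter_join (space \<nu>) (flow 1) P n) = ent N (nms (\<lambda>p. label P (q p)) n)"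
proof -
  have lf: "finite (label P ` topspace Z)" by (rule finite_subset[OF _ fin]) (use label_in[OF P(1)] in auto)
  show "equiv (\<lambda>p. label P (q p))" by (rule equiv_q[OF lf label_fiber[OF P]])
  interpret nu: prob_space \<nu> by (rule prob_space_nu)
  have maps: "flow 1 z \<in> space \<nu>" if "z \<in> space \<nu>" for z
    using measurable_space[OF measurable_funpow_flow[of 1] that] by simp
  let ?G = "\<lambda>z. map (\<lambda>i. label P ((flow 1 ^^ i) z)) [0..<n]"
  have "simple_function \<nu> (\<lambda>z. label P ((flow 1 ^^ i) z))" for i
    unfolding simple_function_def
  proof (intro conjI ballI)
    show "finite ((\<lambda>z. label P ((flow 1 ^^ i) z)) ` space \<nu>)"
      by (rule finite_subset[OF _ lf]) (use measurable_space[OF measurable_funpow_flow[of i]] in auto)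
    fix k
    have "{z \<in> topspace Z. label P z = k} \<in> sets \<nu>" using label_fiber[OF P] by simp
    from measurable_sets[OF measurable_funpow_flow[of i] this]
    have "(flow 1 ^^ i) -` {z \<in> topspace Z. label P z = k} \<inter> space \<nu> \<in> sets \<nu>" .
    moreover have "(flow 1 ^^ i) -` {z \<in> topspace Z. label P z = k} \<inter> space \<nu> = (\<lambda>z. label P ((flow 1 ^^ i) z)) -` {k} \<inter> space \<nu>"
      using measurable_space[OF measurable_funpow_flow[of i]] by auto
    ultimately show "(\<lambda>z. label P ((flow 1 ^^ i) z)) -` {k} \<inter> space \<nu> \<in> sets \<nu>" by simp
  qed
  then have sG: "simple_function \<nu> ?G" by (intro nu.simple_function_names)
  have "partition_entropy \<nu> (iter_join (space \<nu>) (flow 1) P n) = ent \<nu> ?G"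
    using P(1) maps by (intro partition_entropy_iter_join[OF fin]) simp_all
  also have "\<dots> = ent N (\<lambda>p. ?G (q p))"
    using simple_function_fiber[OF sG] by (intro ent_nu) simp
  also have "\<dots> = ent N (nms (\<lambda>p. label P (q p)) n)"
    by (intro ent_cong) (simp only: nms_def funpow_flow)
  finally show "partition_entropy \<nu> (iter_join (space \<nu>) (flow 1) P n) = ent N (nms (\<lambda>p. label P (q p)) n)" .
qed

text \<open>At least \<open>\<tau> + 1\<close>, which bounds the jump of the floor of the height in
  unit time.\<close>

definition W0 :: nat where "W0 = nat \<lceil>\<tau>\<rceil> + 1"

definition qset :: "bool list \<Rightarrow> (config \<times> real) set option set" where
  "qset w = (\<lambda>(x, v). qv x v) ` ((Y \<inter> {x. win W0 x = w}) \<times> {0..<1})"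

text \<open>The observable whose partition attains the entropy: a window of the base configuration
  of \<open>z\<close>, and \<open>None\<close> at \<Delta>. By \<open>qset_iff\<close> the sets
  \<open>qset w\<close> are disjoint, so the description is unique.\<close>

definition code :: "(config \<times> real) set option \<Rightarrow> bool list option" where
  "code z = (if \<exists>w. z \<in> qset w then Some (THE w. z \<in> qset w) else None)"

lemma qset_iff: "q p \<in> qset w \<longleftrightarrow> fst p \<in> Y \<and> win W0 (fst (base p)) = w"
proof
  assume "q p \<in> qset w"
  then obtain y u where y: "y \<in> Y" "win W0 y = w" "0 \<le> u" "u < 1" "q p = qv y u" by (auto simp: qset_def)
  then have p: "fst p \<in> Y" using qv_eq_None_iff by metis
  have u0: "\<lfloor>u\<rfloor> = 0" using y by (simp add: floor_eq_iff)
  have "shiftn \<lfloor>snd p\<rfloor> (fst p) = shiftn \<lfloor>u\<rfloor> y" using y(5) qv_eq_iff[OF p y(1)] by blast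
  then show "fst p \<in> Y \<and> win W0 (fst (base p)) = w" using p y u0 by (simp add: base_def)
next
  assume a: "fst p \<in> Y \<and> win W0 (fst (base p)) = w"
  have "qv (fst (base p)) (snd (base p)) = q p"
  proof -
    have "frac (snd p) + of_int \<lfloor>snd p\<rfloor> = snd p" by (simp add: frac_def)
    then show ?thesis by (simp add: base_def qv_shift)
  qed
  moreover have "fst (base p) \<in> Y" using a by (simp add: base_def)
  moreover have "0 \<le> snd (base p)" "snd (base p) < 1" by (simp_all add: base_def frac_lt_1)
  ultimately show "q p \<in> qset w" unfolding qset_def using a
    by (intro image_eqI[of _ _ "base p"]) (auto simp: split_beta mem_Times_iff)
qed

lemma code_q: "code (q p) = (if fst p \<in> Y then Some (win W0 (fst (base p))) else None)"
  unfolding code_def qset_iff by auto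

lemma code_fiber: "{z \<in> topspace Z. code z = k} \<in> sets (borel_of Z)"
proof -
  have qs: "qset w \<in> sets (borel_of Z)" for w
    unfolding qset_def by (rule qv_clopen_borel[OF clopen_win])
  have Some_code: "{z \<in> topspace Z. code z = Some w} = qset w" for w
  proof (intro set_eqI iffI)
    fix z assume "z \<in> {z \<in> topspace Z. code z = Some w}"
    then obtain p where "z = q p" "code z = Some w" using q_surj by blast
    then show "z \<in> qset w" using code_q[of p] qset_iff[of p w] by (auto split: if_splits)
  next
    fix z assume z: "z \<in> qset w"
    then have "z \<in> topspace Z" using qv_topspace by (auto simp: qset_def)
    then obtain p where p: "z = q p" using q_surj by blast
    then have "code z = Some w" using z code_q[of p] qset_iff[of p w] by simp
    then show "z \<in> {z \<in> topspace Z. code z = Some w}" using \<open>z \<in> topspace Z\<close> by simp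
  qed
  show ?thesis
  proof (cases k)
    case (Some w)
    then show ?thesis using qs Some_code by simp
  next
    case None
    have "{z \<in> topspace Z. code z = None} = topspace Z - (\<Union>w\<in>range (win W0). qset w)"
    proof (intro set_eqI iffI)
      fix z assume "z \<in> {z \<in> topspace Z. code z = None}"
      then show "z \<in> topspace Z - (\<Union>w\<in>range (win W0). qset w)" by (auto simp: code_def split: if_splits)
    next
      fix z assume z: "z \<in> topspace Z - (\<Union>w\<in>range (win W0). qset w)"
      then obtain p where p: "z = q p" using q_surj by blast
      have "fst p \<notin> Y"
      proof
        assume "fst p \<in> Y"
        then have "z \<in> qset (win W0 (fst (base p)))" unfolding p qset_iff by simp
        then show False using z by blast
      qed
      then show "z \<in> {z \<in> topspace Z. code z = None}" using z code_q[of p] p by simp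
    qed
    moreover have "topspace Z - (\<Union>w\<in>range (win W0). qset w) \<in> sets (borel_of Z)"
      using qs finite_range_win[of W0] by (intro sets.Diff sets.finite_UN) (auto simp: borel_of_open)
    ultimately show ?thesis using None by simp
  qed
qed

lemma code_finite: "finite (code ` topspace Z)"
proof (rule finite_subset)
  show "code ` topspace Z \<subseteq> insert None (Some ` range (win W0))"
  proof
    fix k assume "k \<in> code ` topspace Z"
    then obtain p where "k = code (q p)" using q_surj by blast
    then show "k \<in> insert None (Some ` range (win W0))" using code_q[of p] by auto
  qed
qed (simp add: finite_range_win)

text \<open>Consecutive windows overlap, since the floor jumps by at most \<open>\<lceil>\<tau>\<rceil>\<close> in each step.\<close>

lemma windows_cover:
  assumes f: "0 \<le> f" "f < 1" and k: "0 \<le> k" "k < \<lfloor>real n * \<tau>\<rfloor>"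
  shows "\<exists>i<n. \<bar>k - \<lfloor>f + real i * \<tau>\<rfloor>\<bar> \<le> int W0"
proof -
  let ?j = "\<lambda>i. \<lfloor>f + real i * \<tau>\<rfloor>"
  have n: "0 < n" using k by (cases n) auto
  have j0: "?j 0 = 0" using f by (simp add: floor_eq_iff)
  have W: "\<tau> + 1 \<le> real W0" unfolding W0_def using tau_pos by (simp add: of_nat_nat)
  let ?S = "{i. i < n \<and> ?j i \<le> k}"
  have S: "finite ?S" "0 \<in> ?S" using n j0 k by auto
  \<comment> \<open>The last time at which the window centre has not yet passed \<open>k\<close>;
    the next centre, or the end of the word, lies within one jump.\<close>
  define i where "i = Max ?S"
  have i: "i < n" "?j i \<le> k" using Max_in[OF S(1)] S(2) unfolding i_def by blast+
  have "k \<le> ?j i + int W0"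
  proof (cases "Suc i < n")
    case True
    have "Suc i \<notin> ?S"
    proof
      assume "Suc i \<in> ?S"
      then have "Suc i \<le> i" unfolding i_def by (rule Max_ge[OF S(1)])
      then show False by simp
    qed
    then have "k < ?j (Suc i)" using True by auto
    moreover have "f + real (Suc i) * \<tau> = f + real i * \<tau> + \<tau>" by (simp add: algebra_simps)
    then have "?j (Suc i) \<le> ?j i + int W0" using W by linarith
    ultimately show ?thesis by linarith
  next
    case False
    then have "n = Suc i" using i by simp
    then have "real n * \<tau> = real i * \<tau> + \<tau>" by (simp add: algebra_simps)
    then have "\<lfloor>real n * \<tau>\<rfloor> \<le> ?j i + int W0" using W f by linarith
    then show ?thesis using k by linarith
  qed
  then show ?thesis using i by (intro exI[of _ i]) auto
qed

text \<open>A code name shows windows that cover the word, and the itinerary \<open>isum 0\<close>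
  at resolution 1 tells where each window sits. The latter has at most n + 1 values, which gives the
  logarithm.\<close>

lemma ent_nms_code_lower:
  assumes F: "equiv F" and det: "\<And>p p'. F p = F p' \<Longrightarrow> code (q p) = code (q p')" and n: "0 < n"
  shows "ent \<mu> (wrd (nat \<lfloor>real n * \<tau>\<rfloor>)) \<le> ent N (nms F n) + ln (real n + 1)"
proof -
  define L where "L = nat \<lfloor>real n * \<tau>\<rfloor>"
  let ?V = "\<lambda>p. wrd L (fst (base p))"
  \<comment> \<open>Outside \<open>Y\<close> every code is \<open>None\<close> and the word cannot
    be recovered; replacing it there by \<open>[]\<close> changes a null set only.\<close>
  define V' where "V' p = (if fst p \<in> Y then ?V p else [])" for p
  have Vs: "simple_function N ?V" using simple_base_wrd[of L 0] by simp
  have V'V: "AE p in N. V' p = ?V p" using AE_N_Y by eventually_elim (simp add: V'_def)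
  have det2: "V' p = V' p'" if eq: "isum 0 n p = isum 0 n p'" "nms F n p = nms F n p'" for p p'
  proof -
    have Fi: "code (q (tr (real i * \<tau>) p)) = code (q (tr (real i * \<tau>) p'))" if "i < n" for i
    proof (rule det)
      have "nms F n p ! i = nms F n p' ! i" using eq(2) by simp
      then show "F (tr (real i * \<tau>) p) = F (tr (real i * \<tau>) p')" using that by (simp add: nms_def)
    qed
    have Y: "fst p \<in> Y \<longleftrightarrow> fst p' \<in> Y"
      using Fi[OF n] unfolding code_q by (auto split: if_splits)
    show ?thesis
    proof (cases "fst p \<in> Y")
      case True
      have "?V p = ?V p'"
      proof (unfold wrd_eq_iff, intro allI impI)
        fix k assume k: "0 \<le> k \<and> k < int L"
        obtain i where i: "i < n" "\<bar>k - \<lfloor>frac (snd p) + real i * \<tau>\<rfloor>\<bar> \<le> int W0"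
        proof -
          have "0 \<le> \<lfloor>real n * \<tau>\<rfloor>" using tau_pos by simp
          then have "k < \<lfloor>real n * \<tau>\<rfloor>" using k unfolding L_def by simp
          then show ?thesis using windows_cover[of "frac (snd p)" k n] k frac_lt_1[of "snd p"] that by auto
        qed
        let ?j = "\<lfloor>frac (snd p) + real i * \<tau>\<rfloor>"
        have j: "?j = \<lfloor>frac (snd p') + real i * \<tau>\<rfloor>" using isum_determines[OF eq(1) i(1)] by simp
        have "win W0 (fst (base (tr (real i * \<tau>) p))) = win W0 (fst (base (tr (real i * \<tau>) p')))"
          using Fi[OF i(1)] True Y unfolding code_q by simp
        then have "win W0 (shiftn ?j (fst (base p))) = win W0 (shiftn ?j (fst (base p')))"
          unfolding base_tr using j by simp
        then have "shiftn ?j (fst (base p)) (k - ?j) = shiftn ?j (fst (base p')) (k - ?j)"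
          using i(2) unfolding win_eq_iff by blast
        then show "fst (base p) k = fst (base p') k" by (simp add: shiftn_apply)
      qed
      then show ?thesis using True Y by (simp add: V'_def)
    qed (use Y in \<open>simp add: V'_def\<close>)
  qed
  note sI = simple_isum[of 0 n] and sF = simple_nms[OF F, of n]
  have sIF: "simple_function N (\<lambda>p. (isum 0 n p, nms F n p))" by (rule simple_function_Pair[OF sI sF])
  have "\<exists>g. \<forall>p\<in>space N. V' p = g (isum 0 n p, nms F n p)"
    by (rule simple_function_determined[OF sIF]) (use det2 in blast)
  then obtain g where g: "\<And>p. V' p = g (isum 0 n p, nms F n p)" unfolding space_N by blast
  have "V' = (\<lambda>p. g (isum 0 n p, nms F n p))" by (rule ext) (rule g)
  then have sV': "simple_function N V'" using simple_function_comp2[OF sIF, of g] by (simp only:)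
  have "pr N V' w = pr N ?V w" for w
    unfolding pr_def using V'V simple_function_fiber[OF Vs] simple_function_fiber[OF sV']
    by (intro measure_eq_AE) auto
  then have "ent N V' = ent N ?V" by (intro ent_eq_law[OF P.prob_space_axioms P.prob_space_axioms sV' Vs])
  also have "\<dots> = ent \<mu> (wrd L)" using ent_base_wrd[of L 0] by simp
  finally have "ent \<mu> (wrd L) = ent N V'" by simp
  also have "\<dots> \<le> ent N (\<lambda>p. (isum 0 n p, nms F n p))"
    by (rule P.ent_mono[OF sIF]) (use det2 in blast)
  also have "\<dots> \<le> ent N (isum 0 n) + ent N (nms F n)" by (rule P.ent_subadditive[OF sI sF])
  also have "ent N (isum 0 n) \<le> ln (real n + 1)" using ent_isum[of 0 n] by simp
  finally show ?thesis unfolding L_def by simp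
qed

text \<open>Abramov's formula for a constant roof. Every finite partition obeys the upper bound, and
  the partition into fibres of \<open>code\<close> reaches it.\<close>

theorem measure_entropy_nu: "measure_entropy \<nu> (flow 1) = ereal (h * \<tau>)"
proof (rule antisym)
  show "measure_entropy \<nu> (flow 1) \<le> ereal (h * \<tau>)"
    unfolding measure_entropy_def
  proof (rule SUP_least)
    fix P assume "P \<in> {P. finite P \<and> partition_on (space \<nu>) P \<and> P \<subseteq> sets \<nu>}"
    then have P: "finite P" "partition_on (topspace Z) P" "P \<subseteq> sets (borel_of Z)" by simp_all
    let ?F = "\<lambda>p. label P (q p)"
    obtain l where l: "(\<lambda>n. ent N (nms ?F n) / real n) \<longlonglongrightarrow> l"
      using ent_nms_converges[OF partition_entropy_nu(1)[OF P]] by blast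
    have "lim (\<lambda>n. partition_entropy \<nu> (iter_join (space \<nu>) (flow 1) P n) / real n) = l"
      unfolding partition_entropy_nu(2)[OF P] using l by (rule limI)
    then show "ereal (lim (\<lambda>n. partition_entropy \<nu> (iter_join (space \<nu>) (flow 1) P n) / real n)) \<le> ereal (h * \<tau>)"
      using ent_nms_upper[OF partition_entropy_nu(1)[OF P] l] by simp
  qed
next
  define P where "P = (\<lambda>k. {z \<in> topspace Z. code z = k}) ` code ` topspace Z"
  have P: "finite P" "partition_on (topspace Z) P" "P \<subseteq> sets (borel_of Z)"
    using code_finite code_fiber by (auto simp: P_def partition_on_def disjoint_def)
  let ?F = "\<lambda>p. label P (q p)"
  have det: "code (q p) = code (q p')" if "?F p = ?F p'" for p p'
  proof -
    have "label P (q p) = {z \<in> topspace Z. code z = code (q p)}" for p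
      by (rule label_eq[OF P(2)]) (use qv_topspace in \<open>auto simp: P_def\<close>)
    then have "q p \<in> {z \<in> topspace Z. code z = code (q p')}"
      using that qv_topspace by (metis (mono_tags, lifting) mem_Collect_eq)
    then show ?thesis by simp
  qed
  obtain l where l: "(\<lambda>n. ent N (nms ?F n) / real n) \<longlonglongrightarrow> l"
    using ent_nms_converges[OF partition_entropy_nu(1)[OF P]] by blast
  have lim: "lim (\<lambda>n. partition_entropy \<nu> (iter_join (space \<nu>) (flow 1) P n) / real n) = l"
    unfolding partition_entropy_nu(2)[OF P] using l by (rule limI)
  have "h * \<tau> \<le> l + 0"
  proof (rule tendsto_le[OF sequentially_bot])
    show "(\<lambda>n. ent \<mu> (wrd (nat \<lfloor>real n * \<tau>\<rfloor>)) / real n) \<longlonglongrightarrow> h * \<tau>" using ent_wrd_scaled[of 0] by simp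
    have "(\<lambda>n. ln (real n + 1) / real n) \<longlonglongrightarrow> 0" by real_asymp
    then show "(\<lambda>n. ent N (nms ?F n) / real n + ln (real n + 1) / real n) \<longlonglongrightarrow> l + 0"
      by (intro tendsto_add l)
    show "\<forall>\<^sub>F n in sequentially. ent \<mu> (wrd (nat \<lfloor>real n * \<tau>\<rfloor>)) / real n \<le> ent N (nms ?F n) / real n + ln (real n + 1) / real n"
      using eventually_gt_at_top[of 0]
    proof eventually_elim
      case (elim n)
      have "ent \<mu> (wrd (nat \<lfloor>real n * \<tau>\<rfloor>)) \<le> ent N (nms ?F n) + ln (real n + 1)"
        by (rule ent_nms_code_lower[OF partition_entropy_nu(1)[OF P] det elim])
      then have "ent \<mu> (wrd (nat \<lfloor>real n * \<tau>\<rfloor>)) / real n \<le> (ent N (nms ?F n) + ln (real n + 1)) / real n"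
        by (intro divide_right_mono) auto
      then show ?case by (simp add: add_divide_distrib)
    qed
  qed
  then have "ereal (h * \<tau>) \<le> ereal (lim (\<lambda>n. partition_entropy \<nu> (iter_join (space \<nu>) (flow 1) P n) / real n))"
    unfolding lim by simp
  also have "\<dots> \<le> measure_entropy \<nu> (flow 1)"
    unfolding measure_entropy_def by (rule SUP_upper) (use P in simp)
  finally show "ereal (h * \<tau>) \<le> measure_entropy \<nu> (flow 1)" .
qed

end

section \<open>The skeleton of Ohno's sequence\<close>

lemma nth_append3:
  assumes "length A = l" "length B = l" "t < 3 * l"
  shows "(A @ B @ A) ! t = (if l \<le> t \<and> t < 2 * l then B else A) ! (t mod l)"
proof -
  consider "t < l" | "l \<le> t" "t < 2 * l" | "2 * l \<le> t" by linarith
  then show ?thesis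
  proof cases
    case 1
    then show ?thesis using assms by (simp add: nth_append)
  next
    case 2
    then have "t mod l = t - l" "t - l < l" by (simp_all add: le_mod_geq)
    then show ?thesis using 2 assms by (simp add: nth_append)
  next
    case 3
    define s where "s = t - 2 * l"
    have s: "t = 2 * l + s" "s < l" using 3 assms(3) by (simp_all add: s_def)
    then have "t mod l = s" by simp
    then show ?thesis using 3 s assms by (simp add: nth_append)
  qed
qed

section \<open>The odometer of block positions\<close>

definition period :: "nat \<Rightarrow> nat" where "period n = 2 * 3 ^ n"

lemma period_pos [simp]: "0 < period n"
  by (simp add: period_def)

lemma period_Suc: "period (Suc n) = 3 * period n"
  by (simp add: period_def)

text \<open>The offsets of a point of the odometer: \<open>relabel n\<close> reverses the order of the base-3 digits.\<close>

fun relabel :: "nat \<Rightarrow> nat \<Rightarrow> nat" where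
  "relabel 0 j = j"
| "relabel (Suc n) j = relabel n (j div 3) + period n * (j mod 3)"

lemma relabel_bij: "bij_betw (relabel n) {..<period n} {..<period n}"
proof (induction n)
  case 0
  show ?case by (simp add: bij_betw_def inj_on_def)
next
  case (Suc n)
  have maps: "relabel n k < period n" if "k < period n" for k using Suc that by (auto simp: bij_betw_def)
  have dv: "j div 3 < period n" if "j < period (Suc n)" for j using that by (simp add: period_Suc)
  have inj: "inj_on (relabel (Suc n)) {..<period (Suc n)}"
  proof (rule inj_onI)
    fix i j assume ij: "i \<in> {..<period (Suc n)}" "j \<in> {..<period (Suc n)}" "relabel (Suc n) i = relabel (Suc n) j"
    have lt: "relabel n (i div 3) < period n" "relabel n (j div 3) < period n" using ij dv maps by auto
    have "relabel (Suc n) i mod period n = relabel n (i div 3)" "relabel (Suc n) j mod period n = relabel n (j div 3)"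
      using lt by simp_all
    then have e: "relabel n (i div 3) = relabel n (j div 3)" using ij(3) by metis
    then have "i div 3 = j div 3" using Suc ij dv unfolding bij_betw_def inj_on_def by simp
    moreover have "i mod 3 = j mod 3" using ij(3) e period_pos[of n] by simp
    ultimately show "i = j" by (metis div_mult_mod_eq)
  qed
  have "relabel (Suc n) j < period (Suc n)" if "j < period (Suc n)" for j
  proof -
    have "j mod 3 \<le> 2" by simp
    then have "period n * (j mod 3) \<le> period n * 2" by (intro mult_left_mono) auto
    with maps[OF dv[OF that]] have "relabel n (j div 3) + period n * (j mod 3) < period n + period n * 2"
      by (rule add_less_le_mono)
    then show ?thesis by (simp add: period_Suc)
  qed
  then have "relabel (Suc n) ` {..<period (Suc n)} \<subseteq> {..<period (Suc n)}" by auto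
  then show ?case using inj by (metis bij_betw_def endo_inj_surj finite_lessThan)
qed

text \<open>Dividing the unit interval into \<open>period n\<close> equal parts adds a lowest digit
  at each level, while compatible positions in blocks, as in \<open>offset_Suc_mod\<close>, add a
  highest digit. Digit reversal turns one into the other, so a single uniform \<theta> provides all
  offsets at once.\<close>

definition offset :: "nat \<Rightarrow> real \<Rightarrow> nat" where
  "offset n \<theta> = relabel n (nat \<lfloor>real (period n) * frac \<theta>\<rfloor>)"

lemma floor_frac_less: "nat \<lfloor>real (period n) * frac \<theta>\<rfloor> < period n"
proof -
  have "real (period n) * frac \<theta> < real (period n) * 1"
    using frac_lt_1[of \<theta>] by (intro mult_strict_left_mono) auto
  then have "\<lfloor>real (period n) * frac \<theta>\<rfloor> < int (period n)" by (simp add: floor_less_iff)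
  then show ?thesis by (simp add: nat_less_iff)
qed

lemma offset_less: "offset n \<theta> < period n"
  using relabel_bij[of n] floor_frac_less[of n \<theta>] by (auto simp: offset_def bij_betw_def)

lemma offset_Suc_mod: "offset (Suc n) \<theta> mod period n = offset n \<theta>"
proof -
  have "real (period n) * frac \<theta> = real (period (Suc n)) * frac \<theta> / real_of_int 3"
    by (simp add: period_Suc)
  then have "\<lfloor>real (period n) * frac \<theta>\<rfloor> = \<lfloor>real (period (Suc n)) * frac \<theta>\<rfloor> div 3"
    by (simp only: floor_divide_real_eq_div zero_le_numeral)
  then have "nat \<lfloor>real (period n) * frac \<theta>\<rfloor> = nat \<lfloor>real (period (Suc n)) * frac \<theta>\<rfloor> div 3"
    by (simp add: nat_div_distrib)
  then show ?thesis using offset_less[of n \<theta>] by (simp add: offset_def)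
qed

lemma offset_measurable: "{\<theta>. offset n \<theta> = r} \<in> sets borel"
proof -
  have "(\<lambda>\<theta>. real (period n) * frac \<theta>) \<in> borel_measurable borel" unfolding frac_def by measurable
  then have "(\<lambda>\<theta>. offset n \<theta>) \<in> measurable borel (count_space UNIV)" unfolding offset_def by measurable
  from measurable_sets[OF this, of "{r}"] show ?thesis by (simp add: vimage_def)
qed

text \<open>As \<open>relabel n\<close> is a bijection, each offset belongs to exactly one of the
  \<open>period n\<close> intervals of equal length.\<close>

lemma offset_uniform:
  assumes r: "r < period n" shows "measure unif01 {\<theta>. offset n \<theta> = r} = 1 / real (period n)"
proof -
  have "r \<in> relabel n ` {..<period n}" using bij_betw_imp_surj_on[OF relabel_bij[of n]] r by simp
  then obtain j where j: "j < period n" "relabel n j = r" by blast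
  let ?m = "real (period n)"
  have "\<theta> \<in> {0..<1} \<inter> {\<theta>. offset n \<theta> = r} \<longleftrightarrow> \<theta> \<in> {real j / ?m..<(real j + 1) / ?m}" for \<theta>
  proof -
    have "offset n \<theta> = r \<longleftrightarrow> nat \<lfloor>?m * frac \<theta>\<rfloor> = j"
      using relabel_bij[of n] j floor_frac_less[of n \<theta>] unfolding offset_def bij_betw_def inj_on_def by (metis lessThan_iff)
    also have "\<dots> \<longleftrightarrow> \<lfloor>?m * frac \<theta>\<rfloor> = int j" by (simp add: nat_eq_iff)
    also have "\<dots> \<longleftrightarrow> real j \<le> ?m * frac \<theta> \<and> ?m * frac \<theta> < real j + 1" by (simp add: floor_eq_iff)
    also have "\<dots> \<longleftrightarrow> frac \<theta> \<in> {real j / ?m..<(real j + 1) / ?m}" by (simp add: field_simps)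
    finally have e: "offset n \<theta> = r \<longleftrightarrow> frac \<theta> \<in> {real j / ?m..<(real j + 1) / ?m}" .
    show ?thesis
    proof (cases "\<theta> \<in> {0..<1}")
      case True
      then have "frac \<theta> = \<theta>" by (simp add: frac_eq)
      then show ?thesis using e True by simp
    next
      case False
      have "real j + 1 \<le> ?m" using j(1) by linarith
      then have "(real j + 1) / ?m \<le> 1" by (simp add: field_simps)
      then have "\<theta> \<notin> {real j / ?m..<(real j + 1) / ?m}" using False
        by (metis atLeastLessThan_iff divide_nonneg_nonneg of_nat_0_le_iff order.strict_trans2 order_trans)
      then show ?thesis using False by blast
    qed
  qed
  then have "{0..<1} \<inter> {\<theta>. offset n \<theta> = r} = {real j / ?m..<(real j + 1) / ?m}" by blast
  moreover have "real j / ?m \<le> (real j + 1) / ?m" by (intro divide_right_mono) auto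
  ultimately have "measure unif01 {\<theta>. offset n \<theta> = r} = (real j + 1) / ?m - real j / ?m"
    unfolding unif01_def using offset_measurable[of n r] by (subst measure_uniform_measure) auto
  then show ?thesis by (simp add: diff_divide_distrib[symmetric])
qed

text \<open>The words are numbered from 0 here: \<open>W n\<close> is the word of index n + 1, of
  length \<open>period n\<close>.\<close>

locale ohno_skeleton =
  fixes W W' :: "nat \<Rightarrow> symbol list"
  assumes W_0: "W 0 = [sym_one, placeholder]"
    and W_Suc: "W (Suc n) = W n @ W' n @ W n"
    and W'_W: "\<exists>i<length (W n). W n ! i = placeholder \<and> W' n = (W n)[i := sym_one]"
begin

lemma length_W': "length (W' n) = length (W n)"
  using W'_W[of n] by auto

lemma length_W: "length (W n) = period n"
  by (induction n) (simp_all add: W_0 W_Suc length_W' period_def)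

lemma W_symbols: "set (W n) \<subseteq> {placeholder, sym_one}"
proof (induction n)
  case (Suc n)
  obtain i where "W' n = (W n)[i := sym_one]" using W'_W[of n] by blast
  then have "set (W' n) \<subseteq> insert sym_one (set (W n))" by (simp add: set_update_subset_insert)
  then have "set (W' n) \<subseteq> {placeholder, sym_one}" using Suc by blast
  then show ?case using Suc by (simp add: W_Suc)
qed (simp add: W_0)

lemma W_nth: "k < period n \<Longrightarrow> W n ! k \<noteq> placeholder \<Longrightarrow> W n ! k = sym_one"
proof -
  assume "k < period n" "W n ! k \<noteq> placeholder"
  moreover from this have "W n ! k \<in> {placeholder, sym_one}" using W_symbols[of n] nth_mem[of k "W n"] by (metis length_W subsetD)
  ultimately show "W n ! k = sym_one" by (metis insertE singletonD)
qed

text \<open>Placeholders of the bi-infinite periodic repetition of \<open>W n\<close>.\<close>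

definition hole :: "nat \<Rightarrow> int \<Rightarrow> bool" where
  "hole n j \<longleftrightarrow> W n ! nat (j mod int (period n)) = placeholder"

lemma hole_mod: "i mod int (period n) = j mod int (period n) \<Longrightarrow> hole n i = hole n j"
  by (simp add: hole_def)

text \<open>Each third of \<open>W (Suc n)\<close> is \<open>W n\<close>, possibly with one
  placeholder replaced, so passing to a higher level can only remove holes.\<close>

lemma hole_Suc: "hole (Suc n) j \<Longrightarrow> hole n j"
proof -
  assume h: "hole (Suc n) j"
  define t where "t = nat (j mod int (period (Suc n)))"
  have t: "int t = j mod int (period (Suc n))" unfolding t_def by simp
  have t3: "t < 3 * period n" 
  proof -
    have "int t < int (period (Suc n))" unfolding t by (rule pos_mod_bound) simp
    then show ?thesis by (simp add: period_Suc)
  qed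
  have "int (t mod period n) = j mod int (period (Suc n)) mod int (period n)" using t by (simp add: zmod_int)
  also have "\<dots> = j mod int (period n)" by (rule mod_mod_cancel) (simp add: period_Suc)
  finally have tm: "t mod period n = nat (j mod int (period n))" by linarith
  obtain i where i: "i < length (W n)" "W' n = (W n)[i := sym_one]" using W'_W by blast
  have "W (Suc n) ! t = placeholder" using h by (simp add: hole_def t_def)
  then have "(if period n \<le> t \<and> t < 2 * period n then W' n else W n) ! (t mod period n) = placeholder"
    unfolding W_Suc using nth_append3[of "W n" "period n" "W' n" t] t3 by (simp add: length_W length_W')
  then have "W n ! (t mod period n) = placeholder"
    using i by (cases "t mod period n = i") (auto split: if_splits simp: length_W)
  then show ?thesis by (simp add: hole_def tm)
qed

definition num_holes :: "nat \<Rightarrow> nat" where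
  "num_holes n = card {r. r < period n \<and> hole n (int r)}"

lemma num_holes_filter: "num_holes n = length (filter (\<lambda>s. s = placeholder) (W n))"
  unfolding num_holes_def length_filter_conv_card length_W hole_def
  by (intro arg_cong[where f = card] Collect_cong) (auto simp: zmod_int[symmetric])

text \<open>Only the middle block loses a hole, and exactly one: the count a(n) satisfies a(n + 1) =
  3 a(n) - 1 with a(0) = 1.\<close>

lemma num_holes_eq: "2 * num_holes n = 3 ^ n + 1"
proof (induction n)
  case 0
  then show ?case by (simp add: num_holes_filter W_0)
next
  case (Suc n)
  obtain i where i: "i < length (W n)" "W n ! i = placeholder" "W' n = (W n)[i := sym_one]" using W'_W by blast
  have "{k. k < length (W' n) \<and> W' n ! k = placeholder} = {k. k < length (W n) \<and> W n ! k = placeholder} - {i}"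
    using i by (auto simp: nth_list_update)
  then have "length (filter (\<lambda>s. s = placeholder) (W' n)) = num_holes n - 1"
    using i unfolding num_holes_filter length_filter_conv_card by (simp add: card_Diff_singleton)
  moreover have "0 < num_holes n" using Suc by (cases "num_holes n") auto
  ultimately have "num_holes (Suc n) = 3 * num_holes n - 1"
    unfolding num_holes_filter[of "Suc n"] W_Suc by (simp add: num_holes_filter[symmetric])
  then show ?case using Suc \<open>0 < num_holes n\<close> by simp
qed

text \<open>The limit 1/4 is the origin of the entropy bound \<open>ln 2 / 4\<close>, the remainder
  that of the geometric error terms.\<close>

lemma density: "real (num_holes n) / real (period n) = 1 / 4 + 1 / (4 * 3 ^ n)"
proof -
  have "real (2 * num_holes n) = real (3 ^ n + 1)" using num_holes_eq[of n] by simp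
  then have "real (num_holes n) = (3 ^ n + 1) / 2" by simp
  then show ?thesis by (simp add: period_def field_simps)
qed

lemma sum_periodic:
  fixes f :: "int \<Rightarrow> real"
  assumes "\<And>i j. i mod int (period n) = j mod int (period n) \<Longrightarrow> f i = f j"
  shows "(\<Sum>r<period n. f (int r + k)) = (\<Sum>r<period n. f (int r))"
proof -
  let ?m = "int (period n)"
  let ?g = "\<lambda>r. nat ((int r + k) mod ?m)"
  have inj: "inj_on ?g {..<period n}"
  proof (rule inj_onI)
    fix r s assume rs: "r \<in> {..<period n}" "s \<in> {..<period n}" "?g r = ?g s"
    then have "(int r + k) mod ?m = (int s + k) mod ?m"
      by (metis eq_nat_nat_iff of_nat_0_less_iff period_pos pos_mod_sign)
    then have "(int r + k - k) mod ?m = (int s + k - k) mod ?m" by (metis mod_diff_cong)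
    then show "r = s" using rs by (simp add: zmod_int[symmetric])
  qed
  have "?g r < period n" for r
    using pos_mod_bound[of ?m "int r + k"] pos_mod_sign[of ?m "int r + k"] by (simp add: nat_less_iff)
  then have im: "?g ` {..<period n} = {..<period n}"
    using endo_inj_surj[OF _ _ inj] by auto
  have "(\<Sum>r<period n. f (int r)) = (\<Sum>r\<in>?g ` {..<period n}. f (int r))" using im by simp
  also have "\<dots> = (\<Sum>r<period n. f (int (?g r)))" by (rule sum.reindex[OF inj, unfolded comp_def])
  also have "\<dots> = (\<Sum>r<period n. f (int r + k))"
    by (intro sum.cong refl assms) simp
  finally show ?thesis by simp
qed

end

section \<open>Filling the holes with fair coins\<close>

lemma measurable_config:
  fixes f :: "'a \<Rightarrow> config"
  assumes "\<And>i. {\<omega> \<in> space M. f \<omega> i} \<in> sets M"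
  shows "f \<in> borel_measurable M"
proof (rule measurable_coordinatewise_then_product)
  fix i
  have "(\<lambda>\<omega>. f \<omega> i) \<in> measurable M (count_space UNIV)"
    using assms[of i] unfolding pred_def .
  moreover have "sets (borel :: bool measure) = sets (count_space UNIV)" by (simp add: sets_borel_eq_count_space)
  ultimately show "(\<lambda>\<omega>. f \<omega> i) \<in> borel_measurable M" using measurable_cong_sets by blast
qed

definition coins :: "(int \<Rightarrow> bool) measure" where
  "coins = PiM UNIV (\<lambda>_. measure_pmf (bernoulli_pmf (1/2)))"

lemma space_coins [simp]: "space coins = UNIV"
  by (simp add: coins_def space_PiM PiE_UNIV_domain)

lemma coin_measurable [measurable]: "(\<lambda>\<beta>. \<beta> i) \<in> measurable coins (count_space UNIV)"
proof -
  have "(\<lambda>\<beta>. \<beta> i) \<in> measurable coins (measure_pmf (bernoulli_pmf (1/2)))"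
    unfolding coins_def by (rule measurable_component_singleton) simp
  then show ?thesis by simp
qed

text \<open>Probability that a filled position shows \<open>b\<close>: a fair coin at a hole, and a
  certain 1 elsewhere, 1 being the only other symbol of \<open>W n\<close>.\<close>

definition wt :: "bool \<Rightarrow> bool \<Rightarrow> real" where
  "wt h b = (if h then 1 / 2 else if b then 1 else 0)"

interpretation coins_pps: product_prob_space "\<lambda>_::int. measure_pmf (bernoulli_pmf (1/2))" UNIV
  by unfold_locales

lemma prob_space_coins: "prob_space coins"
  unfolding coins_def by (rule coins_pps.prob_space_axioms)

text \<open>\<open>h i \<longrightarrow> \<beta> i\<close> is the filled symbol: the coin at a hole,
  1 elsewhere. Independence of the coins gives the product.\<close>

lemma emeasure_coins:
  assumes "finite J"
  shows "emeasure coins {\<beta>. \<forall>i\<in>J. (h i \<longrightarrow> \<beta> i) = s i} = ennreal (\<Prod>i\<in>J. wt (h i) (s i))"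
proof -
  have "emeasure coins {\<beta> \<in> space coins. \<forall>i\<in>J. \<beta> i \<in> {b. (h i \<longrightarrow> b) = s i}}
      = (\<Prod>i\<in>J. emeasure (measure_pmf (bernoulli_pmf (1/2))) {b. (h i \<longrightarrow> b) = s i})"
    unfolding coins_def using assms by (intro coins_pps.emeasure_PiM_Collect) auto
  also have "\<dots> = (\<Prod>i\<in>J. ennreal (wt (h i) (s i)))"
  proof (intro prod.cong refl)
    fix i
    show "emeasure (measure_pmf (bernoulli_pmf (1/2))) {b. (h i \<longrightarrow> b) = s i} = ennreal (wt (h i) (s i))"
    proof (cases "h i")
      case True
      then have "{b. (h i \<longrightarrow> b) = s i} = {s i}" by auto
      then show ?thesis using True by (cases "s i") (simp_all add: emeasure_pmf_single wt_def)
    next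
      case False
      then have "{b. (h i \<longrightarrow> b) = s i} = (if s i then UNIV else {})" by auto
      then show ?thesis using False measure_pmf.emeasure_space_1[of "bernoulli_pmf (1/2)"] by (simp add: wt_def)
    qed
  qed
  also have "\<dots> = ennreal (\<Prod>i\<in>J. wt (h i) (s i))" by (intro prod_ennreal) (simp add: wt_def)
  finally show ?thesis by simp
qed

definition Om :: "(real \<times> (int \<Rightarrow> bool)) measure" where
  "Om = unif01 \<Otimes>\<^sub>M coins"

lemma space_Om [simp]: "space Om = UNIV"
  by (simp add: Om_def space_pair_measure)

lemma prob_space_Om: "prob_space Om"
proof -
  interpret U: prob_space unif01 by (rule prob_space_unif01)
  interpret C: prob_space coins by (rule prob_space_coins)
  interpret P: pair_prob_space unif01 coins ..
  show ?thesis unfolding Om_def by (rule P.prob_space_axioms)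
qed

interpretation Om: prob_space Om by (rule prob_space_Om)

lemma emeasure_Om_Times:
  assumes "A \<in> sets borel" "B \<in> sets coins"
  shows "emeasure Om (A \<times> B) = emeasure unif01 A * emeasure coins B"
proof -
  interpret C: prob_space coins by (rule prob_space_coins)
  show ?thesis unfolding Om_def using assms by (intro C.emeasure_pair_measure_Times) simp_all
qed

lemma offset_Om [measurable]: "(\<lambda>\<omega>. offset n (fst \<omega>)) \<in> measurable Om (count_space UNIV)"
proof -
  have "offset n \<in> measurable unif01 (count_space UNIV)"
  proof (rule measurable_count_space_eq2_countable[THEN iffD2])
    show "offset n \<in> space unif01 \<rightarrow> UNIV \<and> (\<forall>a\<in>UNIV. offset n -` {a} \<inter> space unif01 \<in> sets unif01)"
      using offset_measurable[of n] by (simp add: vimage_def)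
  qed
  then show ?thesis unfolding Om_def by measurable
qed

lemma coin_Om [measurable]: "(\<lambda>\<omega>. snd \<omega> i) \<in> measurable Om (count_space UNIV)"
  unfolding Om_def by measurable

section \<open>Events that depend on finitely many coordinates\<close>

definition determined_on :: "int set \<Rightarrow> config set \<Rightarrow> bool" where
  "determined_on J E \<longleftrightarrow> finite J \<and> (\<forall>x y. (\<forall>i\<in>J. x i = y i) \<longrightarrow> (x \<in> E \<longleftrightarrow> y \<in> E))"

text \<open>One representative for each pattern on \<open>J\<close> that occurs in \<open>E\<close>,
  namely the one that is 0 off \<open>J\<close>; for \<open>E\<close> determined on \<open>J\<close>
  these index a partition of \<open>E\<close> into cylinders.\<close>

definition reps :: "int set \<Rightarrow> config set \<Rightarrow> config set" where
  "reps J E = {s \<in> E. \<forall>i. i \<notin> J \<longrightarrow> \<not> s i}"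

lemma finite_reps: "finite J \<Longrightarrow> finite (reps J E)"
proof -
  assume J: "finite J"
  have "inj_on (\<lambda>s. {i. s i}) (reps J E)" by (rule inj_onI) (auto simp: fun_eq_iff)
  moreover have "(\<lambda>s. {i. s i}) ` reps J E \<subseteq> Pow J" by (auto simp: reps_def)
  ultimately show ?thesis using J by (metis finite_Pow_iff finite_subset finite_imageD)
qed

lemma reps_unique:
  assumes "determined_on J E"
  shows "x \<in> E \<longleftrightarrow> (\<exists>!s. s \<in> reps J E \<and> (\<forall>i\<in>J. x i = s i))"
proof
  assume x: "x \<in> E"
  let ?s = "\<lambda>i. i \<in> J \<and> x i"
  have "?s \<in> E" using assms x unfolding determined_on_def by (metis (mono_tags, lifting))
  then have "?s \<in> reps J E" by (simp add: reps_def)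
  then show "\<exists>!s. s \<in> reps J E \<and> (\<forall>i\<in>J. x i = s i)"
  proof (intro ex1I[of _ ?s] conjI)
    fix t assume t: "t \<in> reps J E \<and> (\<forall>i\<in>J. x i = t i)"
    show "t = ?s" using t by (auto simp: reps_def fun_eq_iff)
  qed auto
next
  assume "\<exists>!s. s \<in> reps J E \<and> (\<forall>i\<in>J. x i = s i)"
  then obtain s where "s \<in> E" "\<forall>i\<in>J. x i = s i" by (auto simp: reps_def)
  then show "x \<in> E" using assms unfolding determined_on_def by blast
qed

lemma determined_on_borel: "determined_on J E \<Longrightarrow> E \<in> sets borel"
proof -
  assume d: "determined_on J E"
  then have J: "finite J" by (simp add: determined_on_def)
  have "E = (\<Union>s\<in>reps J E. \<Inter>i\<in>J. {x. x i = s i})"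
  proof (intro set_eqI)
    fix x show "x \<in> E \<longleftrightarrow> x \<in> (\<Union>s\<in>reps J E. \<Inter>i\<in>J. {x. x i = s i})"
    proof
      assume "x \<in> E"
      then show "x \<in> (\<Union>s\<in>reps J E. \<Inter>i\<in>J. {x. x i = s i})" using reps_unique[OF d, of x] by auto
    next
      assume "x \<in> (\<Union>s\<in>reps J E. \<Inter>i\<in>J. {x. x i = s i})"
      then obtain s where "s \<in> E" "\<forall>i\<in>J. x i = s i" by (auto simp: reps_def)
      then show "x \<in> E" using d unfolding determined_on_def by blast
    qed
  qed
  moreover have "open (\<Union>s\<in>reps J E. \<Inter>i\<in>J. {x. x i = s i})"
    using J by (intro open_UN open_INT ballI clopen_coordinate)
  ultimately show ?thesis by (metis borel_open)
qed

context ohno_skeleton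
begin

text \<open>The law of \<open>pin n\<close> is computable from one period of \<open>W n\<close>, but
  it may show a 0 at a placeholder that a later level turns into 1. \<open>pil\<close> tosses coins
  only at holes common to all levels.\<close>

definition pin :: "nat \<Rightarrow> real \<times> (int \<Rightarrow> bool) \<Rightarrow> config" where
  "pin n \<omega> = (\<lambda>i. hole n (int (offset n (fst \<omega>)) + i) \<longrightarrow> snd \<omega> i)"

definition pil :: "real \<times> (int \<Rightarrow> bool) \<Rightarrow> config" where
  "pil \<omega> = (\<lambda>i. (\<forall>n. hole n (int (offset n (fst \<omega>)) + i)) \<longrightarrow> snd \<omega> i)"

lemma hole_event [measurable]: "Measurable.pred Om (\<lambda>\<omega>. hole n (int (offset n (fst \<omega>)) + i))"
  by measurable

lemma measurable_pin [measurable]: "pin n \<in> borel_measurable Om"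
  by (rule measurable_config) (unfold pin_def, measurable)

lemma measurable_pil [measurable]: "pil \<in> borel_measurable Om"
  by (rule measurable_config) (unfold pil_def, measurable)

lemma event_pin: "E \<in> sets borel \<Longrightarrow> {\<omega>. pin n \<omega> \<in> E} \<in> sets Om"
  using measurable_sets[OF measurable_pin, of E n] by (simp add: vimage_def)

lemma event_pil: "E \<in> sets borel \<Longrightarrow> {\<omega>. pil \<omega> \<in> E} \<in> sets Om"
  using measurable_sets[OF measurable_pil, of E] by (simp add: vimage_def)

text \<open>The conditional probability, given the offset \<open>r\<close>, that
  \<open>pin n\<close> shows the pattern \<open>s\<close> on \<open>J\<close>.\<close>

definition G :: "nat \<Rightarrow> int \<Rightarrow> int set \<Rightarrow> config \<Rightarrow> real" where
  "G n r J s = (\<Prod>i\<in>J. wt (hole n (r + i)) (s i))"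

lemma G_nonneg: "0 \<le> G n r J s"
  unfolding G_def by (intro prod_nonneg) (simp add: wt_def)

lemma G_mod: "r mod int (period n) = r' mod int (period n) \<Longrightarrow> G n r J s = G n r' J s"
  unfolding G_def by (intro prod.cong refl arg_cong2[where f = wt] hole_mod) (metis mod_add_cong)

lemma prob_offset_cyl:
  assumes J: "finite J" and r: "r < period n"
  shows "measure Om {\<omega>. offset n (fst \<omega>) = r \<and> (\<forall>i\<in>J. pin n \<omega> i = s i)} = G n (int r) J s / real (period n)"
proof -
  let ?A = "{\<theta>. offset n \<theta> = r}" and ?B = "{\<beta>. \<forall>i\<in>J. (hole n (int r + i) \<longrightarrow> \<beta> i) = s i}"
  have eq: "{\<omega>. offset n (fst \<omega>) = r \<and> (\<forall>i\<in>J. pin n \<omega> i = s i)} = ?A \<times> ?B"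
  proof (rule set_eqI)
    fix \<omega> :: "real \<times> (int \<Rightarrow> bool)"
    show "\<omega> \<in> {\<omega>. offset n (fst \<omega>) = r \<and> (\<forall>i\<in>J. pin n \<omega> i = s i)} \<longleftrightarrow> \<omega> \<in> ?A \<times> ?B"
      unfolding mem_Times_iff mem_Collect_eq pin_def by (rule conj_cong) (rule refl, simp only:)
  qed
  have B: "?B \<in> sets coins"
  proof -
    have "{\<beta> \<in> space coins. (hole n (int r + i) \<longrightarrow> \<beta> i) = s i} \<in> sets coins" for i
      using measurable_sets[OF coin_measurable, of "{b. (hole n (int r + i) \<longrightarrow> b) = s i}" i] by (simp add: vimage_def)
    then have "{\<beta> \<in> space coins. \<forall>i\<in>J. (hole n (int r + i) \<longrightarrow> \<beta> i) = s i} \<in> sets coins"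
      using J by (intro sets.sets_Collect_finite_All)
    then show ?thesis by (simp only: space_coins UNIV_I simp_thms)
  qed
  have o: "?A \<in> sets borel" by (rule offset_measurable)
  have m: "measure unif01 ?A = 1 / real (period n)" using offset_uniform[OF r] .
  have c: "emeasure coins ?B = ennreal (G n (int r) J s)" unfolding G_def by (rule emeasure_coins[OF J])
  have "measure Om (?A \<times> ?B) = measure unif01 ?A * measure coins ?B"
    by (simp only: measure_def emeasure_Om_Times[OF o B] enn2real_mult)
  also have "measure coins ?B = G n (int r) J s"
    unfolding measure_def c by (rule enn2real_ennreal[OF G_nonneg])
  finally show ?thesis unfolding eq m by simp
qed

lemma prob_cyl:
  assumes J: "finite J"
  shows "measure Om {\<omega>. \<forall>i\<in>J. pin n \<omega> i = s i} = (\<Sum>r<period n. G n (int r) J s) / real (period n)"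
proof -
  let ?C = "\<lambda>r. {\<omega>. offset n (fst \<omega>) = r \<and> (\<forall>i\<in>J. pin n \<omega> i = s i)}"
  have meas: "?C r \<in> sets Om" for r
  proof -
    have "Measurable.pred Om (\<lambda>\<omega>. offset n (fst \<omega>) = r \<and> (\<forall>i\<in>J. pin n \<omega> i = s i))"
      using J unfolding pin_def by measurable
    then show ?thesis by (simp add: pred_def)
  qed
  have "{\<omega>. \<forall>i\<in>J. pin n \<omega> i = s i} = (\<Union>r<period n. ?C r)" using offset_less by auto
  moreover have "measure Om (\<Union>r<period n. ?C r) = (\<Sum>r<period n. measure Om (?C r))"
    using meas by (intro Om.finite_measure_finite_Union) (auto simp: disjoint_family_on_def)
  ultimately show ?thesis using prob_offset_cyl[OF J] by (simp add: sum_divide_distrib)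
qed

text \<open>For \<open>E\<close> determined on \<open>J\<close>, the conditional probability given
  the offset \<open>r\<close> that \<open>pin n\<close> lies in \<open>E\<close>; as a function of
  \<open>r\<close> it has period \<open>period n\<close>.\<close>

definition b :: "nat \<Rightarrow> int set \<Rightarrow> config set \<Rightarrow> int \<Rightarrow> real" where
  "b n J E r = (\<Sum>s\<in>reps J E. G n r J s)"

lemma b_mod: "r mod int (period n) = r' mod int (period n) \<Longrightarrow> b n J E r = b n J E r'"
  unfolding b_def by (intro sum.cong refl G_mod)

lemma determined_on_coords: "finite J \<Longrightarrow> {\<omega>. \<forall>i\<in>J. pin n \<omega> i = s i} \<in> sets Om"
proof -
  assume "finite J"
  then have "Measurable.pred Om (\<lambda>\<omega>. \<forall>i\<in>J. pin n \<omega> i = s i)" unfolding pin_def by measurable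
  then show ?thesis by (simp add: pred_def)
qed

text \<open>Independence of the coins at the coordinates in \<open>I\<close> and \<open>J + k\<close>, given the offset.\<close>

lemma prob_pair:
  assumes A: "determined_on I A" and B: "determined_on J B" and disj: "I \<inter> (\<lambda>i. i + k) ` J = {}"
  shows "measure Om {\<omega>. pin n \<omega> \<in> A \<and> shiftn k (pin n \<omega>) \<in> B}
    = (\<Sum>r<period n. b n I A (int r) * b n J B (int r + k)) / real (period n)"
proof -
  have fin: "finite I" "finite J" using A B by (auto simp: determined_on_def)
  let ?J' = "(\<lambda>i. i + k) ` J"
  let ?S = "reps I A \<times> reps J B"
  \<comment> \<open>Glues a pattern on \<open>I\<close> and one on \<open>J\<close> moved by
    \<open>k\<close>; disjointness of the two sets makes this consistent.\<close>
  let ?t = "\<lambda>(s, s') i. if i \<in> I then s i else s' (i - k)"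
  let ?C = "\<lambda>p. {\<omega>. \<forall>i\<in>I \<union> ?J'. pin n \<omega> i = ?t p i}"
  have C_iff: "\<omega> \<in> ?C (s, s') \<longleftrightarrow> (\<forall>i\<in>I. pin n \<omega> i = s i) \<and> (\<forall>i\<in>J. shiftn k (pin n \<omega>) i = s' i)" for \<omega> s s'
  proof -
    have "j + k \<notin> I" if "j \<in> J" for j using disj that by blast
    then show ?thesis by (auto simp: shiftn_apply)
  qed
  have "{\<omega>. pin n \<omega> \<in> A \<and> shiftn k (pin n \<omega>) \<in> B} = (\<Union>p\<in>?S. ?C p)"
  proof (intro set_eqI iffI)
    fix \<omega> assume "\<omega> \<in> {\<omega>. pin n \<omega> \<in> A \<and> shiftn k (pin n \<omega>) \<in> B}"
    then obtain s s' where "s \<in> reps I A" "\<forall>i\<in>I. pin n \<omega> i = s i" "s' \<in> reps J B" "\<forall>i\<in>J. shiftn k (pin n \<omega>) i = s' i"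
      using reps_unique[OF A] reps_unique[OF B] by auto
    then have "(s, s') \<in> ?S" "\<omega> \<in> ?C (s, s')" unfolding C_iff by auto
    then show "\<omega> \<in> (\<Union>p\<in>?S. ?C p)" by blast
  next
    fix \<omega> assume "\<omega> \<in> (\<Union>p\<in>?S. ?C p)"
    then obtain s s' where s: "s \<in> reps I A" "s' \<in> reps J B" "\<omega> \<in> ?C (s, s')" by auto
    then have "\<forall>i\<in>I. pin n \<omega> i = s i" "\<forall>i\<in>J. shiftn k (pin n \<omega>) i = s' i" unfolding C_iff by auto
    moreover have "s \<in> A" "s' \<in> B" using s by (auto simp: reps_def)
    ultimately show "\<omega> \<in> {\<omega>. pin n \<omega> \<in> A \<and> shiftn k (pin n \<omega>) \<in> B}"
      using A B unfolding determined_on_def by blast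
  qed
  moreover have "measure Om (\<Union>p\<in>?S. ?C p) = (\<Sum>p\<in>?S. measure Om (?C p))"
  proof (rule Om.finite_measure_finite_Union)
    show "finite ?S" using fin finite_reps by blast
    show "?C ` ?S \<subseteq> sets Om" by (intro image_subsetI determined_on_coords finite_UnI finite_imageI fin)
    show "disjoint_family_on ?C ?S"
      unfolding disjoint_family_on_def
    proof (intro ballI impI)
      fix p p' assume p: "p \<in> ?S" "p' \<in> ?S" "p \<noteq> p'"
      obtain s1 s2 t1 t2 where st: "p = (s1, s2)" "p' = (t1, t2)" by (metis prod.exhaust)
      have "p = p'" if "\<omega> \<in> ?C p" "\<omega> \<in> ?C p'" for \<omega>
      proof -
        have eq: "\<forall>i\<in>I. s1 i = t1 i" "\<forall>i\<in>J. s2 i = t2 i" using that unfolding st C_iff by simp_all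
        have z: "\<And>i. i \<notin> I \<Longrightarrow> \<not> s1 i \<and> \<not> t1 i" "\<And>i. i \<notin> J \<Longrightarrow> \<not> s2 i \<and> \<not> t2 i"
          using p(1,2) unfolding st reps_def by auto
        have "s1 = t1" by (rule ext) (use eq(1) z(1) in blast)
        moreover have "s2 = t2" by (rule ext) (use eq(2) z(2) in blast)
        ultimately show ?thesis by (simp add: st)
      qed
      then show "?C p \<inter> ?C p' = {}" using p(3) by blast
    qed
  qed
  moreover have "measure Om (?C p) = (\<Sum>r<period n. G n (int r) I (fst p) * G n (int r + k) J (snd p)) / real (period n)" if "p \<in> ?S" for p
  proof -
    obtain s s' where p: "p = (s, s')" by force
    have "G n r (I \<union> ?J') (?t p) = G n r I s * G n (r + k) J s'" for r
    proof -
      have "G n r (I \<union> ?J') (?t p) = (\<Prod>i\<in>I. wt (hole n (r + i)) (?t p i)) * (\<Prod>i\<in>?J'. wt (hole n (r + i)) (?t p i))"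
        unfolding G_def using fin disj by (intro prod.union_disjoint) auto
      also have "(\<Prod>i\<in>I. wt (hole n (r + i)) (?t p i)) = G n r I s"
        unfolding G_def p by (intro prod.cong) auto
      also have "(\<Prod>i\<in>?J'. wt (hole n (r + i)) (?t p i)) = (\<Prod>j\<in>J. wt (hole n (r + (j + k))) (?t p (j + k)))"
        by (subst prod.reindex) (auto simp: inj_on_def)
      also have "\<dots> = G n (r + k) J s'"
        unfolding G_def p using disj by (intro prod.cong) (auto simp: algebra_simps)
      finally show ?thesis .
    qed
    then show ?thesis using prob_cyl[of "I \<union> ?J'" n "?t p"] fin p by simp
  qed
  ultimately have "measure Om {\<omega>. pin n \<omega> \<in> A \<and> shiftn k (pin n \<omega>) \<in> B}
      = (\<Sum>p\<in>?S. (\<Sum>r<period n. G n (int r) I (fst p) * G n (int r + k) J (snd p)) / real (period n))" by simp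
  also have "\<dots> = (\<Sum>r<period n. \<Sum>p\<in>?S. G n (int r) I (fst p) * G n (int r + k) J (snd p)) / real (period n)"
    by (subst sum.swap) (simp add: sum_divide_distrib)
  also have "\<dots> = (\<Sum>r<period n. b n I A (int r) * b n J B (int r + k)) / real (period n)"
    unfolding b_def sum_product sum.cartesian_product by (simp add: split_beta)
  finally show ?thesis .
qed

text \<open>\<open>prob_pair\<close> with the sure event as first factor. The shift by
  \<open>k\<close> then merely permutes the residues of the offset, so the law of
  \<open>pin n\<close> is shift invariant.\<close>

lemma prob_shifted:
  assumes B: "determined_on J B"
  shows "measure Om {\<omega>. shiftn k (pin n \<omega>) \<in> B} = (\<Sum>r<period n. b n J B (int r)) / real (period n)"
proof -
  have U: "determined_on {} (UNIV :: config set)" by (simp add: determined_on_def)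
  have "reps {} UNIV = {\<lambda>_. False}" by (auto simp: reps_def fun_eq_iff)
  then have "b n {} UNIV r = 1" for r by (simp add: b_def G_def)
  then have "measure Om {\<omega>. shiftn k (pin n \<omega>) \<in> B} = (\<Sum>r<period n. b n J B (int r + k)) / real (period n)"
    using prob_pair[OF U B, of k n] by simp
  also have "(\<Sum>r<period n. b n J B (int r + k)) = (\<Sum>r<period n. b n J B (int r))"
    by (rule sum_periodic) (rule b_mod)
  finally show ?thesis .
qed

lemma prob_hole: "measure Om {\<omega>. hole n (int (offset n (fst \<omega>)) + i)} = 1 / 4 + 1 / (4 * 3 ^ n)"
proof -
  let ?h = "\<lambda>j. of_bool (hole n j) :: real"
  have "{\<omega>. hole n (int (offset n (fst \<omega>)) + i)} = (\<Union>r\<in>{r. r < period n \<and> hole n (int r + i)}. {\<omega>. offset n (fst \<omega>) = r \<and> (\<forall>i\<in>{}. pin n \<omega> i = False)})"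
    using offset_less by auto
  moreover have "measure Om (\<Union>r\<in>{r. r < period n \<and> hole n (int r + i)}. {\<omega>. offset n (fst \<omega>) = r \<and> (\<forall>i\<in>{}. pin n \<omega> i = False)})
     = (\<Sum>r\<in>{r. r < period n \<and> hole n (int r + i)}. measure Om {\<omega>. offset n (fst \<omega>) = r \<and> (\<forall>i\<in>{}. pin n \<omega> i = False)})"
  proof (rule Om.finite_measure_finite_Union)
    have "{\<omega>. offset n (fst \<omega>) = r} \<in> sets Om" for r
      using measurable_sets[OF offset_Om, of "{r}" n] by (simp add: vimage_def)
    then show "(\<lambda>r. {\<omega>. offset n (fst \<omega>) = r \<and> (\<forall>i\<in>{}. pin n \<omega> i = False)}) ` {r. r < period n \<and> hole n (int r + i)} \<subseteq> sets Om" by auto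
  qed (auto simp: disjoint_family_on_def)
  moreover have "\<dots> = (\<Sum>r\<in>{r. r < period n \<and> hole n (int r + i)}. 1 / real (period n))"
  proof (intro sum.cong refl)
    fix r assume "r \<in> {r. r < period n \<and> hole n (int r + i)}"
    then show "measure Om {\<omega>. offset n (fst \<omega>) = r \<and> (\<forall>i\<in>{}. pin n \<omega> i = False)} = 1 / real (period n)"
      using prob_offset_cyl[of "{}" r n "\<lambda>_. False"] by (simp add: G_def)
  qed
  ultimately have "measure Om {\<omega>. hole n (int (offset n (fst \<omega>)) + i)} = (\<Sum>r\<in>{r. r < period n \<and> hole n (int r + i)}. 1 / real (period n))"
    by simp
  also have "\<dots> = (\<Sum>r<period n. ?h (int r + i)) / real (period n)"
    by (simp add: sum.If_cases sum_divide_distrib[symmetric] of_bool_def Int_def lessThan_def)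
  also have "(\<Sum>r<period n. ?h (int r + i)) = (\<Sum>r<period n. ?h (int r))"
  proof (rule sum_periodic)
    fix i j :: int assume "i mod int (period n) = j mod int (period n)"
    from hole_mod[OF this] show "?h i = ?h j" by simp
  qed
  also have "\<dots> = real (num_holes n)"
    by (simp add: num_holes_def sum.If_cases of_bool_def Int_def lessThan_def)
  finally show ?thesis using density by simp
qed

lemma hole_offset_Suc: "hole (Suc n) (int (offset (Suc n) \<theta>) + i) \<Longrightarrow> hole n (int (offset n \<theta>) + i)"
proof -
  assume "hole (Suc n) (int (offset (Suc n) \<theta>) + i)"
  then have "hole n (int (offset (Suc n) \<theta>) + i)" by (rule hole_Suc)
  moreover have "(int (offset (Suc n) \<theta>) + i) mod int (period n) = (int (offset n \<theta>) + i) mod int (period n)"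
  proof (rule mod_add_cong[OF _ refl])
    have "int (offset (Suc n) \<theta>) mod int (period n) = int (offset n \<theta>)"
      using offset_Suc_mod[of n \<theta>] by (metis zmod_int)
    then show "int (offset (Suc n) \<theta>) mod int (period n) = int (offset n \<theta>) mod int (period n)"
      using offset_less[of n \<theta>] by simp
  qed
  ultimately show ?thesis using hole_mod by blast
qed

text \<open>A difference at \<open>i\<close> requires a hole of level n that some other level does
  not have. The events \<open>H l\<close> decrease in \<open>l\<close> with probabilities tending to
  1/4, so their intersection has probability 1/4 and the excess of \<open>H n\<close> is the
  bound.\<close>

lemma prob_differ: "measure Om {\<omega>. pin n \<omega> i \<noteq> pil \<omega> i} \<le> 1 / (4 * 3 ^ n)"
proof -
  define H where "H l = {\<omega> :: real \<times> (int \<Rightarrow> bool). hole l (int (offset l (fst \<omega>)) + i)}" for l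
  have Hs: "H l \<in> sets Om" for l using hole_event[of l i] unfolding H_def pred_def by simp
  have dec: "decseq H" unfolding H_def by (rule decseq_SucI) (use hole_offset_Suc in auto)
  have "(\<lambda>l. measure Om (H l)) \<longlonglongrightarrow> measure Om (\<Inter>l. H l)"
    using Hs by (intro Om.finite_Lim_measure_decseq dec) auto
  moreover have "(\<lambda>l. measure Om (H l)) \<longlonglongrightarrow> 1 / 4"
  proof -
    have "(\<lambda>l. 1 / 4 + 1 / (4 * 3 ^ l)) \<longlonglongrightarrow> (1 / 4 :: real)" by real_asymp
    then show ?thesis unfolding H_def prob_hole .
  qed
  ultimately have "measure Om (\<Inter>l. H l) = 1 / 4" by (rule LIMSEQ_unique)
  moreover have "measure Om (H n - (\<Inter>l. H l)) = measure Om (H n) - measure Om (\<Inter>l. H l)"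
    using Hs by (intro Om.finite_measure_Diff) auto
  ultimately have "measure Om (H n - (\<Inter>l. H l)) = 1 / (4 * 3 ^ n)" unfolding H_def prob_hole by simp
  moreover have "measure Om {\<omega>. pin n \<omega> i \<noteq> pil \<omega> i} \<le> measure Om (H n - (\<Inter>l. H l))"
    using Hs by (intro Om.finite_measure_mono) (auto simp: pin_def pil_def H_def)
  ultimately show ?thesis by simp
qed

lemma differ_event: "{\<omega>. pin n \<omega> i \<noteq> pil \<omega> i} \<in> sets Om"
proof -
  have "Measurable.pred Om (\<lambda>\<omega>. pin n \<omega> i \<noteq> pil \<omega> i)" unfolding pin_def pil_def by measurable
  then show ?thesis by (simp add: pred_def)
qed

lemma prob_differ_on:
  assumes "finite J"
  shows "measure Om (\<Union>i\<in>J. {\<omega>. pin n \<omega> i \<noteq> pil \<omega> i}) \<le> real (card J) * (1 / (4 * 3 ^ n))"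
proof -
  have "measure Om (\<Union>i\<in>J. {\<omega>. pin n \<omega> i \<noteq> pil \<omega> i}) \<le> (\<Sum>i\<in>J. measure Om {\<omega>. pin n \<omega> i \<noteq> pil \<omega> i})"
    using assms differ_event by (intro Om.finite_measure_subadditive_finite) auto
  also have "\<dots> \<le> (\<Sum>i\<in>J. 1 / (4 * 3 ^ n))" by (intro sum_mono prob_differ)
  finally show ?thesis by simp
qed

lemma prob_approx:
  assumes E: "determined_on J E"
  shows "\<bar>measure Om {\<omega>. pil \<omega> \<in> E} - measure Om {\<omega>. pin n \<omega> \<in> E}\<bar> \<le> real (card J) * (1 / (4 * 3 ^ n))"
proof -
  let ?D = "\<Union>i\<in>J. {\<omega>. pin n \<omega> i \<noteq> pil \<omega> i}"
  have J: "finite J" using E by (simp add: determined_on_def)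
  note Eb = determined_on_borel[OF E]
  have Ds: "?D \<in> sets Om" using J differ_event by auto
  have same: "pin n \<omega> \<in> E \<longleftrightarrow> pil \<omega> \<in> E" if "\<omega> \<notin> ?D" for \<omega>
    using E that unfolding determined_on_def by blast
  have "measure Om {\<omega>. pil \<omega> \<in> E} \<le> measure Om ({\<omega>. pin n \<omega> \<in> E} \<union> ?D)"
    using Ds event_pin[OF Eb] event_pil[OF Eb] same by (intro Om.finite_measure_mono) auto
  also have "\<dots> \<le> measure Om {\<omega>. pin n \<omega> \<in> E} + measure Om ?D"
    using Ds event_pin[OF Eb] by (intro measure_Un_le)
  finally have 1: "measure Om {\<omega>. pil \<omega> \<in> E} \<le> measure Om {\<omega>. pin n \<omega> \<in> E} + measure Om ?D" .
  have "measure Om {\<omega>. pin n \<omega> \<in> E} \<le> measure Om ({\<omega>. pil \<omega> \<in> E} \<union> ?D)"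
    using Ds event_pin[OF Eb] event_pil[OF Eb] same by (intro Om.finite_measure_mono) auto
  also have "\<dots> \<le> measure Om {\<omega>. pil \<omega> \<in> E} + measure Om ?D"
    using Ds event_pil[OF Eb] by (intro measure_Un_le)
  finally show ?thesis using 1 prob_differ_on[OF J, of n] by linarith
qed

end

section \<open>Invariance and ergodicity of the limit law\<close>

lemma null_by_geometric:
  fixes d C :: real
  assumes "\<And>n. \<bar>d\<bar> \<le> C * (1 / (4 * 3 ^ n))" shows "d = 0"
proof -
  have "(\<lambda>n. C * (1 / (4 * 3 ^ n))) \<longlonglongrightarrow> 0" by real_asymp
  then have "\<bar>d\<bar> \<le> 0" by (rule LIMSEQ_le_const) (use assms in auto)
  then show ?thesis by simp
qed

lemma determined_on_win: "E \<in> determined win \<Longrightarrow> \<exists>K. determined_on {- int K..int K} E"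
proof -
  assume "E \<in> determined win"
  then obtain K where K: "\<forall>x y. win K x = win K y \<longrightarrow> (x \<in> E \<longleftrightarrow> y \<in> E)" by (auto simp: determined_def)
  have "win K x = win K y" if "\<forall>i\<in>{- int K..int K}. x i = y i" for x y
    using that unfolding win_eq_iff by (auto simp: abs_le_iff)
  then have "determined_on {- int K..int K} E" using K unfolding determined_on_def by blast
  then show ?thesis ..
qed

lemma determined_on_shift: "determined_on J E \<Longrightarrow> determined_on ((\<lambda>i. i + k) ` J) (shiftn k -` E)"
  unfolding determined_on_def
proof (elim conjE, intro conjI allI impI)
  assume J: "finite J" and E: "\<forall>x y. (\<forall>i\<in>J. x i = y i) \<longrightarrow> (x \<in> E) = (y \<in> E)"
  show "finite ((\<lambda>i. i + k) ` J)" using J by simp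
  fix x y :: config assume "\<forall>i\<in>(\<lambda>i. i + k) ` J. x i = y i"
  then have "\<forall>i\<in>J. shiftn k x i = shiftn k y i" by (simp add: shiftn_apply)
  then have "shiftn k x \<in> E \<longleftrightarrow> shiftn k y \<in> E" using E by blast
  then show "(x \<in> shiftn k -` E) = (y \<in> shiftn k -` E)" by simp
qed

lemma determined_on_Int: "determined_on I A \<Longrightarrow> determined_on J B \<Longrightarrow> determined_on (I \<union> J) (A \<inter> B)"
  unfolding determined_on_def
proof (elim conjE, intro conjI allI impI)
  assume "finite I" "finite J" and A: "\<forall>x y. (\<forall>i\<in>I. x i = y i) \<longrightarrow> (x \<in> A) = (y \<in> A)"
    and B: "\<forall>x y. (\<forall>i\<in>J. x i = y i) \<longrightarrow> (x \<in> B) = (y \<in> B)"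
  then show "finite (I \<union> J)" by simp
  fix x y :: config assume xy: "\<forall>i\<in>I \<union> J. x i = y i"
  have "x \<in> A \<longleftrightarrow> y \<in> A" using A xy by blast
  moreover have "x \<in> B \<longleftrightarrow> y \<in> B" using B xy by blast
  ultimately show "(x \<in> A \<inter> B) = (y \<in> A \<inter> B)" by simp
qed

context ohno_skeleton
begin

definition mu :: "config measure" where "mu = distr Om borel pil"

lemma sets_mu [simp]: "sets mu = sets borel" by (simp add: mu_def)
lemma space_mu [simp]: "space mu = UNIV" by (simp add: mu_def)

lemma prob_space_mu: "prob_space mu"
  unfolding mu_def by (rule Om.prob_space_distr[OF measurable_pil])

lemma measure_mu: "E \<in> sets borel \<Longrightarrow> measure mu E = measure Om {\<omega>. pil \<omega> \<in> E}"
  unfolding mu_def by (subst measure_distr[OF measurable_pil]) (simp_all add: vimage_def)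

sublocale mu: prob_space mu by (rule prob_space_mu)

lemma vimage_shiftn_borel: "E \<in> sets borel \<Longrightarrow> shiftn k -` E \<in> sets borel"
  using measurable_sets[OF measurable_shiftn, of E k] by simp

text \<open>Invariance is exact at every level n; replacing \<open>pin n\<close> by
  \<open>pil\<close> on both sides costs an error geometric in n while the left-hand side does not
  depend on n.\<close>

lemma mu_shift_cyl:
  assumes E: "determined_on J E" shows "measure mu (shiftn k -` E) = measure mu E"
proof -
  let ?E' = "shiftn k -` E" and ?J' = "(\<lambda>i. i + k) ` J"
  have E': "determined_on ?J' ?E'" by (rule determined_on_shift[OF E])
  have c: "card ?J' \<le> card J" using E by (intro card_image_le) (simp add: determined_on_def)
  have same: "measure Om {\<omega>. pin n \<omega> \<in> ?E'} = measure Om {\<omega>. pin n \<omega> \<in> E}" for n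
    using prob_shifted[OF E, of k n] prob_shifted[OF E, of 0 n] by simp
  have "\<bar>measure mu ?E' - measure mu E\<bar> \<le> (2 * real (card J)) * (1 / (4 * 3 ^ n))" for n
  proof -
    have "\<bar>measure mu ?E' - measure Om {\<omega>. pin n \<omega> \<in> ?E'}\<bar> \<le> real (card ?J') * (1 / (4 * 3 ^ n))"
      using prob_approx[OF E', of n] measure_mu[OF determined_on_borel[OF E']] by simp
    also have "\<dots> \<le> real (card J) * (1 / (4 * 3 ^ n))" using c by (intro mult_right_mono) auto
    finally have 1: "\<bar>measure mu ?E' - measure Om {\<omega>. pin n \<omega> \<in> ?E'}\<bar> \<le> real (card J) * (1 / (4 * 3 ^ n))" .
    have "\<bar>measure mu E - measure Om {\<omega>. pin n \<omega> \<in> E}\<bar> \<le> real (card J) * (1 / (4 * 3 ^ n))"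
      using prob_approx[OF E, of n] measure_mu[OF determined_on_borel[OF E]] by simp
    then show ?thesis using 1 same[of n] by linarith
  qed
  then have "measure mu ?E' - measure mu E = 0" by (rule null_by_geometric)
  then show ?thesis by simp
qed

text \<open>Finitely determined events form a generator closed under intersection, so agreement on
  them suffices.\<close>

lemma mu_shift:
  assumes E: "E \<in> sets borel" shows "emeasure mu (shiftn k -` E) = emeasure mu E"
proof -
  have m: "shiftn k \<in> measurable mu borel" using measurable_shiftn by (simp add: measurable_def)
  have "distr mu borel (shiftn k) = mu"
  proof (rule measure_eqI_generator_eq[where E = "determined win" and \<Omega> = UNIV and A = "\<lambda>_. UNIV"])
    have alg: "algebra UNIV (determined win)" by (rule algebra_determined) (rule win_mono)
    show "Int_stable (determined win)" using alg by (simp add: algebra_iff_Int Int_stable_def)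
    show "sets (distr mu borel (shiftn k)) = sigma_sets UNIV (determined win)" by (simp add: borel_config)
    show "sets mu = sigma_sets UNIV (determined win)" by (simp add: borel_config)
    show "range (\<lambda>_::nat. UNIV) \<subseteq> determined win" by (auto simp: determined_def)
    fix A assume "A \<in> determined win"
    then obtain K where A: "determined_on {- int K..int K} A" using determined_on_win by blast
    have "emeasure (distr mu borel (shiftn k)) A = emeasure mu (shiftn k -` A)"
      using emeasure_distr[OF m determined_on_borel[OF A]] by simp
    also have "\<dots> = emeasure mu A" using mu_shift_cyl[OF A, of k] by (simp add: mu.emeasure_eq_measure)
    finally show "emeasure (distr mu borel (shiftn k)) A = emeasure mu A" .
  next
    show "emeasure (distr mu borel (shiftn k)) UNIV \<noteq> \<infinity>" for i :: nat
      using emeasure_distr[OF m, of UNIV] mu.emeasure_space_1 by simp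
  qed auto
  then show ?thesis using emeasure_distr[OF m E] by simp
qed

text \<open>Averaging over one period of the offset decorrelates: the correlations of \<open>A\<close> with its shifts by
  \<open>D, \<dots>, D + period n - 1\<close> under the law of \<open>pin n\<close> average to the square of the probability of \<open>A\<close>.\<close>

lemma average_correlation:
  assumes A: "determined_on J A" and D: "\<And>k. k \<ge> D \<Longrightarrow> J \<inter> (\<lambda>i. i + k) ` J = {}"
  shows "(\<Sum>l<period n. measure Om {\<omega>. pin n \<omega> \<in> A \<and> shiftn (D + int l) (pin n \<omega>) \<in> A})
    = real (period n) * (measure Om {\<omega>. pin n \<omega> \<in> A})\<^sup>2"
proof -
  let ?m = "real (period n)" and ?S = "\<Sum>r<period n. b n J A (int r)"
  have p: "measure Om {\<omega>. pin n \<omega> \<in> A} = ?S / ?m" using prob_shifted[OF A, of 0 n] by simp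
  have "(\<Sum>l<period n. measure Om {\<omega>. pin n \<omega> \<in> A \<and> shiftn (D + int l) (pin n \<omega>) \<in> A})
      = (\<Sum>l<period n. (\<Sum>r<period n. b n J A (int r) * b n J A (int r + (D + int l))) / ?m)"
    by (intro sum.cong refl prob_pair A D) simp
  also have "\<dots> = (\<Sum>r<period n. b n J A (int r) * (\<Sum>l<period n. b n J A (int l + (int r + D)))) / ?m"
    by (simp add: sum_divide_distrib[symmetric] sum_distrib_left algebra_simps) (subst sum.swap, simp add: algebra_simps)
  \<comment> \<open>For each \<open>r\<close> the shifts run through all residues, so the inner sum
    is the full sum over a period.\<close>
  also have "\<dots> = (\<Sum>r<period n. b n J A (int r) * ?S) / ?m"
  proof -
    have "(\<Sum>l<period n. b n J A (int l + (int r + D))) = ?S" for r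
      by (rule sum_periodic) (rule b_mod)
    then show ?thesis by simp
  qed
  also have "\<dots> = ?S * ?S / ?m" by (simp add: sum_distrib_right)
  finally show ?thesis unfolding p by (simp add: power2_eq_square)
qed

text \<open>Replace the invariant set \<open>A\<close> by a finitely determined \<open>A'\<close>.
  Invariance of \<open>A\<close> keeps every correlation of \<open>A'\<close> with its distant
  shifts close to the measure of \<open>A\<close>, whereas by \<open>average_correlation\<close>
  these average at level n to the square of the probability of \<open>A'\<close>. Hence the measure
  of \<open>A\<close> equals its own square.\<close>

lemma mu_ergodic:
  assumes A: "A \<in> sets borel" and inv: "shift_map -` A = A"
  shows "measure mu A = 0 \<or> measure mu A = 1"
proof -
  have invn: "shiftn (int l) -` A = A" for l
  proof (induction l)
    case 0
    show ?case by auto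
  next
    case (Suc l)
    have "shiftn (int (Suc l)) -` A = shiftn (int l) -` (shift_map -` A)" by (auto simp: shift_map_eq)
    then show ?case using inv Suc by simp
  qed
  have main: "\<bar>measure mu A - (measure mu A)\<^sup>2\<bar> \<le> 4 * e" if e: "0 < e" for e
  proof -
    have alg: "algebra (space mu) (determined win)" unfolding space_mu by (rule algebra_determined) (rule win_mono)
    have gen: "sets mu = sigma_sets (space mu) (determined win)" by (simp add: borel_config)
    obtain A' where A': "A' \<in> determined win" "measure mu ((A - A') \<union> (A' - A)) < e"
      using approx_by_algebra[OF mu.finite_measure_axioms alg gen _ e, of A] A by auto
    obtain K where K: "determined_on {- int K..int K} A'" using determined_on_win[OF A'(1)] by blast
    let ?J = "{- int K..int K}"
    \<comment> \<open>From this distance on, a window of radius \<open>K\<close> and its translate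
      are disjoint.\<close>
    define D where "D = 2 * int K + 1"
    have disj: "?J \<inter> (\<lambda>i. i + k) ` ?J = {}" if "k \<ge> D" for k using that unfolding D_def by auto
    have A'b: "A' \<in> sets borel" by (rule determined_on_borel[OF K])
    let ?\<Delta> = "(A - A') \<union> (A' - A)"
    have \<Delta>b: "?\<Delta> \<in> sets borel" using A A'b by auto
    let ?C = "2 * real (card ?J)"
    let ?P = "\<lambda>n. measure Om {\<omega>. pin n \<omega> \<in> A'}"
    let ?c = "\<lambda>n l. measure Om {\<omega>. pin n \<omega> \<in> A' \<and> shiftn (D + int l) (pin n \<omega>) \<in> A'}"
    \<comment> \<open>\<open>2 * e\<close> pays for replacing \<open>A\<close> by \<open>A'\<close>
      in both factors, the other term for replacing \<open>mu\<close> by the law of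
      \<open>pin n\<close>, as the event depends on at most twice \<open>card ?J\<close>
      coordinates.\<close>
    have corr: "\<bar>?c n l - measure mu A\<bar> \<le> 2 * e + ?C * (1 / (4 * 3 ^ n))" for n l
    proof -
      let ?k = "D + int l"
      let ?E = "A' \<inter> shiftn ?k -` A'"
      have E: "determined_on (?J \<union> (\<lambda>i. i + ?k) ` ?J) ?E"
        by (rule determined_on_Int[OF K determined_on_shift[OF K]])
      have "card (?J \<union> (\<lambda>i. i + ?k) ` ?J) \<le> card ?J + card ((\<lambda>i. i + ?k) ` ?J)" by (rule card_Un_le)
      also have "\<dots> \<le> 2 * card ?J" using card_image_le[of ?J "\<lambda>i. i + ?k"] by simp
      finally have "real (card (?J \<union> (\<lambda>i. i + ?k) ` ?J)) \<le> ?C" by simp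
      then have cc: "real (card (?J \<union> (\<lambda>i. i + ?k) ` ?J)) * (1 / (4 * 3 ^ n)) \<le> ?C * (1 / (4 * 3 ^ n))"
        by (intro mult_right_mono) auto
      have Eb: "?E \<in> sets borel" by (rule determined_on_borel[OF E])
      have 1: "\<bar>measure mu ?E - ?c n l\<bar> \<le> ?C * (1 / (4 * 3 ^ n))"
        using prob_approx[OF E, of n] cc measure_mu[OF Eb] by (simp add: vimage_def Int_def)
      have k: "shiftn ?k -` A = A" using invn[of "nat ?k"] by (simp add: D_def)
      have s\<Delta>: "shiftn ?k -` ?\<Delta> \<in> sets borel" by (rule vimage_shiftn_borel[OF \<Delta>b])
      have m\<Delta>: "measure mu (shiftn ?k -` ?\<Delta>) < e"
        using A'(2) mu_shift[OF \<Delta>b, of ?k] by (simp add: measure_def)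
      have k': "x \<in> A \<longleftrightarrow> shiftn ?k x \<in> A" for x using k by auto
      have "measure mu A \<le> measure mu (?E \<union> (?\<Delta> \<union> shiftn ?k -` ?\<Delta>))"
        using A Eb \<Delta>b s\<Delta> k' by (intro mu.finite_measure_mono) auto
      also have "\<dots> \<le> measure mu ?E + measure mu (?\<Delta> \<union> shiftn ?k -` ?\<Delta>)"
        using Eb \<Delta>b s\<Delta> by (intro measure_Un_le) auto
      also have "measure mu (?\<Delta> \<union> shiftn ?k -` ?\<Delta>) \<le> measure mu ?\<Delta> + measure mu (shiftn ?k -` ?\<Delta>)"
        using \<Delta>b s\<Delta> by (intro measure_Un_le) auto
      finally have 2: "measure mu A \<le> measure mu ?E + 2 * e" using A'(2) m\<Delta> by linarith
      have "measure mu ?E \<le> measure mu (A \<union> ?\<Delta>)"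
        using A Eb \<Delta>b by (intro mu.finite_measure_mono) auto
      also have "\<dots> \<le> measure mu A + measure mu ?\<Delta>"
        using A \<Delta>b by (intro measure_Un_le) auto
      finally have "measure mu ?E \<le> measure mu A + 2 * e" using A'(2) e by linarith
      then show ?thesis using 1 2 by linarith
    qed
    \<comment> \<open>The bound \<open>corr\<close> is uniform in \<open>l\<close>, so it survives
      averaging over one period of shifts.\<close>
    have sq: "\<bar>(?P n)\<^sup>2 - measure mu A\<bar> \<le> 2 * e + ?C * (1 / (4 * 3 ^ n))" for n
    proof -
      let ?m = "real (period n)" and ?B = "2 * e + ?C * (1 / (4 * 3 ^ n))"
      have "\<bar>(\<Sum>l<period n. ?c n l) - ?m * measure mu A\<bar> = \<bar>\<Sum>l<period n. (?c n l - measure mu A)\<bar>"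
        by (simp add: sum_subtractf)
      also have "\<dots> \<le> (\<Sum>l<period n. \<bar>?c n l - measure mu A\<bar>)" by (rule sum_abs)
      also have "\<dots> \<le> (\<Sum>l<period n. ?B)" by (intro sum_mono corr)
      finally have "\<bar>?m * (?P n)\<^sup>2 - ?m * measure mu A\<bar> \<le> ?m * ?B"
        using average_correlation[OF K, of D n] disj by simp
      then have "?m * \<bar>(?P n)\<^sup>2 - measure mu A\<bar> \<le> ?m * ?B"
        by (simp add: right_diff_distrib[symmetric] abs_mult del: mult_le_cancel_left_pos)
      then show ?thesis by (rule mult_left_le_imp_le) simp
    qed
    have g0: "(\<lambda>n. C * (1 / (4 * 3 ^ n))) \<longlonglongrightarrow> 0" for C :: real by real_asymp
    have "(\<lambda>n. ?P n - measure mu A') \<longlonglongrightarrow> 0"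
    proof (rule Lim_null_comparison[OF _ g0[of "real (card ?J)"]])
      show "\<forall>\<^sub>F n in sequentially. norm (?P n - measure mu A') \<le> real (card ?J) * (1 / (4 * 3 ^ n))"
        using prob_approx[OF K] measure_mu[OF A'b] by (intro always_eventually allI) (simp add: abs_minus_commute)
    qed
    then have "?P \<longlonglongrightarrow> measure mu A'" by (simp add: LIM_zero_iff)
    \<comment> \<open>The level n tends to infinity while \<open>A'\<close> and \<open>e\<close>
      stay fixed, which removes the geometric terms.\<close>
    then have "(\<lambda>n. \<bar>(?P n)\<^sup>2 - measure mu A\<bar>) \<longlonglongrightarrow> \<bar>(measure mu A')\<^sup>2 - measure mu A\<bar>"
      by (intro tendsto_intros)
    moreover have "(\<lambda>n. 2 * e + ?C * (1 / (4 * 3 ^ n))) \<longlonglongrightarrow> 2 * e + 0" by (intro tendsto_add tendsto_const g0)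
    ultimately have 1: "\<bar>(measure mu A')\<^sup>2 - measure mu A\<bar> \<le> 2 * e + 0"
      by (rule LIMSEQ_le) (use sq in auto)
    have "measure mu A \<le> measure mu (A' \<union> ?\<Delta>)" using A A'b \<Delta>b by (intro mu.finite_measure_mono) auto
    also have "\<dots> \<le> measure mu A' + measure mu ?\<Delta>" using A'b \<Delta>b by (intro measure_Un_le) auto
    finally have u: "measure mu A \<le> measure mu A' + e" using A'(2) by linarith
    have "measure mu A' \<le> measure mu (A \<union> ?\<Delta>)" using A A'b \<Delta>b by (intro mu.finite_measure_mono) auto
    also have "\<dots> \<le> measure mu A + measure mu ?\<Delta>" using A \<Delta>b by (intro measure_Un_le) auto
    finally have l: "measure mu A' \<le> measure mu A + e" using A'(2) by linarith
    let ?a = "measure mu A" and ?a' = "measure mu A'"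
    have "\<bar>?a'\<^sup>2 - ?a\<^sup>2\<bar> = \<bar>?a' - ?a\<bar> * \<bar>?a' + ?a\<bar>" 
      unfolding abs_mult[symmetric] by (intro arg_cong[where f = abs]) (simp add: power2_eq_square algebra_simps)
    also have "\<dots> \<le> e * 2"
    proof (rule mult_mono)
      show "\<bar>?a' - ?a\<bar> \<le> e" using u l by linarith
      have "?a' \<le> 1" "?a \<le> 1" by auto
      moreover have "0 \<le> ?a'" "0 \<le> ?a" by auto
      ultimately show "\<bar>?a' + ?a\<bar> \<le> 2" by linarith
    qed (use e in auto)
    finally show ?thesis using 1 by linarith
  qed
  have "\<bar>measure mu A - (measure mu A)\<^sup>2\<bar> \<le> 0"
  proof (rule field_le_epsilon)
    fix e :: real assume "0 < e"
    then show "\<bar>measure mu A - (measure mu A)\<^sup>2\<bar> \<le> 0 + e" using main[of "e / 4"] by simp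
  qed
  then have "measure mu A * (1 - measure mu A) = 0" by (simp add: power2_eq_square algebra_simps)
  then show ?thesis by simp
qed

end

section \<open>Entropy and support of the limit law\<close>

context ohno_skeleton
begin

lemma simple_mu_wrd: "simple_function mu (\<lambda>x. wrd L (shiftn k x))"
  unfolding simple_function_def
proof (intro conjI ballI)
  show "finite ((\<lambda>x. wrd L (shiftn k x)) ` space mu)" by (rule finite_subset[OF _ finite_range_wrd[of L]]) auto
  fix w show "(\<lambda>x. wrd L (shiftn k x)) -` {w} \<inter> space mu \<in> sets mu"
    using vimage_shiftn_borel[OF borel_wrd, of k L w] by (simp add: vimage_def)
qed

lemma ent_mu_wrd_shift: "ent mu (\<lambda>x. wrd L (shiftn k x)) = ent mu (wrd L)"
proof (rule ent_eq_law[OF mu.prob_space_axioms mu.prob_space_axioms simple_mu_wrd])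
  show "simple_function mu (wrd L)" using simple_mu_wrd[of L 0] by simp
  fix w
  have "emeasure mu (shiftn k -` {x. wrd L x = w}) = emeasure mu {x. wrd L x = w}" by (rule mu_shift[OF borel_wrd])
  then show "pr mu (\<lambda>x. wrd L (shiftn k x)) w = pr mu (wrd L) w" by (simp add: pr_def measure_def vimage_def)
qed

lemma ent_mu_wrd_subadd: "ent mu (wrd (m + n)) \<le> ent mu (wrd m) + ent mu (wrd n)"
proof -
  note s = simple_mu_wrd[of m 0, simplified] simple_mu_wrd[of n "int m"]
  have "ent mu (wrd (m + n)) \<le> ent mu (\<lambda>x. (wrd m x, wrd n (shiftn (int m) x)))"
  proof (rule mu.ent_mono[OF simple_function_Pair[OF s]])
    fix x y assume "(wrd m x, wrd n (shiftn (int m) x)) = (wrd m y, wrd n (shiftn (int m) y))"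
    then have a: "\<And>i. 0 \<le> i \<and> i < int m \<Longrightarrow> x i = y i" "\<And>i. 0 \<le> i \<and> i < int n \<Longrightarrow> x (i + int m) = y (i + int m)"
      by (simp_all add: wrd_eq_iff shiftn_apply)
    show "wrd (m + n) x = wrd (m + n) y"
    proof (unfold wrd_eq_iff, intro allI impI)
      fix i assume i: "0 \<le> i \<and> i < int (m + n)"
      show "x i = y i"
      proof (cases "i < int m")
        case True
        then show ?thesis using a(1) i by blast
      next
        case False
        then show ?thesis using a(2)[of "i - int m"] i by simp
      qed
    qed
  qed
  also have "\<dots> \<le> ent mu (wrd m) + ent mu (\<lambda>x. wrd n (shiftn (int m) x))" by (rule mu.ent_subadditive[OF s])
  finally show ?thesis by (simp add: ent_mu_wrd_shift)
qed

lemma simple_wrd_comp: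
  assumes f: "\<And>E. E \<in> sets borel \<Longrightarrow> {\<omega>. f \<omega> \<in> E} \<in> sets Om"
  shows "simple_function Om (\<lambda>\<omega>. wrd L (f \<omega>))"
  unfolding simple_function_def
proof (intro conjI ballI)
  show "finite ((\<lambda>\<omega>. wrd L (f \<omega>)) ` space Om)" by (rule finite_subset[OF _ finite_range_wrd[of L]]) blast
  fix w show "(\<lambda>\<omega>. wrd L (f \<omega>)) -` {w} \<inter> space Om \<in> sets Om"
    using f[OF borel_wrd, of L w] by (simp add: vimage_def)
qed

lemma simple_Om_wrd: "simple_function Om (\<lambda>\<omega>. wrd L (pin n \<omega>))" "simple_function Om (\<lambda>\<omega>. wrd L (pil \<omega>))"
  by (rule simple_wrd_comp, erule event_pin) (rule simple_wrd_comp, erule event_pil)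

lemma wrd_eq_on: "wrd L x = wrd L s \<longleftrightarrow> (\<forall>i\<in>{0..<int L}. x i = s i)"
  by (auto simp: wrd_eq_iff)

lemma simple_offset: "simple_function Om (\<lambda>\<omega>. offset n (fst \<omega>))"
  unfolding simple_function_def
proof (intro conjI ballI)
  show "finite ((\<lambda>\<omega>. offset n (fst \<omega>)) ` space Om)"
    by (rule finite_subset[of _ "{..<period n}"]) (use offset_less in auto)
  fix r show "(\<lambda>\<omega>. offset n (fst \<omega>)) -` {r} \<inter> space Om \<in> sets Om"
    by (rule measurable_sets[OF offset_Om]) simp
qed

text \<open>A nonzero weight admits no 0 outside the holes, so only holes contribute a factor
  different from 1.\<close>

lemma G_half_power:
  assumes J: "finite J" and G: "G n r J s \<noteq> 0"
  shows "G n r J s = (1 / 2) ^ card {i \<in> J. hole n (r + i)}"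
proof -
  have "wt (hole n (r + i)) (s i) = (if hole n (r + i) then 1 / 2 else 1)" if "i \<in> J" for i
  proof -
    have "wt (hole n (r + i)) (s i) \<noteq> 0" using G J that unfolding G_def by (metis prod_zero)
    then show ?thesis by (simp add: wt_def split: if_splits)
  qed
  then have "G n r J s = (\<Prod>i\<in>J. if hole n (r + i) then 1 / 2 else 1)" unfolding G_def by (intro prod.cong refl)
  also have "\<dots> = (1 / 2) ^ card {i \<in> J. hole n (r + i)}"
    using J by (simp add: prod.If_cases Int_def)
  finally show ?thesis .
qed

text \<open>Given the offset, all words that occur are equally likely, so that the conditional entropy is
  \<open>ln 2\<close> times the expected number of holes.\<close>

lemma ent_pin_lower: "real L * (ln 2 / 4) \<le> ent Om (\<lambda>\<omega>. wrd L (pin n \<omega>))"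
proof -
  let ?J = "{0..<int L}" and ?m = "real (period n)"
  define k where "k r = card {i \<in> ?J. hole n (int r + i)}" for r
  let ?o = "\<lambda>\<omega> :: real \<times> (int \<Rightarrow> bool). offset n (fst \<omega>)"
  let ?W = "\<lambda>\<omega>. (wrd L (pin n \<omega>), ?o \<omega>)"
  have sW: "simple_function Om ?W" by (rule simple_function_Pair[OF simple_Om_wrd(1) simple_offset])
  \<comment> \<open>Minus the logarithm of the probability of a pair is \<open>ln ?m\<close> for the
    offset plus \<open>ln 2\<close> for each hole seen; pairs of probability 0 contribute nothing to
    either side.\<close>
  have p: "- (pr Om ?W v * ln (pr Om ?W v)) = pr Om ?W v * (ln ?m + real (k (snd v)) * ln 2)" if v: "v \<in> ?W ` space Om" for v
  proof -
    obtain \<omega>0 where \<omega>0: "v = ?W \<omega>0" using v by blast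
    have "{\<omega> \<in> space Om. ?W \<omega> = v} = {\<omega>. ?o \<omega> = ?o \<omega>0 \<and> (\<forall>i\<in>?J. pin n \<omega> i = pin n \<omega>0 i)}"
      unfolding \<omega>0 by (auto simp: wrd_eq_on)
    then have pv: "pr Om ?W v = G n (int (?o \<omega>0)) ?J (pin n \<omega>0) / ?m"
      using prob_offset_cyl[of ?J "?o \<omega>0" n "pin n \<omega>0"] offset_less by (simp add: pr_def)
    show ?thesis
    proof (cases "G n (int (?o \<omega>0)) ?J (pin n \<omega>0) = 0")
      case True
      then show ?thesis using pv by simp
    next
      case False
      have "pr Om ?W v = (1 / 2) ^ k (snd v) / ?m"
        unfolding pv using G_half_power[OF _ False] by (simp add: k_def \<omega>0)
      then have "ln (pr Om ?W v) = - (ln ?m + real (k (snd v)) * ln 2)"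
        by (simp add: ln_div ln_realpow)
      then show ?thesis by (simp add: right_diff_distrib distrib_left)
    qed
  qed
  have "ent Om ?W = (\<Sum>v\<in>?W ` space Om. pr Om ?W v * (ln ?m + real (k (snd v)) * ln 2))"
    unfolding ent_def sum_negf[symmetric] by (intro sum.cong refl p)
  also have "\<dots> = (\<Sum>v\<in>?W ` space Om. pr Om ?W v) * ln ?m + ln 2 * (\<Sum>v\<in>?W ` space Om. pr Om ?W v * real (k (snd v)))"
    by (simp add: sum_distrib_left sum_distrib_right sum.distrib[symmetric] algebra_simps)
  also have "(\<Sum>v\<in>?W ` space Om. pr Om ?W v) = 1" by (rule Om.sum_pr[OF sW])
  also have "(\<Sum>v\<in>?W ` space Om. pr Om ?W v * real (k (snd v))) = (\<Sum>r\<in>?o ` space Om. pr Om ?o r * real (k r))"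
  proof -
    have "(\<Sum>v\<in>?W ` space Om. pr Om ?W v * real (k (snd v)))
        = (\<Sum>r\<in>snd ` ?W ` space Om. \<Sum>v | v \<in> ?W ` space Om \<and> snd v = r. pr Om ?W v * real (k (snd v)))"
      by (rule sum.image_gen[OF simple_functionD(1)[OF sW]])
    also have "\<dots> = (\<Sum>r\<in>snd ` ?W ` space Om. pr Om ?o r * real (k r))"
    proof (intro sum.cong refl)
      fix r
      have "pr Om ?o r = (\<Sum>v | v \<in> ?W ` space Om \<and> snd v = r. pr Om ?W v)"
        using Om.pr_comp[OF sW, of snd r] by simp
      then show "(\<Sum>v | v \<in> ?W ` space Om \<and> snd v = r. pr Om ?W v * real (k (snd v))) = pr Om ?o r * real (k r)"
        by (simp add: sum_distrib_right)
    qed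
    also have "snd ` ?W ` space Om = ?o ` space Om" by (simp add: image_image)
    finally show ?thesis .
  qed
  also have "(\<Sum>r\<in>?o ` space Om. pr Om ?o r * real (k r)) = (\<Sum>r<period n. pr Om ?o r * real (k r))"
  proof (rule sum.mono_neutral_left)
    show "?o ` space Om \<subseteq> {..<period n}" using offset_less by auto
    show "\<forall>r\<in>{..<period n} - ?o ` space Om. pr Om ?o r * real (k r) = 0"
      using pr_notin_range[of _ ?o Om] by simp
  qed simp
  also have "\<dots> = (\<Sum>r<period n. real (k r) / ?m)"
  proof (intro sum.cong refl)
    fix r assume "r \<in> {..<period n}"
    then have "pr Om ?o r = 1 / ?m" using prob_offset_cyl[of "{}" r n "\<lambda>_. False"] by (simp add: pr_def G_def)
    then show "pr Om ?o r * real (k r) = real (k r) / ?m" by simp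
  qed
  \<comment> \<open>Exchanging the sums helps because each single coordinate meets all holes as the
    offset runs through a period.\<close>
  also have "\<dots> = (\<Sum>r<period n. \<Sum>i\<in>?J. of_bool (hole n (int r + i))) / ?m"
    by (simp add: sum_divide_distrib k_def of_bool_def sum.If_cases Int_def)
  also have "(\<Sum>r<period n. \<Sum>i\<in>?J. of_bool (hole n (int r + i)) :: real) = (\<Sum>i\<in>?J. \<Sum>r<period n. of_bool (hole n (int r + i)))"
    by (rule sum.swap)
  also have "\<dots> = (\<Sum>i\<in>?J. real (num_holes n))"
  proof (intro sum.cong refl)
    fix i :: int
    have "(\<Sum>r<period n. of_bool (hole n (int r + i)) :: real) = (\<Sum>r<period n. of_bool (hole n (int r)))"
    proof (rule sum_periodic)
      fix i j :: int assume "i mod int (period n) = j mod int (period n)"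
      from hole_mod[OF this] show "(of_bool (hole n i) :: real) = of_bool (hole n j)" by simp
    qed
    also have "\<dots> = real (num_holes n)"
      by (simp add: num_holes_def sum.If_cases of_bool_def Int_def lessThan_def)
    finally show "(\<Sum>r<period n. of_bool (hole n (int r + i)) :: real) = real (num_holes n)" .
  qed
  also have "\<dots> / ?m = real L * (real (num_holes n) / ?m)" by simp
  also have "\<dots> = real L * (1 / 4 + 1 / (4 * 3 ^ n))" unfolding density ..
  finally have eW: "ent Om ?W = ln ?m + ln 2 * (real L * (1 / 4 + 1 / (4 * 3 ^ n)))" by simp
  \<comment> \<open>Dropping the offset from the pair costs at most \<open>ln ?m\<close>, which
    cancels the same term in \<open>eW\<close>; the bound thus becomes independent of n.\<close>
  have "ent Om ?o \<le> ln (real (card {..<period n}))"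
    by (rule Om.ent_le_ln_card[OF simple_offset]) (use offset_less in auto)
  then have "ent Om ?o \<le> ln ?m" by simp
  moreover have "ent Om ?W \<le> ent Om (\<lambda>\<omega>. wrd L (pin n \<omega>)) + ent Om ?o"
    by (rule Om.ent_subadditive[OF simple_Om_wrd(1) simple_offset])
  ultimately have "ln 2 * (real L * (1 / 4 + 1 / (4 * 3 ^ n))) \<le> ent Om (\<lambda>\<omega>. wrd L (pin n \<omega>))" using eW by linarith
  moreover have "ln 2 * (real L * (1 / 4)) \<le> ln 2 * (real L * (1 / 4 + 1 / (4 * 3 ^ n)))"
    by (intro mult_left_mono) auto
  ultimately have "ln 2 * (real L * (1 / 4)) \<le> ent Om (\<lambda>\<omega>. wrd L (pin n \<omega>))" by linarith
  then show ?thesis by (simp add: mult.commute)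
qed

text \<open>The bound for \<open>pin n\<close> is uniform in n, so n may tend to infinity with
  \<open>L\<close> fixed; the words then agree off a set of vanishing probability.\<close>

lemma ent_mu_lower: "real L * (ln 2 / 4) \<le> ent mu (wrd L)"
proof -
  let ?J = "{0..<int L}"
  have "(\<lambda>n. ent Om (\<lambda>\<omega>. wrd L (pin n \<omega>))) \<longlonglongrightarrow> ent Om (\<lambda>\<omega>. wrd L (pil \<omega>))"
  proof (rule Om.ent_tendsto[where S = "range (wrd L)" and bad = "\<lambda>n. \<Union>i\<in>?J. {\<omega>. pin n \<omega> i \<noteq> pil \<omega> i}"])
    show "(\<lambda>n. Om.prob (\<Union>i\<in>?J. {\<omega>. pin n \<omega> i \<noteq> pil \<omega> i})) \<longlonglongrightarrow> 0"
    proof (rule Lim_null_comparison)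
      show "\<forall>\<^sub>F n in sequentially. norm (Om.prob (\<Union>i\<in>?J. {\<omega>. pin n \<omega> i \<noteq> pil \<omega> i})) \<le> real (card ?J) * (1 / (4 * 3 ^ n))"
        using prob_differ_on[of ?J] by (intro always_eventually allI) simp
      have "(\<lambda>n. C * (1 / (4 * 3 ^ n))) \<longlonglongrightarrow> 0" for C :: real by real_asymp
      then show "(\<lambda>n. real (card ?J) * (1 / (4 * 3 ^ n))) \<longlonglongrightarrow> 0" .
    qed
    show "(\<Union>i\<in>?J. {\<omega>. pin n \<omega> i \<noteq> pil \<omega> i}) \<in> sets Om" for n
      by (intro sets.finite_UN differ_event) simp
    show "wrd L (pin n \<omega>) = wrd L (pil \<omega>)" if "\<omega> \<notin> (\<Union>i\<in>?J. {\<omega>. pin n \<omega> i \<noteq> pil \<omega> i})" for n \<omega>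
      using that unfolding wrd_eq_on by blast
  qed (auto simp: finite_range_wrd simple_Om_wrd)
  then have "real L * (ln 2 / 4) \<le> ent Om (\<lambda>\<omega>. wrd L (pil \<omega>))"
    by (rule LIMSEQ_le_const) (use ent_pin_lower in blast)
  also have "\<dots> = ent mu (wrd L)"
  proof (rule ent_eq_law[OF prob_space_Om mu.prob_space_axioms simple_Om_wrd(2)])
    show "simple_function mu (wrd L)" using simple_mu_wrd[of L 0] by simp
    show "pr Om (\<lambda>\<omega>. wrd L (pil \<omega>)) w = pr mu (wrd L) w" for w
      using measure_mu[OF borel_wrd, of L w] by (simp add: pr_def)
  qed
  finally show ?thesis .
qed

lemma ent_mu_limit: "\<exists>h>0. (\<lambda>n. ent mu (wrd n) / real n) \<longlonglongrightarrow> h"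
proof -
  have "0 \<le> ent mu (wrd n)" for n using mu.ent_nonneg[OF simple_mu_wrd[of n 0]] by simp
  then obtain h where h: "(\<lambda>n. ent mu (wrd n) / real n) \<longlonglongrightarrow> h"
    using fekete[of "\<lambda>n. ent mu (wrd n)"] ent_mu_wrd_subadd by blast
  have "ln 2 / 4 \<le> h"
  proof (rule LIMSEQ_le_const[OF h], intro exI allI impI)
    fix n :: nat assume "1 \<le> n"
    then show "ln 2 / 4 \<le> ent mu (wrd n) / real n"
      using ent_mu_lower[of n] by (simp add: pos_le_divide_eq mult.commute)
  qed
  moreover have "0 < ln (2::real) / 4" by simp
  ultimately show ?thesis using h by (intro exI[of _ h]) linarith
qed

text \<open>By ergodicity the fixed point has mass 0 or 1, and mass 1 is excluded because coordinate
  0 shows a 0 with positive probability.\<close>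

lemma mu_not_one: "AE x in mu. x \<noteq> (\<lambda>_. True)"
proof -
  let ?E = "{x::config. \<not> x 0}"
  have E: "determined_on {0} ?E" by (simp add: determined_on_def)
  have "measure Om {\<omega>. pin 2 \<omega> \<in> ?E} = (\<Sum>r<period 2. G 2 (int r) {0} (\<lambda>_. False)) / real (period 2)"
    using prob_cyl[of "{0}" 2 "\<lambda>_. False"] by simp
  also have "(\<Sum>r<period 2. G 2 (int r) {0} (\<lambda>_. False)) = real (num_holes 2) / 2"
    by (simp add: G_def wt_def num_holes_def sum.If_cases Int_def lessThan_def)
  finally have "measure Om {\<omega>. pin 2 \<omega> \<in> ?E} = (real (num_holes 2) / real (period 2)) / 2" by simp
  then have "measure Om {\<omega>. pin 2 \<omega> \<in> ?E} = (1 / 4 + 1 / (4 * 3 ^ 2)) / 2" unfolding density .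
  \<comment> \<open>Half the hole density at level 2; it exceeds the approximation error 1/36 at
    that level.\<close>
  then have "measure Om {\<omega>. pin 2 \<omega> \<in> ?E} = 5 / 36" by simp
  moreover have "\<bar>measure mu ?E - measure Om {\<omega>. pin 2 \<omega> \<in> ?E}\<bar> \<le> 1 / 36"
    using prob_approx[OF E, of 2] measure_mu[OF determined_on_borel[OF E]] by simp
  ultimately have "0 < measure mu ?E" by linarith
  have b1: "{\<lambda>_. True} \<in> sets (borel :: config measure)" using closed_one by simp
  have "shift_map -` {\<lambda>_. True} = {\<lambda>_. True}" unfolding shift_map_eq by auto
  then have "measure mu {\<lambda>_. True} = 0 \<or> measure mu {\<lambda>_. True} = 1" by (rule mu_ergodic[OF b1])
  moreover have "measure mu {\<lambda>_. True} + measure mu ?E \<le> 1"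
  proof -
    have "measure mu {\<lambda>_. True} + measure mu ?E = measure mu ({\<lambda>_. True} \<union> ?E)"
      using b1 determined_on_borel[OF E] by (intro mu.finite_measure_Union[symmetric]) auto
    then show ?thesis by simp
  qed
  ultimately have "measure mu {\<lambda>_. True} = 0" using \<open>0 < measure mu ?E\<close> by linarith
  then have "{\<lambda>_. True} \<in> null_sets mu" using b1 by (simp add: null_sets_def mu.emeasure_eq_measure)
  then have "AE x in mu. x \<notin> {\<lambda>_. True}" by (rule AE_not_in)
  then show ?thesis by simp
qed

text \<open>An offset within \<open>K\<close> of an end of the block has probability at most
  \<open>2 * K / period n\<close>, which tends to 0. This discards the odometer points for which the
  origin stays close to a block boundary at all levels.\<close>

lemma AE_offset_inside: "AE \<omega> in Om. \<forall>K. \<exists>n. K \<le> offset n (fst \<omega>) \<and> offset n (fst \<omega>) + K < period n"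
  unfolding AE_all_countable
proof
  fix K :: nat
  let ?F = "\<lambda>n. {\<omega> :: real \<times> (int \<Rightarrow> bool). \<not> (K \<le> offset n (fst \<omega>) \<and> offset n (fst \<omega>) + K < period n)}"
  have om: "{\<omega>. offset n (fst \<omega>) = r} \<in> sets Om" for n r
    using measurable_sets[OF offset_Om, of "{r}" n] by (simp add: vimage_def)
  have F: "?F n = (\<Union>r\<in>{r. r < period n \<and> \<not> (K \<le> r \<and> r + K < period n)}. {\<omega>. offset n (fst \<omega>) = r})" for n
    using offset_less by auto
  have Fs: "?F n \<in> sets Om" for n unfolding F using om by (intro sets.finite_UN) auto
  have Fm: "measure Om (?F n) \<le> real (2 * K) * (1 / (2 * 3 ^ n))" for n
  proof -
    let ?R = "{r. r < period n \<and> \<not> (K \<le> r \<and> r + K < period n)}"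
    have "?R \<subseteq> {..<K} \<union> {period n - K..<period n}" by auto
    then have "card ?R \<le> card ({..<K} \<union> {period n - K..<period n})" by (intro card_mono) auto
    also have "\<dots> \<le> card {..<K} + card {period n - K..<period n}" by (rule card_Un_le)
    also have "\<dots> \<le> 2 * K" by simp
    finally have c: "card ?R \<le> 2 * K" .
    have "measure Om (?F n) \<le> (\<Sum>r\<in>?R. measure Om {\<omega>. offset n (fst \<omega>) = r})"
      unfolding F using om by (intro Om.finite_measure_subadditive_finite) auto
    also have "\<dots> = (\<Sum>r\<in>?R. 1 / real (period n))"
    proof (intro sum.cong refl)
      fix r assume "r \<in> ?R"
      then show "measure Om {\<omega>. offset n (fst \<omega>) = r} = 1 / real (period n)"
        using prob_offset_cyl[of "{}" r n "\<lambda>_. False"] by (simp add: G_def)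
    qed
    also have "\<dots> = real (card ?R) * (1 / real (period n))" by simp
    also have "\<dots> \<le> real (2 * K) * (1 / real (period n))" using c by (intro mult_right_mono) (simp_all only: of_nat_le_iff, simp)
    finally show ?thesis by (simp add: period_def)
  qed
  have le: "measure Om (\<Inter>n. ?F n) \<le> real (2 * K) * (1 / (2 * 3 ^ n))" for n
  proof -
    have "measure Om (\<Inter>n. ?F n) \<le> measure Om (?F n)" using Fs by (intro Om.finite_measure_mono) auto
    then show ?thesis using Fm[of n] by linarith
  qed
  have "(\<lambda>n. C * (1 / (2 * 3 ^ n))) \<longlonglongrightarrow> 0" for C :: real by real_asymp
  then have "measure Om (\<Inter>n. ?F n) \<le> 0" by (rule LIMSEQ_le_const) (use le in blast)
  then have "measure Om (\<Inter>n. ?F n) = 0" using measure_nonneg[of Om "\<Inter>n. ?F n"] by linarith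
  moreover have "(\<Inter>n. ?F n) \<in> sets Om" using Fs by (intro sets.countable_INT) auto
  ultimately have "(\<Inter>n. ?F n) \<in> null_sets Om" by (simp add: null_sets_def Om.emeasure_eq_measure)
  then have "AE \<omega> in Om. \<omega> \<notin> (\<Inter>n. ?F n)" by (rule AE_not_in)
  then show "AE \<omega> in Om. \<exists>n. K \<le> offset n (fst \<omega>) \<and> offset n (fst \<omega>) + K < period n"
    by eventually_elim auto
qed

text \<open>The block containing the origin, which sits at index
  \<open>offset n (fst \<omega>)\<close> of it, is a filling of \<open>W n\<close>: positions that
  are not holes at level n carry a 1, and the other positions are unconstrained.\<close>

lemma pil_fills: "fills (W n) (map (\<lambda>k. pil \<omega> (int k - int (offset n (fst \<omega>)))) [0..<period n])"
  unfolding fills_def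
proof (intro conjI allI impI)
  show "length (map (\<lambda>k. pil \<omega> (int k - int (offset n (fst \<omega>)))) [0..<period n]) = length (W n)"
    by (simp add: length_W)
  fix k assume k: "k < length (W n)" "W n ! k \<noteq> placeholder"
  then have kp: "k < period n" by (simp add: length_W)
  then have "\<not> hole n (int k)" using k by (simp add: hole_def zmod_int[symmetric])
  then have "\<not> hole n (int (offset n (fst \<omega>)) + (int k - int (offset n (fst \<omega>))))" by simp
  then have "pil \<omega> (int k - int (offset n (fst \<omega>)))" unfolding pil_def by blast
  then show "W n ! k = Some (map (\<lambda>k. pil \<omega> (int k - int (offset n (fst \<omega>)))) [0..<period n] ! k)"
    using W_nth[OF kp k(2)] kp by simp
qed

end

section \<open>The orbit closure in terms of windows\<close>

lemma orbit_closure_iff: "x \<in> orbit_closure xs \<longleftrightarrow> (\<forall>K. \<exists>n. win K (shiftn n xs) = win K x)"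
proof
  assume x: "x \<in> orbit_closure xs"
  show "\<forall>K. \<exists>n. win K (shiftn n xs) = win K x"
  proof
    fix K
    let ?U = "{y. win K y = win K x}"
    have "open ?U" "x \<in> ?U" using clopen_win by auto
    then have "?U \<inter> range (\<lambda>n::int. (\<lambda>i. xs (i + n))) \<noteq> {}"
      using x unfolding orbit_closure_def by (metis Int_iff closure_iff_nhds_not_empty empty_iff order_refl inf_commute)
    then show "\<exists>n. win K (shiftn n xs) = win K x" by (auto simp: shiftn_def)
  qed
next
  assume a: "\<forall>K. \<exists>n. win K (shiftn n xs) = win K x"
  show "x \<in> orbit_closure xs"
    unfolding orbit_closure_def closure_iff_nhds_not_empty
  proof (intro allI impI)
    fix A S :: "config set" assume S: "S \<subseteq> A" "open S" "x \<in> S"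
    obtain K where K: "\<And>y. win K y = win K x \<Longrightarrow> y \<in> S" using open_config_win[OF S(2,3)] by blast
    obtain n where "win K (shiftn n xs) = win K x" using a by blast
    then have "shiftn n xs \<in> A" using K S(1) by blast
    then show "range (\<lambda>n::int. (\<lambda>i. xs (i + n))) \<inter> A \<noteq> {}" unfolding shiftn_def by blast
  qed
qed

text \<open>A match on the window of radius K + 1 gives matches of radius K after a shift by one in
  either direction.\<close>

lemma orbit_closure_shift: "shift_map x \<in> orbit_closure xs \<longleftrightarrow> x \<in> orbit_closure xs"
proof
  assume "shift_map x \<in> orbit_closure xs"
  then have a: "\<exists>n. win K (shiftn n xs) = win K (shiftn 1 x)" for K by (simp add: orbit_closure_iff shift_map_eq)
  show "x \<in> orbit_closure xs"
    unfolding orbit_closure_iff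
  proof
    fix K
    obtain n where n: "\<And>i. \<bar>i\<bar> \<le> int (Suc K) \<Longrightarrow> xs (i + n) = x (i + 1)"
      using a[of "Suc K"] by (auto simp: win_eq_iff shiftn_apply)
    have "xs (i + (n - 1)) = x i" if "\<bar>i\<bar> \<le> int K" for i using n[of "i - 1"] that by (simp add: algebra_simps)
    then show "\<exists>n. win K (shiftn n xs) = win K x" by (intro exI[of _ "n - 1"]) (simp add: win_eq_iff shiftn_apply)
  qed
next
  assume "x \<in> orbit_closure xs"
  then have a: "\<exists>n. win K (shiftn n xs) = win K x" for K by (simp add: orbit_closure_iff)
  show "shift_map x \<in> orbit_closure xs"
    unfolding orbit_closure_iff
  proof
    fix K
    obtain n where n: "\<And>i. \<bar>i\<bar> \<le> int (Suc K) \<Longrightarrow> xs (i + n) = x i"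
      using a[of "Suc K"] by (auto simp: win_eq_iff shiftn_apply)
    have "xs (i + (n + 1)) = x (i + 1)" if "\<bar>i\<bar> \<le> int K" for i using n[of "i + 1"] that by (simp add: algebra_simps)
    then show "\<exists>n. win K (shiftn n xs) = win K (shift_map x)"
      by (intro exI[of _ "n + 1"]) (simp add: win_eq_iff shiftn_apply shift_map_eq)
  qed
qed

theorem theoremA:
  fixes xs :: config and b :: real
  assumes "ohno_point xs"
    and "0 < b"
    and "ereal b < topological_entropy (top_of_set (orbit_closure xs)) shift_map"
  shows "\<exists>\<gamma> \<Phi> \<nu>.
           roof_function (punctured (orbit_closure xs)) \<gamma> \<and>
           suspension_flow (punctured (orbit_closure xs)) \<gamma> \<Phi> \<and>
           \<nu> \<in> ergodic_measures (susp_compactification (punctured (orbit_closure xs)) \<gamma>) \<Phi> \<and>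
           flow_measure_entropy \<nu> \<Phi> = ereal b"
proof -
  let ?X = "orbit_closure xs"
  obtain w w' y z where words: "ohno_words w w'" and lim: "ohno_limit w y" and fil: "ohno_filling w y z"
    and xs: "xs = (\<lambda>k. if k = 0 then False else z (nat \<bar>k\<bar>))"
    using assms(1) unfolding ohno_point_def by blast
  have xs_pos: "xs k = z (nat k)" if "0 < k" for k using that by (simp add: xs)
  interpret ohno_skeleton "\<lambda>n. w (Suc n)" "\<lambda>n. w' (Suc n)"
  proof
    show "w (Suc 0) = [sym_one, placeholder]" using words by (simp add: ohno_words_def)
    show "w (Suc (Suc n)) = w (Suc n) @ w' (Suc n) @ w (Suc n)" for n using words by (simp add: ohno_words_def)
    show "\<exists>i<length (w (Suc n)). w (Suc n) ! i = placeholder \<and> w' (Suc n) = (w (Suc n))[i := sym_one]" for n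
      using words by (simp add: ohno_words_def)
  qed
  \<comment> \<open>Since \<open>e n < s\<close>, the occurrence lies to the right of the origin,
    where \<open>xs\<close> agrees with \<open>z\<close>.\<close>
  have filled: "\<exists>s>0. \<forall>k<period n. z (s + k) = v ! k" if "fills (w (Suc n)) v" for n v
  proof -
    obtain S and e :: "nat \<Rightarrow> nat" where S: "\<forall>n\<ge>1.
           finite (S n) \<and> card (S n) = 2 ^ num_placeholders n \<and>
           (\<forall>s\<in>S n. e (n - 1) < s \<and> (\<forall>k<length (w n). y (s + k) = w n ! k)) \<and>
           e n = Max (S n) + length (w n) - 1 \<and>
           (\<forall>v. fills (w n) v \<longrightarrow> (\<exists>s\<in>S n. \<forall>k<length (w n). z (s + k) = v ! k)) \<and>
           (\<forall>k. e (n - 1) < k \<and> k \<le> e n \<and> y k = placeholder \<and>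
                k \<notin> (\<Union>s\<in>S n. {s..<s + length (w n)}) \<longrightarrow> z k)"
      using fil unfolding ohno_filling_def by (elim conjE exE)
    from S[rule_format, of "Suc n"] have S1: "\<forall>s\<in>S (Suc n). e n < s"
      and S2: "\<forall>v. fills (w (Suc n)) v \<longrightarrow> (\<exists>s\<in>S (Suc n). \<forall>k<length (w (Suc n)). z (s + k) = v ! k)"
      by simp_all
    from S2 that obtain s where s: "s \<in> S (Suc n)" "\<forall>k<length (w (Suc n)). z (s + k) = v ! k" by blast
    moreover have "0 < s" using S1 s(1) by force
    ultimately show ?thesis unfolding length_W by blast
  qed
  have one: "(\<lambda>_. True) \<in> ?X"
    unfolding orbit_closure_iff
  proof
    fix K
    let ?N = "Suc K"
    \<comment> \<open>The number of ones guaranteed in \<open>w' (Suc K)\<close> is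
      \<open>2 * K + 1\<close>, exactly the width of a window of radius \<open>K\<close>.\<close>
    define r where "r = replicate (2 * Suc K - 1) sym_one"
    have r: "length r = 2 * K + 1" "\<And>j. j < 2 * K + 1 \<Longrightarrow> r ! j = sym_one"
      unfolding r_def by (simp, intro nth_replicate) simp
    obtain u v where uv: "w' ?N = u @ r @ v"
      using words unfolding ohno_words_def contains_ones_def r_def by (metis le_add1 plus_1_eq_Suc)
    \<comment> \<open>\<open>w' ?N\<close> is the middle third of \<open>w (Suc ?N)\<close> and so
      starts after \<open>period K\<close> symbols. Its ones are no placeholders of that word and
      survive the filling.\<close>
    define p where "p = period K + length u"
    have ones: "z (Suc (p + j)) = True" if j: "j < 2 * K + 1" for j
    proof -
      have "w (Suc ?N) = w ?N @ (u @ r @ v) @ w ?N" using W_Suc[of K] uv by simp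
      moreover have "length (w ?N) = period K" using length_W[of K] by simp
      ultimately have wj: "w (Suc ?N) ! (p + j) = sym_one" "p + j < length (w (Suc ?N))"
        using j r by (simp_all add: p_def nth_append)
      then have "y (Suc (p + j)) = sym_one" using lim unfolding ohno_limit_def by (metis le_add1 plus_1_eq_Suc)
      moreover have "\<forall>k\<ge>1. y k \<noteq> placeholder \<longrightarrow> y k = Some (z k)" using fil by (simp add: ohno_filling_def)
      ultimately have "Some (z (Suc (p + j))) = sym_one" by (metis le_add1 option.distinct(1) plus_1_eq_Suc)
      then show ?thesis by simp
    qed
    \<comment> \<open>As \<open>y\<close> and \<open>z\<close> are indexed from 1, the run of ones
      begins at position p + 1, so this is its centre.\<close>
    have "xs (i + (1 + int p + int K)) = True" if i: "\<bar>i\<bar> \<le> int K" for i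
    proof -
      let ?j = "nat (i + int K)"
      have "?j < 2 * K + 1" "nat (i + (1 + int p + int K)) = Suc (p + ?j)" using i by auto
      then show ?thesis using ones[of ?j] xs_pos[of "i + (1 + int p + int K)"] i by auto
    qed
    then show "\<exists>n. win K (shiftn n xs) = win K (\<lambda>_. True)"
      by (intro exI[of _ "1 + int p + int K"]) (simp add: win_eq_iff shiftn_apply)
  qed
  have closedX: "closed ?X" by (simp add: orbit_closure_def)
  \<comment> \<open>Almost surely a window of any radius lies inside one block of some level; that
    block is a filling of \<open>W n\<close>, and all fillings occur in \<open>xs\<close>.\<close>
  have "AE \<omega> in Om. pil \<omega> \<in> ?X"
    using AE_offset_inside
  proof eventually_elim
    case (elim \<omega>)
    show ?case
      unfolding orbit_closure_iff
    proof
      fix K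
      obtain n where n: "K \<le> offset n (fst \<omega>)" "offset n (fst \<omega>) + K < period n" using elim by blast
      let ?o = "offset n (fst \<omega>)"
      obtain s where s: "0 < s" "\<And>k. k < period n \<Longrightarrow> z (s + k) = pil \<omega> (int k - int ?o)"
        using filled[OF pil_fills[of n \<omega>]] by auto
      have "xs (i + (int s + int ?o)) = pil \<omega> i" if i: "\<bar>i\<bar> \<le> int K" for i
      proof -
        let ?k = "nat (i + int ?o)"
        have k: "?k < period n" "int ?k = i + int ?o" "nat (i + (int s + int ?o)) = s + ?k"
          using i n by auto
        have "xs (i + (int s + int ?o)) = z (s + ?k)" using xs_pos[of "i + (int s + int ?o)"] k i n s(1) by simp
        then show ?thesis using s(2)[OF k(1)] k(2) by simp
      qed
      then show "\<exists>n. win K (shiftn n xs) = win K (pil \<omega>)"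
        by (intro exI[of _ "int s + int ?o"]) (simp add: win_eq_iff shiftn_apply)
    qed
  qed
  then have "AE x in mu. x \<in> ?X"
    unfolding mu_def using closedX by (subst AE_distr_iff[OF measurable_pil]) auto
  with mu_not_one have muY: "AE x in mu. x \<in> punctured ?X"
    by eventually_elim (simp add: punctured_def)
  obtain h where h: "0 < h" "(\<lambda>n. ent mu (wrd n) / real n) \<longlonglongrightarrow> h" using ent_mu_limit by blast
  have inv: "emeasure mu (shift_map -` A) = emeasure mu A" if "A \<in> sets borel" for A
    using mu_shift[OF that, of 1] by (simp add: shift_map_eq)
  interpret S: suspension_measure ?X "h / b" mu h
  proof unfold_locales
    show "measure mu A = 0 \<or> measure mu A = 1" if "A \<in> sets borel" "shift_map -` A = A" for A
      using that by (rule mu_ergodic)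
    show "closed ?X" by (rule closedX)
    show "shift_map x \<in> ?X \<longleftrightarrow> x \<in> ?X" for x by (rule orbit_closure_shift)
    show "(\<lambda>_. True) \<in> ?X" by (rule one)
    show "0 < h / b" using h(1) assms(2) by simp
    show "sets mu = sets borel" by (rule sets_mu)
    show "emeasure mu (shift_map -` A) = emeasure mu A" if "A \<in> sets borel" for A using that by (rule inv)
    show "AE x in mu. x \<in> punctured ?X" by (rule muY)
    show "(\<lambda>n. ent mu (wrd n) / real n) \<longlonglongrightarrow> h" by (rule h(2))
  qed
  have "h * S.\<tau> = b" using h(1) assms(2) by (simp add: S.\<tau>_def)
  then have "flow_measure_entropy S.\<nu> S.flow = ereal b"
    using S.measure_entropy_nu by (simp add: flow_measure_entropy_def)
  then show ?thesis
    using S.roof_function_const S.suspension_flow_flow S.nu_ergodic by blast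
qed

end
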